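(* Let $H_l$ be an $n\times l$ matrix of SRHT or SRFT, where $$4\big(\sqrt r+\sqrt{8\log(rn)}\,\big)^2\log(r)\le l\le n.$$ Let $W_r$ be an $r\times n$ matrix with singular values $\sigma_j=\sigma_j(W_r)$, $j=1,\dots,r$, listed in nonincreasing order, and let $\sigma_r>0$. Then $$0.40\,\sigma_r\le\sigma_r(W_rH_l)\quad\text{and}\quad \sigma_1(W_rH_l)\le 1.48\,\sigma_1$$ with failure probability in $O(1/r)$.
   Context: $\sigma_j(M)$ denotes the $j$th largest singular value of $M$. An $n\times l$ matrix $H_l$ of a subsampled randomized Hadamard or Fourier transform (SRHT or SRFT) is obtained as follows. Let $F$ be the $n\times n$ Walsh–Hadamard matrix (for $n$ a power of $2$) or the $n\times n$ discrete Fourier transform matrix $(\omega_n^{ij})_{i,j=0}^{n-1}$, $\omega_n=\exp(2\pi\sqrt{-1}/n)$, in either case scaled by $1/\sqrt n$ so as to be unitary. The Walsh–Hadamard matrices are defined by $H_2=\begin{pmatrix}1&1\\1&-1\end{pmatrix}$ and $H_{2q}=\begin{pmatrix}H_q&H_q\\H_q&-H_q\end{pmatrix}$. Let $D$ be a random $n\times n$ diagonal matrix whose diagonal entries are independent and uniformly distributed on the complex unit circle, and let $P$ be a random $n\times n$ permutation matrix. Sample $l$ columns of $DFP$ uniformly at random and without replacement and multiply the resulting $n\times l$ matrix by $\sqrt{n/l}$; the result is $H_l$. (SRHT refers to the Hadamard case, SRFT to the Fourier case.) *)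

theory Defs
  imports
    "HOL-Probability.Probability"
    "Jordan_Normal_Form.Schur_Decomposition"
begin

section \<open>Singular values\<close>

text \<open>
  The singular values of an \<open>m \<times> n\<close> matrix \<open>M\<close> are the \<open>min m n\<close> largest square roots of the
  eigenvalues of \<open>M\<^sup>* M\<close>, counted with multiplicity (for \<open>m < n\<close> the remaining \<open>n - m\<close>
  eigenvalues are zero). These eigenvalues are real and nonnegative, so \<open>Re\<close> only changes the type.
\<close>

definition singular_values :: "complex mat \<Rightarrow> real list" where
  "singular_values M =
     take (min (dim_row M) (dim_col M))
       (rev (sorted_list_of_multiset
          (image_mset (\<lambda>z. sqrt (Re z)) (proots (char_poly (mat_adjoint M * M))))))"

text \<open>Indices start at 1; the value outside \<open>1..min m n\<close> is 0 by convention.\<close>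

definition sigma_val :: "nat \<Rightarrow> complex mat \<Rightarrow> real" where
  "sigma_val j M =
     (if 1 \<le> j \<and> j \<le> length (singular_values M) then singular_values M ! (j - 1) else 0)"


section \<open>Unitary Walsh--Hadamard and Fourier matrices\<close>

text \<open>The Walsh--Hadamard matrix of size \<open>2 ^ k\<close>, without scaling.\<close>

fun walsh_hadamard :: "nat \<Rightarrow> complex mat" where
  "walsh_hadamard 0 = 1\<^sub>m 1"
| "walsh_hadamard (Suc k) =
     four_block_mat (walsh_hadamard k) (walsh_hadamard k) (walsh_hadamard k) (- walsh_hadamard k)"

definition unitary_hadamard :: "nat \<Rightarrow> complex mat" where
  "unitary_hadamard k = complex_of_real (1 / sqrt (2 ^ k)) \<cdot>\<^sub>m walsh_hadamard k"

definition unitary_dft :: "nat \<Rightarrow> complex mat" where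
  "unitary_dft n =
     complex_of_real (1 / sqrt (real n)) \<cdot>\<^sub>m
       Matrix.mat n n (\<lambda>(i, j). exp (2 * of_real pi * \<i> / of_nat n) ^ (i * j))"

lemma walsh_hadamard_carrier [simp]: "walsh_hadamard k \<in> carrier_mat (2 ^ k) (2 ^ k)"
proof (induction k)
  case (Suc k)
  then show ?case by (auto simp: mult_2)
qed auto

lemma walsh_hadamard_2: "walsh_hadamard 1 = mat_of_rows_list 2 [[1, 1], [1, -1]]"
proof (rule eq_matI)
  fix i j
  assume "i < dim_row (mat_of_rows_list 2 [[1, 1], [1, -1 :: complex]])"
     and "j < dim_col (mat_of_rows_list 2 [[1, 1], [1, -1 :: complex]])"
  then have "i = 0 \<or> i = 1" "j = 0 \<or> j = 1"
    by (auto simp: mat_of_rows_list_def)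
  then show "walsh_hadamard 1 $$ (i, j) = mat_of_rows_list 2 [[1, 1], [1, -1]] $$ (i, j)"
    by (auto simp: mat_of_rows_list_def)
qed (auto simp: mat_of_rows_list_def)


section \<open>Subsampled randomized transforms\<close>

definition uniform_circle :: "complex measure" where
  "uniform_circle = distr (uniform_measure lborel {0..2 * pi}) borel cis"

text \<open>
  A sample point \<open>(d, p, s)\<close> consists of the diagonal entries of \<open>D\<close>, the permutation
  defining \<open>P\<close>, and the sampled column indices in the order in which they are drawn; uniform sampling
  of \<open>l\<close> indices without replacement makes all lists of \<open>l\<close> distinct indices equally likely.
  The three components are independent.
\<close>

definition transform_space ::
  "nat \<Rightarrow> nat \<Rightarrow> ((nat \<Rightarrow> complex) \<times> (nat \<Rightarrow> nat) \<times> nat list) measure" where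
  "transform_space n l =
     (\<Pi>\<^sub>M i\<in>{..<n}. uniform_circle) \<Otimes>\<^sub>M
     (measure_pmf (pmf_of_set {p. p permutes {..<n}}) \<Otimes>\<^sub>M
      measure_pmf (pmf_of_set {s. length s = l \<and> distinct s \<and> set s \<subseteq> {..<n}}))"

definition perm_mat :: "nat \<Rightarrow> (nat \<Rightarrow> nat) \<Rightarrow> complex mat" where
  "perm_mat n p = Matrix.mat n n (\<lambda>(i, j). if i = p j then 1 else 0)"

definition subsampled_transform ::
  "complex mat \<Rightarrow> nat \<Rightarrow> nat \<Rightarrow> (nat \<Rightarrow> complex) \<times> (nat \<Rightarrow> nat) \<times> nat list \<Rightarrow> complex mat" where
  "subsampled_transform F n l = (\<lambda>(d, p, s).
     complex_of_real (sqrt (real n / real l)) \<cdot>\<^sub>m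
       mat_of_cols n (map (col (mat_diag n d * F * perm_mat n p)) s))"

end

theory Submission
  imports Defs
begin

text \<open>
  Write \<open>W = T Q\<close> where \<open>Q\<close> has orthonormal rows (\<open>orthonormal_row_factor\<close>). Singular values are
  governed by Gram matrices, and \<open>z\<^sup>* W H\<close> is \<open>y\<^sup>* Q H\<close> with \<open>\<parallel>y\<parallel> = \<parallel>z\<^sup>* W\<parallel>\<close>; so it suffices that
  \<open>S = Q H (Q H)\<^sup>*\<close> has all its eigenvalues between \<open>0.40\<^sup>2\<close> and \<open>1.48\<^sup>2\<close>. Let \<open>x\<^sub>J\<close> be the columns of
  \<open>sqrt (n / l) Q D F\<close>. As \<open>D F\<close> is unitary, the \<open>x\<^sub>J x\<^sub>J\<^sup>*\<close> add up to \<open>(n / l) I\<close>, and \<open>S\<close> is the sum of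
  \<open>l\<close> of them, drawn without replacement. Its mean is the identity, and two things have to be shown.

  No \<open>x\<^sub>J\<close> is long. Every entry of \<open>F\<close> has modulus \<open>1 / sqrt n\<close>, so \<open>sqrt l x\<^sub>J\<close> is a sum of the
  columns of \<open>Q\<close>, up to unimodular constants, with independent coefficients uniform on the circle.
  Such a coefficient has a smaller moment generating function than a complex Gaussian, and
  linearising the square of the norm by an auxiliary Gaussian vector transfers this to the norm
  (\<open>circle_sum_norm_tail\<close>): with \<open>M = (sqrt r + sqrt (8 ln (r n)))\<^sup>2\<close>, all \<open>\<parallel>x\<^sub>J\<parallel>\<^sup>2\<close> are at most \<open>M / l\<close>
  except with probability \<open>1 / r\<close>.

  The sum concentrates. This is a matrix Chernoff bound (\<open>perm_chernoff\<close>). The trace of \<open>exp (s S)\<close>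
  is followed while the samples are added one by one. For a rank-one update, the two eigenbases are
  compared through the squared moduli of their inner products, a doubly stochastic matrix; this
  reduces the growth of the trace to an inequality between real functions of the
  difference of two eigenvalues (\<open>rank_one_update\<close>). Averaged over a tight frame, the growth is a
  constant factor (\<open>exp_trace_frame_average\<close>). That a sample is fresh rather than independent of the
  earlier ones only helps, because the trace of the exponential is convex and the order of the
  samples is exchangeable (\<open>perm_exp_trace_insert_le_reused\<close>). Since \<open>4 M ln r \<le> l\<close>, each of the two
  tails has probability at most \<open>1 / r\<close>. The total is \<open>3 / r\<close>, which is
  a trivial bound for \<open>r = 1\<close>.
\<close>

section \<open>The spectral theorem\<close>

lemma dim_mat_adjoint [simp]:
  "dim_row (mat_adjoint M) = dim_col M" "dim_col (mat_adjoint M) = dim_row M"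
  unfolding mat_adjoint_def by (simp_all add: mat_of_rows_def)

lemma mat_adjoint_carrier [simp]:
  "M \<in> carrier_mat m n \<Longrightarrow> mat_adjoint M \<in> carrier_mat n m"
  by (intro carrier_matI) (simp_all add: carrier_matD)

lemma index_mat_adjoint [simp]:
  fixes M :: "complex mat"
  shows "i < dim_col M \<Longrightarrow> j < dim_row M \<Longrightarrow> mat_adjoint M $$ (i, j) = cnj (M $$ (j, i))"
  unfolding mat_adjoint_def by (auto simp: mat_of_rows_def)

lemma mat_adjoint_mult:
  fixes M :: "complex mat"
  assumes "M \<in> carrier_mat m n" "N \<in> carrier_mat n q"
  shows "mat_adjoint (M * N) = mat_adjoint N * mat_adjoint M"
  by (rule eq_matI) (use assms in \<open>auto simp: scalar_prod_def mult.commute\<close>)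

lemma mat_adjoint_adjoint [simp]:
  fixes M :: "complex mat"
  shows "mat_adjoint (mat_adjoint M) = M"
  by (rule eq_matI) auto

definition unitary_matrix :: "nat \<Rightarrow> complex mat \<Rightarrow> bool" where
  "unitary_matrix r U \<longleftrightarrow>
     U \<in> carrier_mat r r \<and> mat_adjoint U * U = 1\<^sub>m r \<and> U * mat_adjoint U = 1\<^sub>m r"

lemma unitary_matrixI:
  assumes "U \<in> carrier_mat r r" "mat_adjoint U * U = 1\<^sub>m r"
  shows "unitary_matrix r U"
  using assms mat_mult_left_right_inverse[of "mat_adjoint U" r U]
  unfolding unitary_matrix_def by auto

text \<open>
  The deflation step of the spectral theorem: Gram--Schmidt extends an eigenvector to an orthogonal
  basis, whose vectors are then normalised.
\<close>

lemma unitary_with_eigenvector: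
  fixes A :: "complex mat"
  assumes A: "A \<in> carrier_mat n n" and n: "n \<noteq> 0"
  shows "\<exists>U e. unitary_matrix n U \<and> col (A * U) 0 = e \<cdot>\<^sub>v col U 0"
proof -
  obtain as where as: "char_poly A = (\<Prod>a \<leftarrow> as. [:- a, 1:])" "length as = n"
    using char_poly_factorized[OF A] by blast
  then obtain e es where "as = e # es" using n by (cases as) auto
  then have "poly (char_poly A) e = 0" using as by simp
  then have e: "eigenvalue A e" using eigenvalue_root_char_poly[OF A] by simp
  then obtain v where ev: "eigenvector A v e" unfolding eigenvalue_def by auto
  then have v: "v \<in> carrier_vec n" and v0: "v \<noteq> 0\<^sub>v n" and Av: "A *\<^sub>v v = e \<cdot>\<^sub>v v"
    using A unfolding eigenvector_def by auto
  interpret cof_vec_space n "TYPE(complex)" .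
  define b where "b = basis_completion v"
  define ws where "ws = gram_schmidt n b"
  from basis_completion[OF v v0, folded b_def]
  have dist_b: "distinct b" and indep: "\<not> lin_dep (set b)" and b: "set b \<subseteq> carrier_vec n"
    and hdb: "hd b = v" and len_b: "length b = n" by auto
  from hdb len_b n obtain vs where bv: "b = v # vs" by (cases b, auto)
  from gram_schmidt_result[OF b dist_b indep refl, folded ws_def]
  have ws: "set ws \<subseteq> carrier_vec n" "corthogonal ws" "length ws = n"
    by (auto simp: len_b)
  have hdws: "hd ws = v" unfolding ws_def using gram_schmidt_hd[OF v, of vs, folded bv] .
  have wsc: "ws ! j \<in> carrier_vec n" if "j < n" for j using ws that by auto
  define c where "c j = complex_of_real (1 / sqrt (Re (ws ! j \<bullet>c ws ! j)))" for j
  define U where "U = Matrix.mat n n (\<lambda>(i, j). c j * (ws ! j) $ i)"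
  have U: "U \<in> carrier_mat n n" unfolding U_def by simp
  have real: "complex_of_real (Re (ws ! j \<bullet>c ws ! j)) = ws ! j \<bullet>c ws ! j" for j
  proof -
    have "0 \<le> ws ! j \<bullet>c ws ! j" by (rule conjugate_square_ge_0_vec)
    then show ?thesis by (auto simp: less_eq_complex_def complex_eq_iff)
  qed
  have pos: "Re (ws ! j \<bullet>c ws ! j) > 0" if "j < n" for j
  proof -
    have "0 \<le> ws ! j \<bullet>c ws ! j" by (rule conjugate_square_ge_0_vec)
    moreover have "ws ! j \<bullet>c ws ! j \<noteq> 0"
      using corthogonalD[OF ws(2), of j j] that ws(3) by simp
    ultimately show ?thesis by (auto simp: less_eq_complex_def complex_eq_iff)
  qed
  have entry: "(mat_adjoint U * U) $$ (i, j) = cnj (c i) * c j * (ws ! j \<bullet>c ws ! i)"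
    if ij: "i < n" "j < n" for i j
  proof -
    have "(mat_adjoint U * U) $$ (i, j) = (\<Sum>k = 0..<n. cnj (U $$ (k, i)) * U $$ (k, j))"
      using U ij by (simp add: scalar_prod_def)
    also have "\<dots> = cnj (c i) * c j * (\<Sum>k = 0..<n. (ws ! j) $ k * cnj ((ws ! i) $ k))"
      unfolding U_def sum_distrib_left using ij by (intro sum.cong) auto
    also have "(\<Sum>k = 0..<n. (ws ! j) $ k * cnj ((ws ! i) $ k)) = ws ! j \<bullet>c ws ! i"
      using wsc[OF ij(1)] by (simp add: scalar_prod_def)
    finally show ?thesis .
  qed
  have "mat_adjoint U * U = 1\<^sub>m n"
  proof (rule eq_matI)
    fix i j assume "i < dim_row (1\<^sub>m n :: complex mat)" "j < dim_col (1\<^sub>m n :: complex mat)"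
    then have ij: "i < n" "j < n" by auto
    show "(mat_adjoint U * U) $$ (i, j) = 1\<^sub>m n $$ (i, j)"
    proof (cases "i = j")
      case True
      define q where "q = Re (ws ! j \<bullet>c ws ! j)"
      have cj: "c j = complex_of_real (1 / sqrt q)" and rq: "ws ! j \<bullet>c ws ! j = complex_of_real q"
        unfolding c_def q_def using real[of j] by simp_all
      have "(mat_adjoint U * U) $$ (i, j) = cnj (c j) * c j * (ws ! j \<bullet>c ws ! j)"
        using entry[OF ij] True by simp
      also have "\<dots> = complex_of_real (1 / sqrt q * (1 / sqrt q) * q)"
        unfolding cj rq by (simp only: complex_cnj_complex_of_real of_real_mult)
      also have "1 / sqrt q * (1 / sqrt q) * q = 1"
        using pos[OF ij(2)] unfolding q_def[symmetric] by simp
      finally show ?thesis using True ij by simp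
    next
      case False
      then have "ws ! j \<bullet>c ws ! i = 0"
        using corthogonalD[OF ws(2), of j i] ij ws(3) by simp
      then show ?thesis unfolding entry[OF ij] using False ij by simp
    qed
  qed (use U in auto)
  then have uU: "unitary_matrix n U" using U by (intro unitary_matrixI)
  have ws0: "ws ! 0 = v" using hdws ws(3) n by (cases ws) auto
  have col0: "col U 0 = c 0 \<cdot>\<^sub>v v"
    by (rule eq_vecI) (use n v in \<open>auto simp: U_def ws0\<close>)
  have "col (A * U) 0 = A *\<^sub>v col U 0"
    using A U n by (intro eq_vecI) (auto simp: scalar_prod_def)
  also have "\<dots> = c 0 \<cdot>\<^sub>v (A *\<^sub>v v)" unfolding col0 using A v by (simp add: mult_mat_vec)
  also have "\<dots> = e \<cdot>\<^sub>v col U 0" unfolding Av col0 by (simp add: smult_smult_assoc mult.commute)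
  finally show ?thesis using uU by blast
qed

lemma mult_square_carrier [simp]:
  "A \<in> carrier_mat n n \<Longrightarrow> B \<in> carrier_mat n m \<Longrightarrow> A * B \<in> carrier_mat n m"
  "A \<in> carrier_mat n m \<Longrightarrow> C \<in> carrier_mat m m \<Longrightarrow> A * C \<in> carrier_mat n m"
  by auto

lemma index_mat_diag [simp]:
  "i < n \<Longrightarrow> j < n \<Longrightarrow> mat_diag n f $$ (i, j) = (if i = j then f j else 0)"
  by (simp add: mat_diag_def)

abbreviation real_diag :: "nat \<Rightarrow> (nat \<Rightarrow> real) \<Rightarrow> complex mat" where
  "real_diag r a \<equiv> mat_diag r (\<lambda>i. complex_of_real (a i))"

text \<open>
  In a unitary basis that starts with an eigenvector, the first column of a Hermitian matrix vanishes
  below the diagonal, hence so does its first row to the right of it, and the rest is a smaller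
  Hermitian matrix.
\<close>

lemma hermitian_unitary_diagonalization:
  fixes A :: "complex mat"
  assumes "A \<in> carrier_mat r r" "mat_adjoint A = A"
  shows "\<exists>U a. unitary_matrix r U \<and> mat_adjoint U * A * U = real_diag r a"
  using assms
proof (induction r arbitrary: A)
  case 0
  have "unitary_matrix 0 (1\<^sub>m 0)" by (intro unitary_matrixI) auto
  moreover have "mat_adjoint (1\<^sub>m 0) * A * 1\<^sub>m 0 = mat_diag 0 (\<lambda>i. complex_of_real (0))"
    by (rule eq_matI) (auto simp: mat_diag_def)
  ultimately show ?case by (intro exI[of _ "1\<^sub>m 0"] exI[of _ "\<lambda>_. 0"] conjI)
next
  case (Suc r)
  let ?n = "Suc r"
  from unitary_with_eigenvector[OF Suc.prems(1)] obtain W e where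
    W: "unitary_matrix ?n W" and ev: "col (A * W) 0 = e \<cdot>\<^sub>v col W 0" by auto
  have Wc [simp]: "W \<in> carrier_mat ?n ?n" and WW: "mat_adjoint W * W = 1\<^sub>m ?n"
    using W unfolding unitary_matrix_def by auto
  note A [simp] = Suc.prems(1)
  note dims = carrier_matD[OF A] carrier_matD[OF Wc]
  define A' where "A' = mat_adjoint W * A * W"
  have A'c [simp]: "A' \<in> carrier_mat ?n ?n" unfolding A'_def by simp
  note dims' = carrier_matD[OF A'c]
  have hA': "mat_adjoint A' = A'" unfolding A'_def
    using Suc.prems(2) by (simp add: mat_adjoint_mult[of _ ?n ?n _ ?n] assoc_mult_mat[of _ ?n ?n _ ?n _ ?n])
  have A'0: "A' $$ (i, 0) = (if i = 0 then e else 0)" if i: "i < ?n" for i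
  proof -
    have "A' = mat_adjoint W * (A * W)" unfolding A'_def by (simp add: assoc_mult_mat[of _ ?n ?n _ ?n _ ?n])
    then have "A' $$ (i, 0) = row (mat_adjoint W) i \<bullet> col (A * W) 0"
      using i dims by (simp del: col_mult2)
    also have "\<dots> = e * (row (mat_adjoint W) i \<bullet> col W 0)"
      unfolding ev using i dims by (simp add: scalar_prod_def sum_distrib_left ring_distribs mult.left_commute)
    also have "row (mat_adjoint W) i \<bullet> col W 0 = (mat_adjoint W * W) $$ (i, 0)"
      using i dims by simp
    finally show ?thesis unfolding WW using i by simp
  qed
  have A'0': "A' $$ (0, i) = (if i = 0 then e else 0)" if i: "i < ?n" for i
  proof -
    have "A' $$ (0, i) = mat_adjoint A' $$ (0, i)" using hA' by simp
    also have "\<dots> = cnj (A' $$ (i, 0))" using i dims' by (subst index_mat_adjoint) auto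
    finally have *: "A' $$ (0, i) = cnj (A' $$ (i, 0))" .
    show ?thesis
    proof (cases "i = 0")
      case True then show ?thesis using A'0[OF i] by simp
    next
      case False then show ?thesis using A'0[OF i] * by simp
    qed
  qed
  have ereal: "e = complex_of_real (Re e)"
  proof -
    have "A' $$ (0, 0) = mat_adjoint A' $$ (0, 0)" using hA' by simp
    also have "\<dots> = cnj (A' $$ (0, 0))" using dims' by (subst index_mat_adjoint) auto
    finally have "e = cnj e" using A'0[of 0] by simp
    then show ?thesis by (simp add: complex_eq_iff)
  qed
  define A3 where "A3 = Matrix.mat r r (\<lambda>(i, j). A' $$ (Suc i, Suc j))"
  have A3c [simp]: "A3 \<in> carrier_mat r r" unfolding A3_def by simp
  have hA3: "mat_adjoint A3 = A3"
  proof (rule eq_matI)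
    fix i j assume ij: "i < dim_row A3" "j < dim_col A3"
    then have ij': "i < r" "j < r" unfolding A3_def by auto
    have "mat_adjoint A3 $$ (i, j) = cnj (A' $$ (Suc j, Suc i))" using ij' A3c unfolding A3_def by simp
    also have "\<dots> = mat_adjoint A' $$ (Suc i, Suc j)" using ij' dims' by (subst index_mat_adjoint) auto
    also have "\<dots> = A3 $$ (i, j)" unfolding hA' A3_def using ij' by simp
    finally show "mat_adjoint A3 $$ (i, j) = A3 $$ (i, j)" .
  qed (use carrier_matD[OF A3c] in auto)
  have block: "A' = four_block_mat (mat_diag 1 (\<lambda>_. e)) (0\<^sub>m 1 r) (0\<^sub>m r 1) A3"
    by (rule eq_matI) (use A'0 A'0' dims' in \<open>auto simp: A3_def mat_diag_def\<close>)
  from Suc.IH[OF A3c hA3] obtain U3 a3 where U3: "unitary_matrix r U3"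
    and d3: "mat_adjoint U3 * A3 * U3 = real_diag r a3" by blast
  have U3c [simp]: "U3 \<in> carrier_mat r r" and UU3: "mat_adjoint U3 * U3 = 1\<^sub>m r"
    using U3 unfolding unitary_matrix_def by auto
  note zeros = left_mult_zero_mat[OF U3c] left_mult_zero_mat[OF A3c]
    right_mult_zero_mat[OF mat_adjoint_carrier[OF U3c]] right_mult_zero_mat[OF U3c] right_mult_zero_mat[OF A3c]
    right_mult_zero_mat[of "mat_adjoint U3 * A3" r r] left_mult_zero_mat[OF mat_diag_dim]
    left_mult_one_mat[OF mat_diag_dim] right_mult_one_mat[OF mat_diag_dim] right_mult_zero_mat[OF mat_diag_dim]
  define V where "V = four_block_mat (1\<^sub>m 1) (0\<^sub>m 1 r) (0\<^sub>m r 1) U3"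
  have Vc [simp]: "V \<in> carrier_mat ?n ?n" unfolding V_def using four_block_carrier_mat[of "1\<^sub>m 1" 1 1 U3 r r] by simp
  have aV: "mat_adjoint V = four_block_mat (1\<^sub>m 1) (0\<^sub>m 1 r) (0\<^sub>m r 1) (mat_adjoint U3)"
    unfolding V_def by (rule eq_matI) (use carrier_matD[OF U3c] in auto)
  have VV: "mat_adjoint V * V = 1\<^sub>m ?n"
  proof -
    have "mat_adjoint V * V = four_block_mat (1\<^sub>m 1) (0\<^sub>m 1 r) (0\<^sub>m r 1) (1\<^sub>m r)"
      unfolding aV unfolding V_def
      by (subst mult_four_block_mat[of _ 1 1 _ r _ r _ _ 1 _ r]) (auto simp: UU3 zeros)
    also have "\<dots> = 1\<^sub>m ?n" by (rule eq_matI) auto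
    finally show ?thesis .
  qed
  define a where "a i = (if i = 0 then Re e else a3 (i - 1))" for i
  have VAV: "mat_adjoint V * A' * V = real_diag ?n a"
  proof -
    have "mat_adjoint V * A' = four_block_mat (mat_diag 1 (\<lambda>_. e)) (0\<^sub>m 1 r) (0\<^sub>m r 1) (mat_adjoint U3 * A3)"
      unfolding aV block
      by (subst mult_four_block_mat[of _ 1 1 _ r _ r _ _ 1 _ r]) (auto simp: zeros)
    then have "mat_adjoint V * A' * V =
      four_block_mat (mat_diag 1 (\<lambda>_. e)) (0\<^sub>m 1 r) (0\<^sub>m r 1) (mat_adjoint U3 * A3 * U3)"
      unfolding V_def
      by (simp, subst mult_four_block_mat[of _ 1 1 _ r _ r _ _ 1 _ r]) (auto simp: zeros)
    also have "\<dots> = real_diag ?n a"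
      unfolding d3 by (rule eq_matI) (auto simp: mat_diag_def a_def ereal[symmetric])
    finally show ?thesis .
  qed
  have "unitary_matrix ?n (W * V)"
  proof (rule unitary_matrixI)
    have "mat_adjoint (W * V) * (W * V) = mat_adjoint V * (mat_adjoint W * W) * V"
      by (simp add: mat_adjoint_mult[of _ ?n ?n _ ?n] assoc_mult_mat[of _ ?n ?n _ ?n _ ?n])
    then show "mat_adjoint (W * V) * (W * V) = 1\<^sub>m ?n"
      unfolding WW using VV right_mult_one_mat[OF mat_adjoint_carrier[OF Vc]] by simp
  qed simp
  moreover have "mat_adjoint (W * V) * A * (W * V) = mat_adjoint V * A' * V"
    unfolding A'_def by (simp add: mat_adjoint_mult[of _ ?n ?n _ ?n] assoc_mult_mat[of _ ?n ?n _ ?n _ ?n])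
  ultimately show ?case using VAV by (intro exI[of _ "W * V"] exI[of _ a] conjI) simp_all
qed

section \<open>Traces of exponentials under rank-one updates\<close>

abbreviation norm_square :: "nat \<Rightarrow> (nat \<Rightarrow> complex) \<Rightarrow> real" where
  "norm_square r x \<equiv> \<Sum>i<r. (cmod (x i))\<^sup>2"

lemma mult_adjoint_diagonal:
  fixes M :: "complex mat"
  assumes "M \<in> carrier_mat m n" "i < m"
  shows "(M * mat_adjoint M) $$ (i, i) = complex_of_real (\<Sum>j<n. (cmod (M $$ (i, j)))\<^sup>2)"
  using assms carrier_matD[OF assms(1)]
  by (simp add: scalar_prod_def complex_norm_square lessThan_atLeast0 mult.commute del: of_real_power)

lemma adjoint_mult_diagonal:
  fixes M :: "complex mat"
  assumes "M \<in> carrier_mat m n" "j < n"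
  shows "(mat_adjoint M * M) $$ (j, j) = complex_of_real (\<Sum>i<m. (cmod (M $$ (i, j)))\<^sup>2)"
  using assms carrier_matD[OF assms(1)]
  by (simp add: scalar_prod_def complex_norm_square lessThan_atLeast0 mult.commute del: of_real_power)

definition column_matrix :: "nat \<Rightarrow> (nat \<Rightarrow> complex) \<Rightarrow> complex mat" where
  "column_matrix r x = Matrix.mat r 1 (\<lambda>(i, _). x i)"

definition rank_one :: "nat \<Rightarrow> (nat \<Rightarrow> complex) \<Rightarrow> complex mat" where
  "rank_one r x = Matrix.mat r r (\<lambda>(i, j). x i * cnj (x j))"

lemma column_matrix_carrier [simp]: "column_matrix r x \<in> carrier_mat r (Suc 0)"
  by (simp add: column_matrix_def)

lemma rank_one_carrier [simp]: "rank_one r x \<in> carrier_mat r r"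
  by (simp add: rank_one_def)

lemma rank_one_eq: "rank_one r x = column_matrix r x * mat_adjoint (column_matrix r x)"
  by (rule eq_matI) (auto simp: rank_one_def column_matrix_def scalar_prod_def)

lemma index_column_matrix [simp]: "i < r \<Longrightarrow> column_matrix r x $$ (i, 0) = x i"
  by (simp add: column_matrix_def)

text \<open>
  For unitary \<open>U\<close>, the coordinates of \<open>x\<close> in the basis formed by the columns of \<open>U\<close>.
\<close>

definition adjoint_apply :: "nat \<Rightarrow> complex mat \<Rightarrow> (nat \<Rightarrow> complex) \<Rightarrow> nat \<Rightarrow> complex" where
  "adjoint_apply r U x i = (\<Sum>k<r. cnj (U $$ (k, i)) * x k)"

lemma adjoint_times_column:
  assumes "U \<in> carrier_mat r r" "i < r"
  shows "(mat_adjoint U * column_matrix r x) $$ (i, 0) = adjoint_apply r U x i"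
  using assms carrier_matD[OF assms(1)]
  by (simp add: adjoint_apply_def column_matrix_def scalar_prod_def lessThan_atLeast0)

lemma norm_adjoint_apply:
  assumes U: "unitary_matrix r U"
  shows "(\<Sum>i<r. (cmod (adjoint_apply r U x i))\<^sup>2) = norm_square r x"
proof -
  have Uc [simp]: "U \<in> carrier_mat r r" and UU: "U * mat_adjoint U = 1\<^sub>m r"
    using U unfolding unitary_matrix_def by auto
  let ?X = "column_matrix r x" and ?Y = "mat_adjoint U * column_matrix r x"
  have "mat_adjoint ?Y * ?Y = mat_adjoint ?X * (U * mat_adjoint U * ?X)"
    by (simp add: mat_adjoint_mult[of _ r r _ "Suc 0"] assoc_mult_mat[of _ "Suc 0" r _ r _ "Suc 0"]
        assoc_mult_mat[of _ r r _ r _ "Suc 0"])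
  then have "mat_adjoint ?Y * ?Y = mat_adjoint ?X * ?X" unfolding UU using left_mult_one_mat[OF column_matrix_carrier] by simp
  then have "(mat_adjoint ?Y * ?Y) $$ (0, 0) = (mat_adjoint ?X * ?X) $$ (0, 0)" by simp
  then have "complex_of_real (\<Sum>i<r. (cmod (?Y $$ (i, 0)))\<^sup>2) = complex_of_real (\<Sum>i<r. (cmod (?X $$ (i, 0)))\<^sup>2)"
    by (subst (asm) (1 2) adjoint_mult_diagonal[of _ r "Suc 0"]) auto
  then have "(\<Sum>i<r. (cmod (?Y $$ (i, 0)))\<^sup>2) = (\<Sum>i<r. (cmod (?X $$ (i, 0)))\<^sup>2)"
    by (simp only: of_real_eq_iff)
  then show ?thesis by (simp add: adjoint_times_column)
qed

lemma conjugated_rank_one: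
  assumes U: "U \<in> carrier_mat r r" and V: "V \<in> carrier_mat r r" and "i < r" "j < r"
  shows "(mat_adjoint U * rank_one r x * V) $$ (i, j) = adjoint_apply r U x i * cnj (adjoint_apply r V x j)"
proof -
  let ?X = "column_matrix r x"
  have "mat_adjoint U * rank_one r x * V = (mat_adjoint U * ?X) * mat_adjoint (mat_adjoint V * ?X)"
    unfolding rank_one_eq using U V rank_one_carrier[of r x, unfolded rank_one_eq]
    by (simp add: mat_adjoint_mult[of _ r r _ "Suc 0"] assoc_mult_mat[of _ r r _ r _ r] assoc_mult_mat[of _ r r _ "Suc 0" _ r]
      assoc_mult_mat[of _ r "Suc 0" _ r _ r])
  also have "\<dots> $$ (i, j) = (mat_adjoint U * ?X) $$ (i, 0) * cnj ((mat_adjoint V * ?X) $$ (j, 0))"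
    using assms carrier_matD[OF U] carrier_matD[OF V]
    by (subst index_mult_mat(1)) (auto simp: scalar_prod_def column_matrix_def)
  finally show ?thesis using assms by (simp add: adjoint_times_column)
qed

text \<open>
  Two Hermitian matrices are compared through their eigenbases. The squared moduli of the entries of
  \<open>U\<^sup>* V\<close> form a doubly stochastic matrix. An inequality between real functions of a pair
  \<open>(a i, b j)\<close> of eigenvalues, averaged against these weights, becomes an inequality between traces.
\<close>

locale diagonalized_pair =
  fixes r :: nat and A B U V :: "complex mat" and a b :: "nat \<Rightarrow> real"
  assumes A [simp]: "A \<in> carrier_mat r r" and B [simp]: "B \<in> carrier_mat r r"
    and U: "unitary_matrix r U" and V: "unitary_matrix r V"
    and diag_A: "mat_adjoint U * A * U = real_diag r a"
    and diag_B: "mat_adjoint V * B * V = real_diag r b"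
begin

lemma Uc [simp]: "U \<in> carrier_mat r r" and Vc [simp]: "V \<in> carrier_mat r r"
  and UU: "U * mat_adjoint U = 1\<^sub>m r" "mat_adjoint U * U = 1\<^sub>m r"
  and VV: "V * mat_adjoint V = 1\<^sub>m r" "mat_adjoint V * V = 1\<^sub>m r"
  using U V unfolding unitary_matrix_def by auto

definition basis_change :: "complex mat" where "basis_change = mat_adjoint U * V"

definition overlap :: "nat \<Rightarrow> nat \<Rightarrow> real" where "overlap i j = (cmod (basis_change $$ (i, j)))\<^sup>2"

lemma basis_change_carrier [simp]: "basis_change \<in> carrier_mat r r" unfolding basis_change_def by simp

lemma overlap_nonneg: "0 \<le> overlap i j" unfolding overlap_def by simp

lemma
  shows adjoint_basis_change: "mat_adjoint basis_change = mat_adjoint V * U"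
    and basis_change_unitary: "basis_change * mat_adjoint basis_change = 1\<^sub>m r" "mat_adjoint basis_change * basis_change = 1\<^sub>m r"
proof -
  show *: "mat_adjoint basis_change = mat_adjoint V * U" unfolding basis_change_def by (simp add: mat_adjoint_mult[of _ r r _ r])
  have "basis_change * mat_adjoint basis_change = mat_adjoint U * (V * mat_adjoint V) * U"
    unfolding * unfolding basis_change_def by (simp add: assoc_mult_mat[of _ r r _ r _ r])
  then show "basis_change * mat_adjoint basis_change = 1\<^sub>m r"
    unfolding VV using UU right_mult_one_mat[OF mat_adjoint_carrier[OF Uc]] by simp
  have "mat_adjoint basis_change * basis_change = mat_adjoint V * (U * mat_adjoint U) * V"
    unfolding * unfolding basis_change_def by (simp add: assoc_mult_mat[of _ r r _ r _ r])
  then show "mat_adjoint basis_change * basis_change = 1\<^sub>m r"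
    unfolding UU using VV right_mult_one_mat[OF mat_adjoint_carrier[OF Vc]] by simp
qed

lemma overlap_row_sum: assumes "i < r" shows "(\<Sum>j<r. overlap i j) = 1"
proof -
  have "complex_of_real (\<Sum>j<r. overlap i j) = 1"
    unfolding overlap_def using mult_adjoint_diagonal[OF basis_change_carrier assms] basis_change_unitary assms by simp
  then show ?thesis by (simp only: of_real_eq_1_iff)
qed

lemma overlap_col_sum: assumes "j < r" shows "(\<Sum>i<r. overlap i j) = 1"
proof -
  have "complex_of_real (\<Sum>i<r. overlap i j) = 1"
    unfolding overlap_def using adjoint_mult_diagonal[OF basis_change_carrier assms] basis_change_unitary assms by simp
  then show ?thesis by (simp only: of_real_eq_1_iff)
qed

text \<open>
  Between the two eigenbases, \<open>B - A\<close> multiplies the entries of \<open>U\<^sup>* V\<close> by the differences of the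
  eigenvalues. So the moments of \<open>b j - a i\<close> with respect to the overlaps are entries of products
  formed from \<open>B - A\<close>.
\<close>

lemma intertwine:
  assumes "i < r" "j < r"
  shows "(mat_adjoint U * (B - A) * V) $$ (i, j) = complex_of_real (b j - a i) * basis_change $$ (i, j)"
proof -
  let ?da = "real_diag r a" and ?db = "real_diag r b"
  have "basis_change * ?db = mat_adjoint U * (V * mat_adjoint V) * (B * V)"
    unfolding diag_B[symmetric] basis_change_def by (simp add: assoc_mult_mat[of _ r r _ r _ r])
  also have "\<dots> = mat_adjoint U * (B * V)"
    unfolding VV using right_mult_one_mat[OF mat_adjoint_carrier[OF Uc]] by simp
  finally have 1: "mat_adjoint U * (B * V) = basis_change * ?db" ..
  have "?da * basis_change = mat_adjoint U * A * (U * mat_adjoint U) * V"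
    unfolding diag_A[symmetric] basis_change_def by (simp add: assoc_mult_mat[of _ r r _ r _ r])
  also have "\<dots> = mat_adjoint U * (A * V)"
    unfolding UU using right_mult_one_mat[of "mat_adjoint U * A" r r] by (simp add: assoc_mult_mat[of _ r r _ r _ r])
  finally have 2: "mat_adjoint U * (A * V) = ?da * basis_change" ..
  have "mat_adjoint U * (B - A) * V = basis_change * ?db - ?da * basis_change"
    unfolding 1[symmetric] 2[symmetric]
    by (simp add: assoc_mult_mat[of _ r r _ r _ r] minus_mult_distrib_mat[of _ r r _ _ r] mult_minus_distrib_mat[of _ r r _ r])
  then show ?thesis using assms carrier_matD[OF basis_change_carrier]
    by (simp add: mat_diag_mult_left[OF basis_change_carrier] mat_diag_mult_right[OF basis_change_carrier] algebra_simps)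
qed

lemma overlap_mean_shift:
  assumes "i < r"
  shows "(\<Sum>j<r. overlap i j * (b j - a i)) = Re ((mat_adjoint U * (B - A) * U) $$ (i, i))"
proof -
  let ?M = "mat_adjoint U * (B - A) * V"
  have BA: "B - A \<in> carrier_mat r r" by (simp add: minus_carrier_mat)
  then have Mc: "?M \<in> carrier_mat r r" by simp
  have "?M * mat_adjoint basis_change = mat_adjoint U * (B - A) * (V * mat_adjoint V) * U"
    unfolding adjoint_basis_change using BA by (simp add: assoc_mult_mat[of _ r r _ r _ r])
  also have "\<dots> = mat_adjoint U * (B - A) * U"
    unfolding VV using right_mult_one_mat[of "mat_adjoint U * (B - A)" r r] BA by simp
  finally have "(mat_adjoint U * (B - A) * U) $$ (i, i) = (?M * mat_adjoint basis_change) $$ (i, i)" by simp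
  also have "\<dots> = (\<Sum>j<r. ?M $$ (i, j) * cnj (basis_change $$ (i, j)))"
    using assms carrier_matD[OF Mc] carrier_matD[OF basis_change_carrier]
    by (subst index_mult_mat(1)) (auto simp: scalar_prod_def lessThan_atLeast0)
  also have "\<dots> = (\<Sum>j<r. complex_of_real (overlap i j * (b j - a i)))"
    using assms by (intro sum.cong refl, subst intertwine) (auto simp: overlap_def complex_norm_square simp del: of_real_power)
  finally show ?thesis by simp
qed

text \<open>
  Klein's inequality for the exponential function: average \<open>exp b \<ge> exp a (1 + b - a)\<close> over the
  overlaps.
\<close>

lemma exp_trace_gradient:
  "(\<Sum>j<r. exp (b j)) \<ge> (\<Sum>i<r. exp (a i)) + (\<Sum>i<r. exp (a i) * Re ((mat_adjoint U * (B - A) * U) $$ (i, i)))"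
proof -
  have "(\<Sum>i<r. exp (a i)) + (\<Sum>i<r. exp (a i) * Re ((mat_adjoint U * (B - A) * U) $$ (i, i)))
     = (\<Sum>i<r. exp (a i) * (\<Sum>j<r. overlap i j)) + (\<Sum>i<r. exp (a i) * (\<Sum>j<r. overlap i j * (b j - a i)))"
    by (simp add: overlap_row_sum overlap_mean_shift)
  also have "\<dots> = (\<Sum>i<r. \<Sum>j<r. overlap i j * (exp (a i) * (1 + (b j - a i))))"
    by (simp add: sum_distrib_left sum.distrib algebra_simps sum_subtractf)
  also have "\<dots> \<le> (\<Sum>i<r. \<Sum>j<r. overlap i j * exp (b j))"
  proof (intro sum_mono mult_left_mono overlap_nonneg)
    fix i j
    have "exp (a i) * (1 + (b j - a i)) \<le> exp (a i) * exp (b j - a i)"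
      by (intro mult_left_mono exp_ge_add_one_self) simp
    then show "exp (a i) * (1 + (b j - a i)) \<le> exp (b j)" by (simp add: exp_add[symmetric])
  qed
  also have "\<dots> = (\<Sum>j<r. exp (b j) * (\<Sum>i<r. overlap i j))"
    by (subst sum.swap) (simp add: sum_distrib_left mult.commute)
  finally show ?thesis by (simp add: overlap_col_sum)
qed

text \<open>
  This lemma plays the role of the Golden--Thompson inequality. When \<open>B - A\<close> has rank one, the
  differences \<open>d = b j - a i\<close> have the first moments \<open>s \<xi>\<^sub>i\<close> over row \<open>i\<close> and \<open>s \<eta>\<^sub>j\<close> over column \<open>j\<close>, and the
  second moments are \<open>s \<parallel>x\<parallel>\<^sup>2\<close> times the first ones; here \<open>\<xi>\<^sub>i\<close> and \<open>\<eta>\<^sub>j\<close> are the squared moduli of the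
  coordinates of \<open>x\<close> in the two eigenbases. So \<open>d\<^sup>2 - R d\<close> is nonpositive on average over each row and
  over each column as soon as \<open>s \<parallel>x\<parallel>\<^sup>2\<close> lies between \<open>0\<close> and \<open>R\<close>. The error term of the scalar
  inequality is charged to the rows, with weights \<open>\<nu> exp (a i)\<close>, and to the columns, with weights
  \<open>\<mu> exp (b j)\<close>. Both parts are needed, since \<open>d\<close> ranges over all real numbers.
\<close>

lemma rank_one_update:
  assumes BA: "B - A = complex_of_real s \<cdot>\<^sub>m rank_one r x"
    and sx: "s * (s * norm_square r x - R) \<le> 0"
    and "0 \<le> \<nu>" "0 \<le> \<mu>"
    and scalar: "\<And>d. exp d - 1 - K * d \<le> (\<nu> + \<mu> * exp d) * (d\<^sup>2 - R * d)"
  shows "(\<Sum>j<r. exp (b j)) \<le> (\<Sum>i<r. exp (a i)) + K * s * (\<Sum>i<r. exp (a i) * (cmod (adjoint_apply r U x i))\<^sup>2)"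
proof -
  define \<xi> where "\<xi> i = (cmod (adjoint_apply r U x i))\<^sup>2" for i
  define \<eta> where "\<eta> j = (cmod (adjoint_apply r V x j))\<^sup>2" for j
  define N where "N = norm_square r x"
  define d where "d i j = b j - a i" for i j
  have entry: "(mat_adjoint U * (B - A) * Z) $$ (i, j) = complex_of_real s * (adjoint_apply r U x i * cnj (adjoint_apply r Z x j))"
    if "i < r" "j < r" and Z: "Z \<in> carrier_mat r r" for i j Z
  proof -
    have "mat_adjoint U * (B - A) * Z = complex_of_real s \<cdot>\<^sub>m (mat_adjoint U * rank_one r x * Z)"
      unfolding BA using Z
      by (simp add: mult_smult_distrib[of _ r r _ r] mult_smult_assoc_mat[of _ r r _ r])
    then show ?thesis using that conjugated_rank_one[OF Uc Z that(1,2)] carrier_matD[OF Z] carrier_matD[OF Uc] by simp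
  qed
  have N: "(\<Sum>i<r. \<xi> i) = N" "(\<Sum>j<r. \<eta> j) = N"
    unfolding \<xi>_def \<eta>_def N_def using norm_adjoint_apply[OF U] norm_adjoint_apply[OF V] by auto
  have mean_row: "(\<Sum>j<r. overlap i j * d i j) = s * \<xi> i" if "i < r" for i
    unfolding d_def overlap_mean_shift[OF that] entry[OF that that Uc] \<xi>_def
    by (simp add: complex_mult_cnj cmod_power2)
  have square: "overlap i j * (d i j)\<^sup>2 = s\<^sup>2 * \<xi> i * \<eta> j" if "i < r" "j < r" for i j
  proof -
    have "complex_of_real (d i j) * basis_change $$ (i, j) = complex_of_real s * (adjoint_apply r U x i * cnj (adjoint_apply r V x j))"
      unfolding d_def intertwine[OF that, symmetric] by (rule entry[OF that Vc])
    then have "cmod (complex_of_real (d i j) * basis_change $$ (i, j)) ^ 2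
       = cmod (complex_of_real s * (adjoint_apply r U x i * cnj (adjoint_apply r V x j))) ^ 2" by simp
    then show ?thesis unfolding overlap_def \<xi>_def \<eta>_def
      by (simp add: norm_mult power_mult_distrib mult_ac)
  qed
  \<comment> \<open>exchanging \<open>A\<close> and \<open>B\<close> turns the column moments into row moments\<close>
  interpret swap: diagonalized_pair r B A V U b a
    by unfold_locales (simp_all add: U V diag_A diag_B)
  have overlap_swap: "swap.overlap j i = overlap i j" if "i < r" "j < r" for i j
  proof -
    have "swap.basis_change = mat_adjoint basis_change" unfolding adjoint_basis_change swap.basis_change_def ..
    then show ?thesis unfolding overlap_def swap.overlap_def using that carrier_matD[OF basis_change_carrier] by simp
  qed
  have mean_col: "(\<Sum>i<r. overlap i j * d i j) = s * \<eta> j" if "j < r" for j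
  proof -
    have ABm: "mat_adjoint V * (A - B) * V = (- complex_of_real s) \<cdot>\<^sub>m (mat_adjoint V * rank_one r x * V)"
    proof -
      have "A - B = - (B - A)" by (rule eq_matI) (use carrier_matD[OF A] carrier_matD[OF B] in auto)
      also have "\<dots> = (- complex_of_real s) \<cdot>\<^sub>m rank_one r x" unfolding BA by (rule eq_matI) auto
      finally show ?thesis
        by (simp add: mult_smult_distrib[of _ r r _ r] mult_smult_assoc_mat[of _ r r _ r])
    qed
    have "(\<Sum>i<r. swap.overlap j i * (a i - b j)) = - s * \<eta> j"
      unfolding swap.overlap_mean_shift[OF that] ABm \<eta>_def
      using that conjugated_rank_one[OF Vc Vc that that] carrier_matD[OF Vc]
      by (simp add: complex_mult_cnj cmod_power2)
    moreover have "(\<Sum>i<r. swap.overlap j i * (a i - b j)) = - (\<Sum>i<r. overlap i j * d i j)"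
      unfolding sum_negf[symmetric] d_def using that by (intro sum.cong refl) (simp add: overlap_swap algebra_simps)
    ultimately show ?thesis by simp
  qed
  have row: "(\<Sum>j<r. overlap i j * ((d i j)\<^sup>2 - R * d i j)) \<le> 0" if "i < r" for i
  proof -
    have "(\<Sum>j<r. overlap i j * ((d i j)\<^sup>2 - R * d i j)) = (\<Sum>j<r. overlap i j * (d i j)\<^sup>2) - R * (\<Sum>j<r. overlap i j * d i j)"
      by (simp add: sum_subtractf sum_distrib_left algebra_simps)
    also have "(\<Sum>j<r. overlap i j * (d i j)\<^sup>2) = s\<^sup>2 * \<xi> i * N"
      using that by (simp add: square N(2)[symmetric] sum_distrib_left)
    also have "s\<^sup>2 * \<xi> i * N - R * (\<Sum>j<r. overlap i j * d i j) = \<xi> i * (s * (s * N - R))"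
      unfolding mean_row[OF that] by (simp add: algebra_simps power2_eq_square)
    also have "\<dots> \<le> 0" by (rule mult_nonneg_nonpos) (use sx in \<open>simp_all only: N_def \<xi>_def zero_le_power2\<close>)
    finally show ?thesis .
  qed
  have col: "(\<Sum>i<r. overlap i j * ((d i j)\<^sup>2 - R * d i j)) \<le> 0" if "j < r" for j
  proof -
    have "(\<Sum>i<r. overlap i j * ((d i j)\<^sup>2 - R * d i j)) = (\<Sum>i<r. overlap i j * (d i j)\<^sup>2) - R * (\<Sum>i<r. overlap i j * d i j)"
      by (simp add: sum_subtractf sum_distrib_left algebra_simps)
    also have "(\<Sum>i<r. overlap i j * (d i j)\<^sup>2) = s\<^sup>2 * \<eta> j * N"
      using that by (simp add: square N(1)[symmetric] sum_distrib_left sum_distrib_right mult_ac)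
    also have "s\<^sup>2 * \<eta> j * N - R * (\<Sum>i<r. overlap i j * d i j) = \<eta> j * (s * (s * N - R))"
      unfolding mean_col[OF that] by (simp add: algebra_simps power2_eq_square)
    also have "\<dots> \<le> 0" by (rule mult_nonneg_nonpos) (use sx in \<open>simp_all only: N_def \<eta>_def zero_le_power2\<close>)
    finally show ?thesis .
  qed
  have point: "overlap i j * (exp (b j) - exp (a i) - K * (exp (a i) * d i j))
      \<le> \<nu> * (exp (a i) * (overlap i j * ((d i j)\<^sup>2 - R * d i j))) + \<mu> * (exp (b j) * (overlap i j * ((d i j)\<^sup>2 - R * d i j)))" for i j
  proof -
    have e: "exp (b j) = exp (a i) * exp (d i j)" unfolding d_def by (simp add: exp_add[symmetric])
    have "overlap i j * exp (a i) * (exp (d i j) - 1 - K * d i j)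
      \<le> overlap i j * exp (a i) * ((\<nu> + \<mu> * exp (d i j)) * ((d i j)\<^sup>2 - R * d i j))"
      by (intro mult_left_mono scalar mult_nonneg_nonneg overlap_nonneg) simp
    then show ?thesis unfolding e by (simp add: algebra_simps)
  qed
  have "(\<Sum>i<r. \<Sum>j<r. overlap i j * (exp (b j) - exp (a i) - K * (exp (a i) * d i j)))
     \<le> (\<Sum>i<r. \<Sum>j<r. \<nu> * (exp (a i) * (overlap i j * ((d i j)\<^sup>2 - R * d i j))) + \<mu> * (exp (b j) * (overlap i j * ((d i j)\<^sup>2 - R * d i j))))"
    by (intro sum_mono point)
  also have "\<dots> = \<nu> * (\<Sum>i<r. exp (a i) * (\<Sum>j<r. overlap i j * ((d i j)\<^sup>2 - R * d i j)))
     + \<mu> * (\<Sum>j<r. exp (b j) * (\<Sum>i<r. overlap i j * ((d i j)\<^sup>2 - R * d i j)))"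
  proof -
    have "(\<Sum>i<r. \<Sum>j<r. \<mu> * (exp (b j) * (overlap i j * ((d i j)\<^sup>2 - R * d i j))))
      = (\<Sum>j<r. \<Sum>i<r. \<mu> * (exp (b j) * (overlap i j * ((d i j)\<^sup>2 - R * d i j))))" by (rule sum.swap)
    then show ?thesis by (simp add: sum.distrib sum_distrib_left)
  qed
  also have "\<dots> \<le> \<nu> * 0 + \<mu> * 0"
  proof (intro add_mono mult_left_mono assms(3,4))
    show "(\<Sum>i<r. exp (a i) * (\<Sum>j<r. overlap i j * ((d i j)\<^sup>2 - R * d i j))) \<le> 0"
      by (rule sum_nonpos, rule mult_nonneg_nonpos) (auto intro: row)
    show "(\<Sum>j<r. exp (b j) * (\<Sum>i<r. overlap i j * ((d i j)\<^sup>2 - R * d i j))) \<le> 0"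
      by (rule sum_nonpos, rule mult_nonneg_nonpos) (auto intro: col)
  qed
  finally have main: "(\<Sum>i<r. \<Sum>j<r. overlap i j * (exp (b j) - exp (a i) - K * (exp (a i) * d i j))) \<le> 0" by simp
  have "(\<Sum>i<r. \<Sum>j<r. overlap i j * (exp (b j) - exp (a i) - K * (exp (a i) * d i j)))
    = (\<Sum>i<r. \<Sum>j<r. overlap i j * exp (b j)) - (\<Sum>i<r. exp (a i) * (\<Sum>j<r. overlap i j)) - K * (\<Sum>i<r. exp (a i) * (\<Sum>j<r. overlap i j * d i j))"
    by (simp add: sum_subtractf sum_distrib_left algebra_simps)
  also have "(\<Sum>i<r. \<Sum>j<r. overlap i j * exp (b j)) = (\<Sum>j<r. exp (b j) * (\<Sum>i<r. overlap i j))"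
    by (subst sum.swap) (simp add: sum_distrib_left mult.commute)
  also have "\<dots> = (\<Sum>j<r. exp (b j))" by (simp add: overlap_col_sum)
  also have "(\<Sum>i<r. exp (a i) * (\<Sum>j<r. overlap i j)) = (\<Sum>i<r. exp (a i))" by (simp add: overlap_row_sum)
  also have "(\<Sum>i<r. exp (a i) * (\<Sum>j<r. overlap i j * d i j)) = s * (\<Sum>i<r. exp (a i) * \<xi> i)"
    unfolding sum_distrib_left[of s] by (intro sum.cong refl) (simp add: mean_row)
  finally show ?thesis using main unfolding \<xi>_def by (simp add: mult.assoc)
qed

end

section \<open>Traces of exponentials averaged over tight frames\<close>

definition hermitian_matrix :: "nat \<Rightarrow> complex mat \<Rightarrow> bool" where
  "hermitian_matrix r A \<longleftrightarrow> A \<in> carrier_mat r r \<and> mat_adjoint A = A"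

definition diagonalizes :: "nat \<Rightarrow> complex mat \<Rightarrow> complex mat \<times> (nat \<Rightarrow> real) \<Rightarrow> bool" where
  "diagonalizes r A = (\<lambda>(U, a). unitary_matrix r U \<and>
     mat_adjoint U * A * U = real_diag r a)"

definition eigenbasis :: "nat \<Rightarrow> complex mat \<Rightarrow> complex mat" where
  "eigenbasis r A = fst (SOME Ua. diagonalizes r A Ua)"

text \<open>
  With a fixed choice of a diagonalisation, the trace of the exponential becomes a function of the
  matrix and can be summed over random matrices.
\<close>

definition eigenvals :: "nat \<Rightarrow> complex mat \<Rightarrow> nat \<Rightarrow> real" where
  "eigenvals r A = snd (SOME Ua. diagonalizes r A Ua)"

definition exp_trace :: "nat \<Rightarrow> complex mat \<Rightarrow> real" where
  "exp_trace r A = (\<Sum>i<r. exp (eigenvals r A i))"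

lemma eigenbasis:
  assumes "hermitian_matrix r A"
  shows "unitary_matrix r (eigenbasis r A)"
    and "mat_adjoint (eigenbasis r A) * A * eigenbasis r A = real_diag r (eigenvals r A)"
proof -
  obtain U a where "diagonalizes r A (U, a)"
    using hermitian_unitary_diagonalization[of A r] assms
    unfolding hermitian_matrix_def diagonalizes_def by auto
  then have D: "diagonalizes r A (SOME Ua. diagonalizes r A Ua)" by (rule someI)
  obtain V b where S: "(SOME Ua. diagonalizes r A Ua) = (V, b)" by (cases "SOME Ua. diagonalizes r A Ua")
  have D: "diagonalizes r A (V, b)" using D unfolding S .
  show "unitary_matrix r (eigenbasis r A)"
    and "mat_adjoint (eigenbasis r A) * A * eigenbasis r A = real_diag r (eigenvals r A)"
    unfolding eigenbasis_def eigenvals_def S using D unfolding diagonalizes_def by auto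
qed

lemma diagonalized_pair_eigenbasis:
  assumes "hermitian_matrix r A" "hermitian_matrix r B"
  shows "diagonalized_pair r A B (eigenbasis r A) (eigenbasis r B) (eigenvals r A) (eigenvals r B)"
  by unfold_locales (use assms eigenbasis[OF assms(1)] eigenbasis[OF assms(2)] in \<open>auto simp: hermitian_matrix_def\<close>)

lemma exp_trace_nonneg: "0 \<le> exp_trace r A"
  unfolding exp_trace_def by (intro sum_nonneg) simp

text \<open>
  Convexity of the trace of the exponential: in the gradient inequalities at the midpoint, towards
  either end, the linear terms cancel.
\<close>

lemma exp_trace_midpoint:
  assumes hA: "hermitian_matrix r A" and hB: "hermitian_matrix r B" and hM: "hermitian_matrix r M"
    and mid: "\<And>i j. i < r \<Longrightarrow> j < r \<Longrightarrow> 2 * M $$ (i, j) = A $$ (i, j) + B $$ (i, j)"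
  shows "2 * exp_trace r M \<le> exp_trace r A + exp_trace r B"
proof -
  interpret MA: diagonalized_pair r M A "eigenbasis r M" "eigenbasis r A" "eigenvals r M" "eigenvals r A"
    by (rule diagonalized_pair_eigenbasis[OF hM hA])
  interpret MB: diagonalized_pair r M B "eigenbasis r M" "eigenbasis r B" "eigenvals r M" "eigenvals r B"
    by (rule diagonalized_pair_eigenbasis[OF hM hB])
  let ?U = "eigenbasis r M"
  have "B - M = (-1) \<cdot>\<^sub>m (A - M)"
  proof (rule eq_matI)
    fix i j assume "i < dim_row ((-1) \<cdot>\<^sub>m (A - M))" "j < dim_col ((-1) \<cdot>\<^sub>m (A - M))"
    then have ij: "i < r" "j < r" using carrier_matD[OF MA.A] by auto
    then have "B $$ (i, j) = 2 * M $$ (i, j) - A $$ (i, j)" using mid by simp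
    then show "(B - M) $$ (i, j) = ((-1) \<cdot>\<^sub>m (A - M)) $$ (i, j)"
      using ij carrier_matD[OF MA.A] carrier_matD[OF MA.B] carrier_matD[OF MB.B] by simp
  qed (use carrier_matD[OF MA.A] carrier_matD[OF MA.B] carrier_matD[OF MB.B] in auto)
  then have "mat_adjoint ?U * (B - M) * ?U = (-1) \<cdot>\<^sub>m (mat_adjoint ?U * (A - M) * ?U)"
    using minus_carrier_mat[OF MA.A, of A]
    by (simp add: mult_smult_distrib[of _ r r _ r] mult_smult_assoc_mat[of _ r r _ r])
  then have "(mat_adjoint ?U * (B - M) * ?U) $$ (i, i) = - (mat_adjoint ?U * (A - M) * ?U) $$ (i, i)" if "i < r" for i
    using that carrier_matD[OF MA.Uc] by simp
  then have "(\<Sum>i<r. exp (eigenvals r M i) * Re ((mat_adjoint ?U * (B - M) * ?U) $$ (i, i)))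
    = - (\<Sum>i<r. exp (eigenvals r M i) * Re ((mat_adjoint ?U * (A - M) * ?U) $$ (i, i)))"
    unfolding sum_negf[symmetric] by (intro sum.cong refl) simp
  then show ?thesis using MA.exp_trace_gradient MB.exp_trace_gradient unfolding exp_trace_def by linarith
qed

definition gram_sum :: "nat \<Rightarrow> real \<Rightarrow> 'a set \<Rightarrow> ('a \<Rightarrow> nat \<Rightarrow> complex) \<Rightarrow> complex mat" where
  "gram_sum r s T x = Matrix.mat r r (\<lambda>(a, b). complex_of_real s * (\<Sum>j\<in>T. x j a * cnj (x j b)))"

lemma gram_sum_carrier [simp]: "gram_sum r s T x \<in> carrier_mat r r"
  by (simp add: gram_sum_def)

lemma hermitian_gram_sum [simp]: "hermitian_matrix r (gram_sum r s T x)"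
  unfolding hermitian_matrix_def
proof
  show "mat_adjoint (gram_sum r s T x) = gram_sum r s T x"
    by (rule eq_matI) (auto simp: gram_sum_def mult.commute)
qed simp

lemma hermitian_add:
  assumes "hermitian_matrix r A" "hermitian_matrix r B"
  shows "hermitian_matrix r (A + B)"
  unfolding hermitian_matrix_def
proof
  have A: "A \<in> carrier_mat r r" "mat_adjoint A = A" and B: "B \<in> carrier_mat r r" "mat_adjoint B = B"
    using assms unfolding hermitian_matrix_def by auto
  show "A + B \<in> carrier_mat r r" using A B by simp
  have *: "cnj (X $$ (j, i)) = X $$ (i, j)" if "X \<in> carrier_mat r r" "mat_adjoint X = X" "i < r" "j < r"
    for X :: "complex mat" and i j
    using index_mat_adjoint[of i X j] that by auto
  show "mat_adjoint (A + B) = A + B"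
    by (rule eq_matI) (use A B carrier_matD[OF A(1)] carrier_matD[OF B(1)] * in auto)
qed

lemma hermitian_smult_rank_one [simp]: "hermitian_matrix r (complex_of_real s \<cdot>\<^sub>m rank_one r x)"
  unfolding hermitian_matrix_def
proof
  show "mat_adjoint (complex_of_real s \<cdot>\<^sub>m rank_one r x) = complex_of_real s \<cdot>\<^sub>m rank_one r x"
    by (rule eq_matI) (auto simp: rank_one_def)
qed simp

lemma gram_sum_insert:
  assumes "finite T" "a \<notin> T"
  shows "gram_sum r s (insert a T) x = gram_sum r s T x + complex_of_real s \<cdot>\<^sub>m rank_one r (x a)"
  by (rule eq_matI) (use assms in \<open>auto simp: gram_sum_def rank_one_def algebra_simps\<close>)

text \<open>
  A tight frame spreads its weight evenly over the vectors of every orthonormal basis.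
\<close>

lemma tight_frame_adjoint_apply:
  assumes U: "unitary_matrix r U"
    and frame: "\<And>a b. a < r \<Longrightarrow> b < r \<Longrightarrow> (\<Sum>j<n. x j a * cnj (x j b)) = (if a = b then complex_of_real \<kappa> else 0)"
    and i: "i < r"
  shows "(\<Sum>j<n. (cmod (adjoint_apply r U (x j) i))\<^sup>2) = \<kappa>"
proof -
  have Uc: "U \<in> carrier_mat r r" and UU: "mat_adjoint U * U = 1\<^sub>m r"
    using U unfolding unitary_matrix_def by auto
  have "complex_of_real (\<Sum>j<n. (cmod (adjoint_apply r U (x j) i))\<^sup>2)
    = (\<Sum>j<n. adjoint_apply r U (x j) i * cnj (adjoint_apply r U (x j) i))"
    by (simp add: complex_norm_square del: of_real_power)
  also have "\<dots> = (\<Sum>j<n. \<Sum>a<r. \<Sum>b<r. cnj (U $$ (a, i)) * U $$ (b, i) * (x j a * cnj (x j b)))"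
    unfolding adjoint_apply_def by (simp add: sum_product mult_ac)
  also have "\<dots> = (\<Sum>a<r. \<Sum>b<r. \<Sum>j<n. cnj (U $$ (a, i)) * U $$ (b, i) * (x j a * cnj (x j b)))"
    by (subst sum.swap, rule sum.cong[OF refl], rule sum.swap)
  also have "\<dots> = (\<Sum>a<r. \<Sum>b<r. cnj (U $$ (a, i)) * U $$ (b, i) * (if a = b then complex_of_real \<kappa> else 0))"
    unfolding sum_distrib_left[symmetric] by (intro sum.cong refl) (simp add: frame)
  also have "\<dots> = complex_of_real \<kappa> * (\<Sum>a<r. U $$ (a, i) * cnj (U $$ (a, i)))"
    by (simp add: sum_distrib_left mult_ac if_distrib[of "(*) _"] sum.delta cong: if_cong)
  also have "(\<Sum>a<r. U $$ (a, i) * cnj (U $$ (a, i))) = complex_of_real (\<Sum>a<r. (cmod (U $$ (a, i)))\<^sup>2)"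
    by (simp add: complex_norm_square del: of_real_power)
  also have "\<dots> = 1" using adjoint_mult_diagonal[OF Uc i] UU i by simp
  finally show ?thesis by (simp only: mult_1_right of_real_eq_iff)
qed

text \<open>
  The vectors that are sampled, together with constants for which \<open>rank_one_update\<close> applies to each
  of them. The assumption \<open>bounded\<close> says that \<open>s \<parallel>x j\<parallel>\<^sup>2\<close> lies between \<open>0\<close> and \<open>R\<close>; \<open>s\<close> and \<open>R\<close> are negative for
  the lower tail.
\<close>

locale bounded_tight_frame =
  fixes n r :: nat and x :: "nat \<Rightarrow> nat \<Rightarrow> complex" and \<kappa> s R \<nu> \<mu> K :: real
  assumes frame: "\<And>a b. a < r \<Longrightarrow> b < r \<Longrightarrow>
      (\<Sum>j<n. x j a * cnj (x j b)) = (if a = b then complex_of_real \<kappa> else 0)"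
    and bounded: "\<And>j. j < n \<Longrightarrow> s * (s * norm_square r (x j) - R) \<le> 0"
    and nonneg: "0 \<le> \<nu>" "0 \<le> \<mu>"
    and scalar: "\<And>d. exp d - 1 - K * d \<le> (\<nu> + \<mu> * exp d) * (d\<^sup>2 - R * d)"

text \<open>
  By \<open>tight_frame_adjoint_apply\<close>, the average of the increments in \<open>rank_one_update\<close> is a multiple of the trace
  of the exponential itself. This closes the recursion over the samples.
\<close>

lemma (in bounded_tight_frame) exp_trace_frame_average:
  assumes hA: "hermitian_matrix r A"
  shows "(\<Sum>j<n. exp_trace r (A + complex_of_real s \<cdot>\<^sub>m rank_one r (x j))) \<le> (real n + K * s * \<kappa>) * exp_trace r A"
proof -
  let ?B = "\<lambda>j. A + complex_of_real s \<cdot>\<^sub>m rank_one r (x j)"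
  let ?U = "eigenbasis r A" and ?a = "eigenvals r A"
  let ?w = "\<lambda>j. \<Sum>i<r. exp (?a i) * (cmod (adjoint_apply r ?U (x j) i))\<^sup>2"
  have Ac: "A \<in> carrier_mat r r" using hA unfolding hermitian_matrix_def by simp
  have "exp_trace r (?B j) \<le> exp_trace r A + K * s * ?w j"
    if "j < n" for j
  proof -
    interpret diagonalized_pair r A "?B j" ?U "eigenbasis r (?B j)" ?a "eigenvals r (?B j)"
      by (intro diagonalized_pair_eigenbasis hermitian_add hA hermitian_smult_rank_one)
    show ?thesis unfolding exp_trace_def
    proof (rule rank_one_update[where R = R and \<nu> = \<nu> and \<mu> = \<mu>])
      show "?B j - A = complex_of_real s \<cdot>\<^sub>m rank_one r (x j)"
        by (rule eq_matI) (use Ac carrier_matD[OF Ac] carrier_matD[OF rank_one_carrier] in auto)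
    qed (use bounded[OF that] nonneg scalar in auto)
  qed
  then have "(\<Sum>j<n. exp_trace r (?B j))
     \<le> (\<Sum>j<n. exp_trace r A + K * s * ?w j)"
    by (intro sum_mono) auto
  also have "\<dots> = n * exp_trace r A + K * s * (\<Sum>j<n. \<Sum>i<r. exp (?a i) * (cmod (adjoint_apply r ?U (x j) i))\<^sup>2)"
    by (simp add: sum.distrib sum_distrib_left)
  also have "(\<Sum>j<n. \<Sum>i<r. exp (?a i) * (cmod (adjoint_apply r ?U (x j) i))\<^sup>2)
    = (\<Sum>i<r. exp (?a i) * (\<Sum>j<n. (cmod (adjoint_apply r ?U (x j) i))\<^sup>2))"
    by (subst sum.swap) (simp add: sum_distrib_left)
  also have "\<dots> = \<kappa> * exp_trace r A"
    unfolding exp_trace_def sum_distrib_left[of \<kappa>]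
    by (intro sum.cong refl) (simp add: tight_frame_adjoint_apply[OF eigenbasis(1)[OF hA] frame] mult.commute)
  finally show ?thesis by (simp add: algebra_simps)
qed

lemma exp_trace_empty: "exp_trace r (gram_sum r s {} x) = r"
proof -
  let ?Z = "gram_sum r s {} x"
  let ?U = "eigenbasis r ?Z"
  have h: "hermitian_matrix r ?Z" by simp
  have Uc: "?U \<in> carrier_mat r r" using eigenbasis(1)[OF h] unfolding unitary_matrix_def by simp
  have "?Z = 0\<^sub>m r r" by (rule eq_matI) (auto simp: gram_sum_def)
  then have "mat_adjoint ?U * ?Z * ?U = 0\<^sub>m r r"
    using right_mult_zero_mat[OF mat_adjoint_carrier[OF Uc]] left_mult_zero_mat[OF Uc] by simp
  then have "real_diag r (eigenvals r ?Z) = 0\<^sub>m r r"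
    using eigenbasis(2)[OF h] by simp
  then have "real_diag r (eigenvals r ?Z) $$ (i, i) = 0" if "i < r" for i using that by simp
  then have "eigenvals r ?Z i = 0" if "i < r" for i using that by simp
  then show ?thesis unfolding exp_trace_def by simp
qed

definition rayleigh_form :: "nat \<Rightarrow> complex mat \<Rightarrow> (nat \<Rightarrow> complex) \<Rightarrow> complex" where
  "rayleigh_form r A z = (mat_adjoint (column_matrix r z) * A * column_matrix r z) $$ (0, 0)"

lemma rayleigh_form_diagonalized:
  assumes A: "A \<in> carrier_mat r r" and U: "unitary_matrix r U"
    and D: "mat_adjoint U * A * U = real_diag r a"
  shows "rayleigh_form r A z = complex_of_real (\<Sum>i<r. a i * (cmod (adjoint_apply r U z i))\<^sup>2)"
proof -
  let ?z = "column_matrix r z" and ?D = "real_diag r a"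
  let ?y = "mat_adjoint U * ?z"
  have Uc [simp]: "U \<in> carrier_mat r r" and UU: "U * mat_adjoint U = 1\<^sub>m r"
    using U unfolding unitary_matrix_def by auto
  note A [simp]
  have zc: "mat_adjoint ?z \<in> carrier_mat (Suc 0) r" by simp
  have yc: "?y \<in> carrier_mat r (Suc 0)" by simp
  have "mat_adjoint ?y * (?D * ?y) = mat_adjoint ?z * (U * mat_adjoint U) * A * (U * mat_adjoint U * ?z)"
    unfolding D[symmetric]
    by (simp add: mat_adjoint_mult[of _ r r _ "Suc 0"] assoc_mult_mat[of _ r r _ r _ r] assoc_mult_mat[of _ r r _ r _ "Suc 0"]
      assoc_mult_mat[of _ "Suc 0" r _ r _ r] assoc_mult_mat[of _ "Suc 0" r _ r _ "Suc 0"])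
  also have "\<dots> = mat_adjoint ?z * A * ?z"
    unfolding UU using right_mult_one_mat[OF zc] left_mult_one_mat[OF column_matrix_carrier[of r z]] by simp
  finally have "rayleigh_form r A z = (mat_adjoint ?y * (?D * ?y)) $$ (0, 0)" unfolding rayleigh_form_def by simp
  also have "\<dots> = (\<Sum>i<r. cnj (?y $$ (i, 0)) * (complex_of_real (a i) * ?y $$ (i, 0)))"
    using carrier_matD[OF yc]
    by (subst index_mult_mat(1)) (auto simp: mat_diag_mult_left[OF yc] scalar_prod_def lessThan_atLeast0)
  also have "\<dots> = (\<Sum>i<r. complex_of_real (a i * (cmod (adjoint_apply r U z i))\<^sup>2))"
    by (intro sum.cong refl) (simp add: adjoint_times_column complex_norm_square mult_ac del: of_real_power)
  finally show ?thesis by simp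
qed

text \<open>
  Some eigenvalue exceeds \<open>t\<close>, and its exponential is one summand of the trace.
\<close>

lemma exp_trace_gt:
  assumes hA: "hermitian_matrix r A" and gt: "Re (rayleigh_form r A z) > t * norm_square r z"
  shows "exp_trace r A > exp t"
proof -
  let ?U = "eigenbasis r A" and ?a = "eigenvals r A"
  have Ac: "A \<in> carrier_mat r r" using hA unfolding hermitian_matrix_def by simp
  have "\<exists>i<r. ?a i > t"
  proof (rule ccontr)
    assume "\<not> ?thesis"
    then have le: "?a i \<le> t" if "i < r" for i using that by auto
    have "Re (rayleigh_form r A z) = (\<Sum>i<r. ?a i * (cmod (adjoint_apply r ?U z i))\<^sup>2)"
      using rayleigh_form_diagonalized[OF Ac eigenbasis[OF hA]] by simp
    also have "\<dots> \<le> (\<Sum>i<r. t * (cmod (adjoint_apply r ?U z i))\<^sup>2)"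
      by (intro sum_mono mult_right_mono) (auto simp: le)
    also have "\<dots> = t * norm_square r z"
      unfolding sum_distrib_left[symmetric] norm_adjoint_apply[OF eigenbasis(1)[OF hA]] ..
    finally show False using gt by simp
  qed
  then obtain i where i: "i < r" "t < ?a i" by auto
  have "exp t < exp (?a i)" using i by simp
  also have "\<dots> \<le> exp_trace r A" unfolding exp_trace_def using i by (intro member_le_sum) auto
  finally show ?thesis .
qed

lemma rayleigh_form_gram_sum:
  "rayleigh_form r (gram_sum r s T x) z = complex_of_real (s * (\<Sum>j\<in>T. (cmod (\<Sum>a<r. cnj (z a) * x j a))\<^sup>2))"
proof -
  have "rayleigh_form r (gram_sum r s T x) z = (\<Sum>b<r. (\<Sum>a<r. cnj (z a) * (complex_of_real s * (\<Sum>j\<in>T. x j a * cnj (x j b)))) * z b)"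
    unfolding rayleigh_form_def gram_sum_def
    by (simp add: scalar_prod_def lessThan_atLeast0 column_matrix_def)
  also have "\<dots> = (\<Sum>b<r. \<Sum>a<r. \<Sum>j\<in>T. complex_of_real s * ((cnj (z a) * x j a) * (z b * cnj (x j b))))"
    by (simp add: sum_distrib_left sum_distrib_right mult_ac)
  also have "\<dots> = (\<Sum>j\<in>T. \<Sum>b<r. \<Sum>a<r. complex_of_real s * ((cnj (z a) * x j a) * (z b * cnj (x j b))))"
    by (subst sum.swap, subst sum.swap, subst (2) sum.swap, subst (2) sum.swap) (rule refl)
  also have "\<dots> = (\<Sum>j\<in>T. complex_of_real s * ((\<Sum>a<r. cnj (z a) * x j a) * cnj (\<Sum>a<r. cnj (z a) * x j a)))"
    unfolding cnj_sum sum_product by (intro sum.cong refl, subst sum.swap) (simp add: sum_distrib_left)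
  finally show ?thesis by (simp add: complex_norm_square sum_distrib_left del: of_real_power)
qed

section \<open>Sampling without replacement\<close>

definition perms :: "nat \<Rightarrow> (nat \<Rightarrow> nat) set" where "perms n = {p. p permutes {..<n}}"

lemma finite_perms [simp]: "finite (perms n)" unfolding perms_def by (simp add: finite_permutations)
lemma card_perms: "card (perms n) = fact n" unfolding perms_def by (simp add: card_permutations)

lemma sum_perms_transpose:
  assumes "a < n" "b < n"
  shows "(\<Sum>p\<in>perms n. f p) = (\<Sum>p\<in>perms n. f (p \<circ> Transposition.transpose a b))"
  unfolding perms_def by (rule sum_permutations_compose_right) (use assms in \<open>auto intro: permutes_swap_id\<close>)

text \<open>
  The uniformly random permutation \<open>p\<close> draws the vectors \<open>x (p i)\<close>, \<open>i \<in> T\<close>, without replacement. Sums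
  over all permutations stand for expectations, up to the factor \<open>n!\<close>.
\<close>

definition perm_exp_trace ::
  "nat \<Rightarrow> nat \<Rightarrow> real \<Rightarrow> (nat \<Rightarrow> nat \<Rightarrow> complex) \<Rightarrow> nat set \<Rightarrow> real" where
  "perm_exp_trace n r s x T = (\<Sum>p\<in>perms n. exp_trace r (gram_sum r s T (\<lambda>i. x (p i))))"

lemma gram_sum_cong:
  assumes "\<And>j. j \<in> T \<Longrightarrow> x j = y j"
  shows "gram_sum r s T x = gram_sum r s T y"
  unfolding gram_sum_def using assms by simp

text \<open>
  Replacing the fresh sample \<open>p a\<close> by \<open>p J\<close> for a fixed index \<open>J\<close>, possibly one that was drawn before, does not
  decrease the expected trace. If \<open>J \<notin> T\<close>, a transposition of \<open>a\<close> and \<open>J\<close> shows that nothing changes.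
  If \<open>J \<in> T\<close>, the sum over \<open>insert a T\<close> is the midpoint of two sums, in which \<open>p J\<close> or \<open>p a\<close>,
  respectively, occurs twice and the other one not at all; the transposition exchanges these two, so
  that they have the same expectation, and convexity gives the claim.
\<close>

lemma perm_exp_trace_insert_le_reused:
  assumes T: "T \<subseteq> {..<n}" and a: "a < n" "a \<notin> T" and J: "J < n"
  shows "perm_exp_trace n r s x (insert a T) \<le>
    (\<Sum>p\<in>perms n. exp_trace r (gram_sum r s T (\<lambda>i. x (p i)) + complex_of_real s \<cdot>\<^sub>m rank_one r (x (p J))))"
    (is "_ \<le> (\<Sum>p\<in>perms n. ?g p)")
proof -
  have fT: "finite T" using T finite_subset by blast
  define \<tau> where "\<tau> = Transposition.transpose a J"
  have swap: "(\<Sum>p\<in>perms n. ?g p) = (\<Sum>p\<in>perms n. ?g (p \<circ> \<tau>))"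
    unfolding \<tau>_def by (rule sum_perms_transpose[OF a(1) J])
  have tJ: "\<tau> J = a" unfolding \<tau>_def by simp
  show ?thesis
  proof (cases "J \<in> T")
    case False
    have "?g (p \<circ> \<tau>) = exp_trace r (gram_sum r s (insert a T) (\<lambda>i. x (p i)))" for p
    proof -
      have "\<tau> i = i" if "i \<in> T" for i using that a False unfolding \<tau>_def by (metis transpose_apply_other)
      then have "gram_sum r s T (\<lambda>i. x ((p \<circ> \<tau>) i)) = gram_sum r s T (\<lambda>i. x (p i))"
        by (intro gram_sum_cong) simp
      then show ?thesis unfolding gram_sum_insert[OF fT a(2)] by (simp add: tJ)
    qed
    then show ?thesis unfolding perm_exp_trace_def swap by simp
  next
    case True
    define T' where "T' = T - {J}"
    have T': "T = insert J T'" "J \<notin> T'" "finite T'" "a \<notin> T'" using True fT a unfolding T'_def by auto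
    have aJ: "a \<noteq> J" using True a by auto
    have mid: "2 * exp_trace r (gram_sum r s (insert a T) (\<lambda>i. x (p i))) \<le> ?g p + ?g (p \<circ> \<tau>)" for p
    proof (rule exp_trace_midpoint)
      fix i j assume ij: "i < r" "j < r"
      have "(\<Sum>k\<in>T'. x (p (\<tau> k)) i * cnj (x (p (\<tau> k)) j)) = (\<Sum>k\<in>T'. x (p k) i * cnj (x (p k) j))"
      proof (intro sum.cong refl)
        fix k assume "k \<in> T'"
        then have "\<tau> k = k" using T'(2,4) unfolding \<tau>_def by (metis transpose_apply_other)
        then show "x (p (\<tau> k)) i * cnj (x (p (\<tau> k)) j) = x (p k) i * cnj (x (p k) j)" by simp
      qed
      moreover have "\<tau> a = J" unfolding \<tau>_def by simp
      ultimately show "2 * gram_sum r s (insert a T) (\<lambda>i. x (p i)) $$ (i, j) =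
        (gram_sum r s T (\<lambda>i. x (p i)) + complex_of_real s \<cdot>\<^sub>m rank_one r (x (p J))) $$ (i, j) +
        (gram_sum r s T (\<lambda>i. x ((p \<circ> \<tau>) i)) + complex_of_real s \<cdot>\<^sub>m rank_one r (x ((p \<circ> \<tau>) J))) $$ (i, j)"
        using ij T' aJ fT a by (simp add: gram_sum_def rank_one_def tJ algebra_simps)
    qed (intro hermitian_add hermitian_gram_sum hermitian_smult_rank_one)+
    have "2 * perm_exp_trace n r s x (insert a T) \<le> (\<Sum>p\<in>perms n. ?g p + ?g (p \<circ> \<tau>))"
      unfolding perm_exp_trace_def sum_distrib_left by (intro sum_mono mid)
    then show ?thesis using swap by (simp add: sum.distrib)
  qed
qed

text \<open>
  Summing the previous bound over all \<open>J < n\<close> makes \<open>p J\<close> run through the whole frame once, whatever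
  \<open>p\<close> is, as if the new sample were independent of the earlier ones.
\<close>

lemma (in bounded_tight_frame) perm_exp_trace_insert:
  assumes T: "T \<subseteq> {..<n}" and a: "a < n" "a \<notin> T"
  shows "perm_exp_trace n r s x (insert a T) \<le> exp (K * s * \<kappa> / n) * perm_exp_trace n r s x T"
proof -
  let ?A = "\<lambda>p. gram_sum r s T (\<lambda>i. x (p i))"
  have "real n * perm_exp_trace n r s x (insert a T)
    \<le> (\<Sum>J<n. \<Sum>p\<in>perms n. exp_trace r (?A p + complex_of_real s \<cdot>\<^sub>m rank_one r (x (p J))))"
    using sum_mono[of "{..<n}" "\<lambda>_. perm_exp_trace n r s x (insert a T)", OF perm_exp_trace_insert_le_reused[OF T a]]
    by simp
  also have "\<dots> = (\<Sum>p\<in>perms n. \<Sum>J<n. exp_trace r (?A p + complex_of_real s \<cdot>\<^sub>m rank_one r (x (p J))))"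
    by (rule sum.swap)
  also have "\<dots> = (\<Sum>p\<in>perms n. \<Sum>J<n. exp_trace r (?A p + complex_of_real s \<cdot>\<^sub>m rank_one r (x J)))"
  proof (rule sum.cong[OF refl])
    fix p assume "p \<in> perms n"
    then have "p permutes {..<n}" unfolding perms_def by simp
    from sum.permute[OF this, of "\<lambda>J. exp_trace r (?A p + complex_of_real s \<cdot>\<^sub>m rank_one r (x J))"]
    show "(\<Sum>J<n. exp_trace r (?A p + complex_of_real s \<cdot>\<^sub>m rank_one r (x (p J))))
      = (\<Sum>J<n. exp_trace r (?A p + complex_of_real s \<cdot>\<^sub>m rank_one r (x J)))" by (simp add: o_def)
  qed
  also have "\<dots> \<le> (\<Sum>p\<in>perms n. (real n + K * s * \<kappa>) * exp_trace r (?A p))"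
    by (intro sum_mono[of "perms n"] exp_trace_frame_average hermitian_gram_sum)
  also have "\<dots> = (real n + K * s * \<kappa>) * perm_exp_trace n r s x T"
    unfolding perm_exp_trace_def by (simp add: sum_distrib_left)
  finally have "perm_exp_trace n r s x (insert a T) \<le> (1 + K * s * \<kappa> / n) * perm_exp_trace n r s x T"
    using a(1) by (simp add: field_simps)
  also have "\<dots> \<le> exp (K * s * \<kappa> / n) * perm_exp_trace n r s x T"
    unfolding perm_exp_trace_def
    by (intro mult_right_mono exp_ge_add_one_self sum_nonneg exp_trace_nonneg)
  finally show ?thesis .
qed

lemma (in bounded_tight_frame) perm_exp_trace_bound:
  assumes T: "T \<subseteq> {..<n}"
  shows "perm_exp_trace n r s x T \<le> exp (card T * (K * s * \<kappa> / n)) * (fact n * real r)"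
proof -
  have "finite T" using T finite_subset by blast
  then show ?thesis using T
  proof (induction T rule: finite_induct)
    case empty
    show ?case unfolding perm_exp_trace_def by (simp add: exp_trace_empty card_perms)
  next
    case (insert a T)
    have "perm_exp_trace n r s x (insert a T) \<le> exp (K * s * \<kappa> / n) * perm_exp_trace n r s x T"
      by (rule perm_exp_trace_insert) (use insert in auto)
    also have "\<dots> \<le> exp (K * s * \<kappa> / n) * (exp (card T * (K * s * \<kappa> / n)) * (fact n * real r))"
      using insert by (intro mult_left_mono) auto
    also have "\<dots> = exp (card (insert a T) * (K * s * \<kappa> / n)) * (fact n * real r)"
      using insert by (simp add: exp_add[symmetric] algebra_simps add_divide_distrib)
    finally show ?case .
  qed
qed

text \<open>
  Markov's inequality for the trace of the exponential. The upper tail is the case \<open>s > 0\<close>, the lower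
  tail the case \<open>s < 0\<close>.
\<close>

lemma (in bounded_tight_frame) perm_chernoff:
  assumes T: "T \<subseteq> {..<n}"
  shows "real (card {p \<in> perms n. \<exists>z. s * (\<Sum>j\<in>T. (cmod (\<Sum>a<r. cnj (z a) * x (p j) a))\<^sup>2) > t * norm_square r z})
     \<le> fact n * (real r * exp (card T * (K * s * \<kappa> / n) - t))"
proof -
  let ?F = "{p \<in> perms n. \<exists>z. s * (\<Sum>j\<in>T. (cmod (\<Sum>a<r. cnj (z a) * x (p j) a))\<^sup>2) > t * norm_square r z}"
  have "real (card ?F) * exp t = (\<Sum>p\<in>?F. exp t)" by simp
  also have "\<dots> \<le> (\<Sum>p\<in>?F. exp_trace r (gram_sum r s T (\<lambda>i. x (p i))))"
  proof (rule sum_mono)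
    fix p assume "p \<in> ?F"
    then obtain z where "s * (\<Sum>j\<in>T. (cmod (\<Sum>a<r. cnj (z a) * x (p j) a))\<^sup>2) > t * norm_square r z" by auto
    then show "exp t \<le> exp_trace r (gram_sum r s T (\<lambda>i. x (p i)))"
      by (intro less_imp_le exp_trace_gt[where z = z]) (auto simp: rayleigh_form_gram_sum)
  qed
  also have "\<dots> \<le> perm_exp_trace n r s x T"
    unfolding perm_exp_trace_def by (intro sum_mono2) (auto intro: exp_trace_nonneg)
  also have "\<dots> \<le> exp (card T * (K * s * \<kappa> / n)) * (fact n * real r)"
    by (rule perm_exp_trace_bound[OF T])
  finally show ?thesis by (simp add: exp_diff field_simps)
qed

section \<open>Scalar inequalities for the two tails\<close>

text \<open>
  The value of \<open>K\<close> makes the difference of the two sides vanish to second order at \<open>d = 0\<close>, and the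
  second assumption says that this difference is convex in \<open>d\<close>; so it is nonnegative. The best
  constant in Chernoff's bound is \<open>(exp R - 1) / R\<close>. Giving up a few percent of it leaves room for
  the convexity.
\<close>

lemma chernoff_scalar_inequality:
  fixes R \<nu> \<mu> K d :: real
  assumes K: "K = 1 + (\<nu> + \<mu>) * R"
    and h: "\<And>u. 1 + 2 * \<mu> * R - 2 * \<mu> - \<mu> * (4 - R) * u - \<mu> * u\<^sup>2 \<le> 2 * \<nu> * exp (- u)"
  shows "exp d - 1 - K * d \<le> (\<nu> + \<mu> * exp d) * (d\<^sup>2 - R * d)"
proof -
  define f where "f u = (\<nu> + \<mu> * exp u) * (u\<^sup>2 - R * u) - exp u + 1 + K * u" for u
  define f' where "f' u = \<mu> * exp u * (u\<^sup>2 - R * u) + (\<nu> + \<mu> * exp u) * (2 * u - R) - exp u + K" for u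
  define f'' where "f'' u = \<mu> * exp u * (u\<^sup>2 - R * u) + 2 * (\<mu> * exp u * (2 * u - R)) + 2 * (\<nu> + \<mu> * exp u) - exp u" for u
  have d1: "DERIV f u :> f' u" for u
    unfolding f_def f'_def by (auto intro!: derivative_eq_intros simp: algebra_simps)
  have d2: "DERIV f' u :> f'' u" for u
    unfolding f'_def f''_def by (auto intro!: derivative_eq_intros simp: algebra_simps)
  have pos: "0 \<le> f'' u" for u
  proof -
    let ?h = "1 + 2 * \<mu> * R - 2 * \<mu> - \<mu> * (4 - R) * u - \<mu> * u\<^sup>2"
    have "exp u * ?h \<le> exp u * (2 * \<nu> * exp (- u))" by (intro mult_left_mono h) simp
    also have "\<dots> = 2 * \<nu>" by (simp add: exp_minus)
    finally have "0 \<le> 2 * \<nu> - exp u * ?h" by simp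
    also have "\<dots> = f'' u" unfolding f''_def by (simp add: algebra_simps)
    finally show ?thesis .
  qed
  have "f' 0 * (d - 0) \<le> f d - f 0"
    by (rule f''_imp_f'[of UNIV f f' f'']) (use d1 d2 pos in auto)
  moreover have "f' 0 = 0" "f 0 = 0" unfolding f'_def f_def K by (simp_all add: algebra_simps)
  ultimately show ?thesis unfolding f_def by simp
qed

lemma exp_neg_ge_line:
  fixes c E u :: real
  assumes "E \<le> exp (- c)" "0 \<le> E"
  shows "E * (1 + c - u) \<le> exp (- u)"
proof (cases "1 + c - u \<ge> 0")
  case True
  have "E * (1 + c - u) \<le> exp (- c) * exp (c - u)"
    using True assms exp_ge_add_one_self[of "c - u"] by (intro mult_mono) (simp_all add: add_diff_eq)
  then show ?thesis by (simp add: exp_add[symmetric])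
next
  case False
  then have "E * (1 + c - u) \<le> 0" using assms by (intro mult_nonneg_nonpos) auto
  then show ?thesis using exp_ge_zero[of "- u"] by linarith
qed

text \<open>
  The constants satisfy \<open>(1.5175 - 1.48\<^sup>2) 3/4 \<le> -1/2\<close>, and this exponent yields the probability
  \<open>1 / r\<close> for the upper tail.
\<close>

lemma chernoff_scalar_upper:
  "exp d - 1 - 1.5175 * d \<le> (0.49 + 0.2 * exp d) * (d\<^sup>2 - (3/4) * d)" for d :: real
proof (rule chernoff_scalar_inequality)
  fix u :: real
  have "0.77 \<le> (1 - 1/16 :: real) ^ 4" by (simp add: power4_eq_xxxx)
  also have "(1 - 1/16 :: real) ^ 4 \<le> exp (- (1/16) :: real) ^ 4"
    using exp_ge_add_one_self[of "- (1/16) :: real"] by (intro power_mono) auto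
  also have "\<dots> = exp (- (1/4))" using exp_of_nat_mult[of 4 "- (1/16) :: real"] by simp
  finally have E: "0.77 * (1 + 1/4 - u) \<le> exp (- u)" by (intro exp_neg_ge_line) auto
  \<comment> \<open>the left-hand side is concave in \<open>u\<close>; it stays below a line close to the tangent of the right-hand side at \<open>1/4\<close>\<close>
  have "0 \<le> 0.2 * (u - 0.2615)\<^sup>2" by simp
  then have "1 + 2 * 0.2 * (3/4) - 2 * 0.2 - 0.2 * (4 - 3/4) * u - 0.2 * u\<^sup>2 \<le> 2 * 0.49 * (0.77 * (1 + 1/4 - u))"
    by (simp add: power2_eq_square algebra_simps)
  also have "\<dots> \<le> 2 * 0.49 * exp (- u)" using E by (intro mult_left_mono) auto
  finally show "1 + 2 * 0.2 * (3/4) - 2 * 0.2 - 0.2 * (4 - 3/4) * u - 0.2 * u\<^sup>2 \<le> 2 * 0.49 * exp (- u)" .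
qed simp

text \<open>
  Here \<open>- (3/2) (0.49345 - 0.40\<^sup>2) \<le> -1/2\<close>, which serves the lower tail in the same way.
\<close>

lemma chernoff_scalar_lower:
  "exp d - 1 - 0.49345 * d \<le> (0.2077 + 0.13 * exp d) * (d\<^sup>2 - (- (3/2)) * d)" for d :: real
proof (rule chernoff_scalar_inequality)
  fix u :: real
  have "1.49 \<le> (1 + 1/10 + (1/10)\<^sup>2 / 2 :: real) ^ 4" by (simp add: power4_eq_xxxx power2_eq_square)
  also have "\<dots> \<le> exp (1/10) ^ 4"
    using exp_lower_Taylor_quadratic[of "1/10 :: real"] by (intro power_mono) auto
  also have "\<dots> = exp (- (- (2/5)))" using exp_of_nat_mult[of 4 "1/10 :: real"] by simp
  finally have E: "1.49 * (1 + (- (2/5)) - u) \<le> exp (- u)" by (intro exp_neg_ge_line) auto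
  \<comment> \<open>the separating line is close to the tangent of the right-hand side at \<open>- 2/5\<close>\<close>
  have "0 \<le> 0.13 * (u + 240135 / 650000)\<^sup>2" by simp
  then have "1 + 2 * 0.13 * (- (3/2)) - 2 * 0.13 - 0.13 * (4 - (- (3/2))) * u - 0.13 * u\<^sup>2
    \<le> 2 * 0.2077 * (1.49 * (1 + (- (2/5)) - u))"
    by (simp add: power2_eq_square algebra_simps)
  also have "\<dots> \<le> 2 * 0.2077 * exp (- u)" using E by (intro mult_left_mono) auto
  finally show "1 + 2 * 0.13 * (- (3/2)) - 2 * 0.13 - 0.13 * (4 - (- (3/2))) * u - 0.13 * u\<^sup>2 \<le> 2 * 0.2077 * exp (- u)" .
qed simp

section \<open>Exponential moments on the circle\<close>

lemma cosh_le_exp_square: "cosh x \<le> exp (x\<^sup>2 / 2)" for x :: real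
proof -
  have *: "cosh x \<le> exp (x\<^sup>2 / 2)" if x: "0 \<le> x" for x :: real
  proof -
    have sinh_le: "sinh y \<le> y * cosh y" if "0 \<le> y" for y :: real
    proof -
      have "(\<lambda>y. y * cosh y - sinh y) 0 \<le> (\<lambda>y. y * cosh y - sinh y) y"
        by (rule DERIV_nonneg_imp_nondecreasing[OF that])
          (auto intro!: derivative_eq_intros exI mult_nonneg_nonneg)
      then show ?thesis by simp
    qed
    have "(\<lambda>y. exp (- (y\<^sup>2 / 2)) * cosh y) x \<le> (\<lambda>y. exp (- (y\<^sup>2 / 2)) * cosh y) 0"
    proof (rule DERIV_nonpos_imp_nonincreasing[OF x])
      fix y :: real assume "0 \<le> y"
      have "DERIV (\<lambda>y. exp (- (y\<^sup>2 / 2)) * cosh y) y :> exp (- (y\<^sup>2 / 2)) * (sinh y - y * cosh y)"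
        by (auto intro!: derivative_eq_intros simp: algebra_simps)
      moreover have "exp (- (y\<^sup>2 / 2)) * (sinh y - y * cosh y) \<le> 0"
        using sinh_le[OF \<open>0 \<le> y\<close>] by (intro mult_nonneg_nonpos) auto
      ultimately show "\<exists>D. DERIV (\<lambda>y. exp (- (y\<^sup>2 / 2)) * cosh y) y :> D \<and> D \<le> 0" by blast
    qed
    then show ?thesis by (simp add: exp_minus field_simps)
  qed
  show ?thesis using *[of "\<bar>x\<bar>"] by simp
qed

text \<open>
  The sum is \<open>2 cosh ((a + b) / 2) cosh ((a - b) / 2)\<close>, and \<open>cosh_le_exp_square\<close> applies to both factors.
\<close>

lemma cosh_add_cosh_le: "cosh a + cosh b \<le> 2 * exp ((a\<^sup>2 + b\<^sup>2) / 4)" for a b :: real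
proof -
  have "cosh a + cosh b = 2 * (cosh ((a + b) / 2) * cosh ((a - b) / 2))"
  proof -
    have "a = (a + b) / 2 + (a - b) / 2" "b = (a + b) / 2 - (a - b) / 2" by (simp_all add: field_simps)
    then show ?thesis
      using cosh_add[of "(a + b) / 2" "(a - b) / 2"] cosh_diff[of "(a + b) / 2" "(a - b) / 2"] by simp
  qed
  also have "\<dots> \<le> 2 * (exp (((a + b) / 2)\<^sup>2 / 2) * exp (((a - b) / 2)\<^sup>2 / 2))"
    by (intro mult_left_mono mult_mono cosh_le_exp_square) auto
  also have "\<dots> = 2 * exp ((a\<^sup>2 + b\<^sup>2) / 4)"
    unfolding exp_add[symmetric] by (simp add: power2_eq_square field_simps)
  finally show ?thesis .
qed

text \<open>
  Averaging over the rotations by powers of \<open>\<i>\<close> is already enough for the constant \<open>1/4\<close>, so the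
  moment generating function of the circle can be bounded without Bessel functions.
\<close>

lemma exp_rotations_le:
  assumes z: "cmod z = 1"
  shows "exp (Re (z * w)) + exp (Re (\<i> * z * w)) + exp (Re (\<i> * (\<i> * z) * w)) + exp (Re (\<i> * (\<i> * (\<i> * z)) * w))
    \<le> 4 * exp ((cmod w)\<^sup>2 / 4)"
proof -
  define a b where "a = Re (z * w)" and "b = Im (z * w)"
  have ab: "a\<^sup>2 + b\<^sup>2 = (cmod w)\<^sup>2" unfolding a_def b_def using z by (metis cmod_power2 norm_mult mult_1)
  have rot: "Re (z * w) = a" "Re (\<i> * z * w) = - b" "Re (\<i> * (\<i> * z) * w) = - a" "Re (\<i> * (\<i> * (\<i> * z)) * w) = b"
    by (simp_all add: a_def b_def algebra_simps)
  have "exp a + exp (- a) = 2 * cosh a" "exp b + exp (- b) = 2 * cosh b"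
    by (simp_all add: cosh_def)
  then show ?thesis using cosh_add_cosh_le[of a b] unfolding rot ab by linarith
qed

lemma sets_uniform_circle [measurable_cong, simp]: "sets uniform_circle = sets borel"
  unfolding uniform_circle_def by simp

lemma space_uniform_circle [simp]: "space uniform_circle = UNIV"
  unfolding uniform_circle_def by simp

lemma cis_measurable [measurable]: "cis \<in> borel_measurable borel"
  by (intro borel_measurable_continuous_onI continuous_intros)

lemma prob_space_uniform_circle: "prob_space uniform_circle"
  unfolding uniform_circle_def
  by (intro prob_space.prob_space_distr prob_space_uniform_measure) auto

lemma AE_uniform_circle: "AE z in uniform_circle. cmod z = 1"
  unfolding uniform_circle_def by (subst AE_distr_iff) auto

lemma nn_integral_uniform_circle:
  assumes [measurable]: "f \<in> borel_measurable borel"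
  shows "(\<integral>\<^sup>+z. f z \<partial>uniform_circle) =
    (\<integral>\<^sup>+t. f (cis t) * indicator {0..2 * pi} t \<partial>lborel) / ennreal (2 * pi)"
  unfolding uniform_circle_def
  by (simp add: nn_integral_distr nn_integral_uniform_measure)

lemma nn_integral_periodic_shift:
  fixes h :: "real \<Rightarrow> ennreal"
  assumes [measurable]: "h \<in> borel_measurable borel" and per: "\<And>t. h (t + p) = h t"
    and s: "0 \<le> s" "s \<le> p"
  shows "(\<integral>\<^sup>+t. h (t + s) * indicator {0..p} t \<partial>lborel) = (\<integral>\<^sup>+t. h t * indicator {0..p} t \<partial>lborel)"
proof -
  let ?I = "\<lambda>(g :: real \<Rightarrow> ennreal) A. \<integral>\<^sup>+t. g t * indicator A t \<partial>lborel"
  have shift: "(\<integral>\<^sup>+t. f (t + u) \<partial>lborel) = (\<integral>\<^sup>+t. f t \<partial>lborel)"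
    if "f \<in> borel_measurable borel" for f :: "real \<Rightarrow> ennreal" and u
    using nn_integral_real_affine[OF that, of 1 u] by (simp add: add.commute)
  have half_open: "?I g {a..b} = ?I g {a..<b}"
    for g :: "real \<Rightarrow> ennreal" and a b
    by (rule nn_integral_cong_AE, rule AE_mp[OF AE_lborel_singleton[of b]]) (auto simp: indicator_def)
  have split: "?I h {a..<c} =
      ?I h {a..<b} + ?I h {b..<c}"
    if "a \<le> b" "b \<le> c" for a b c
    by (subst nn_integral_add[symmetric]) (use that in \<open>auto intro!: nn_integral_cong simp: indicator_def\<close>)
  have move: "?I (\<lambda>t. h (t + u)) {a..<b} = ?I h {a + u..<b + u}"
    for a b u
  proof -
    have "?I (\<lambda>t. h (t + u)) {a..<b} = (\<integral>\<^sup>+t. h (t + u) * indicator {a + u..<b + u} (t + u) \<partial>lborel)"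
      by (intro nn_integral_cong) (auto simp: indicator_def)
    then show ?thesis using shift[of "\<lambda>t. h t * indicator {a + u..<b + u} t" u] by simp
  qed
  have "?I (\<lambda>t. h (t + s)) {0..p} = ?I h {s..<p + s}"
    unfolding half_open[of _ 0 p] move by simp
  also have "\<dots> = ?I h {s..<p} + ?I h {0 + p..<s + p}"
    using s by (subst split[of s p]) (auto simp: add.commute)
  also have "?I h {0 + p..<s + p} = ?I h {0..<s}"
    unfolding move[symmetric] per ..
  also have "?I h {s..<p} + ?I h {0..<s}
    = ?I h {0..p}"
    unfolding half_open[of _ 0 p] using split[of 0 s p] s by (simp add: add.commute)
  finally show ?thesis .
qed

lemma nn_integral_uniform_circle_rotate:
  assumes [measurable]: "f \<in> borel_measurable borel"
  shows "(\<integral>\<^sup>+z. f (\<i> * z) \<partial>uniform_circle) = (\<integral>\<^sup>+z. f z \<partial>uniform_circle)"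
proof -
  have "\<i> * cis t = cis (t + pi / 2)" for t by (simp add: cis_mult[symmetric])
  moreover have "(\<integral>\<^sup>+t. f (cis (t + pi / 2)) * indicator {0..2 * pi} t \<partial>lborel) =
      (\<integral>\<^sup>+t. f (cis t) * indicator {0..2 * pi} t \<partial>lborel)"
    by (rule nn_integral_periodic_shift) (auto simp: cis_mult[symmetric])
  ultimately show ?thesis by (simp add: nn_integral_uniform_circle)
qed

text \<open>
  The right-hand side is the moment generating function of a complex Gaussian variable with the same
  covariance. This sharp constant is what makes \<open>r\<close> the leading term in the bound on the norms.
\<close>

lemma uniform_circle_mgf:
  "(\<integral>\<^sup>+z. ennreal (exp (Re (z * w))) \<partial>uniform_circle) \<le> ennreal (exp ((cmod w)\<^sup>2 / 4))"
proof -
  interpret prob_space uniform_circle by (rule prob_space_uniform_circle)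
  define f where "f z = ennreal (exp (Re (z * w)))" for z
  have [measurable]: "f \<in> borel_measurable borel" unfolding f_def by measurable
  let ?I = "\<integral>\<^sup>+z. f z \<partial>uniform_circle"
  have r1: "(\<integral>\<^sup>+z. f (\<i> * z) \<partial>uniform_circle) = ?I" by (rule nn_integral_uniform_circle_rotate) simp
  have r2: "(\<integral>\<^sup>+z. f (\<i> * (\<i> * z)) \<partial>uniform_circle) = ?I"
    using nn_integral_uniform_circle_rotate[of "\<lambda>z. f (\<i> * z)"] r1 by simp
  have r3: "(\<integral>\<^sup>+z. f (\<i> * (\<i> * (\<i> * z))) \<partial>uniform_circle) = ?I"
    using nn_integral_uniform_circle_rotate[of "\<lambda>z. f (\<i> * (\<i> * z))"] r2 by simp
  have four: "(4::ennreal) = 1 + 1 + 1 + 1" by simp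
  have "4 * ?I = ?I + ?I + ?I + ?I" unfolding four distrib_right mult_1 ..
  also have "\<dots> = (\<integral>\<^sup>+z. f z + f (\<i> * z) + f (\<i> * (\<i> * z)) + f (\<i> * (\<i> * (\<i> * z))) \<partial>uniform_circle)"
    by (subst nn_integral_add, measurable)+ (simp only: r1 r2 r3)
  also have "\<dots> \<le> (\<integral>\<^sup>+z. ennreal (4 * exp ((cmod w)\<^sup>2 / 4)) \<partial>uniform_circle)"
  proof (rule nn_integral_mono_AE, rule AE_mp[OF AE_uniform_circle], rule AE_I2, rule impI)
    fix z assume "cmod z = 1"
    from exp_rotations_le[OF this, of w]
    show "f z + f (\<i> * z) + f (\<i> * (\<i> * z)) + f (\<i> * (\<i> * (\<i> * z))) \<le> ennreal (4 * exp ((cmod w)\<^sup>2 / 4))"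
      unfolding f_def by (simp add: ennreal_plus[symmetric] del: ennreal_plus)
  qed
  also have "\<dots> = 4 * ennreal (exp ((cmod w)\<^sup>2 / 4))"
    using emeasure_space_1 by (simp add: ennreal_mult)
  finally have "4 * ?I \<le> 4 * ennreal (exp ((cmod w)\<^sup>2 / 4))" .
  then have "?I \<le> ennreal (exp ((cmod w)\<^sup>2 / 4))"
    by (subst (asm) ennreal_mult_le_mult_iff) auto
  then show ?thesis unfolding f_def .
qed

definition std_normal :: "real measure" where "std_normal = density lborel std_normal_density"

lemma sets_std_normal [measurable_cong, simp]: "sets std_normal = sets borel"
  unfolding std_normal_def by simp

lemma prob_space_std_normal: "prob_space std_normal"
  unfolding std_normal_def by (rule prob_space_normal_density) simp

lemma std_normal_mgf: "(\<integral>\<^sup>+g. ennreal (exp (c * g)) \<partial>std_normal) = ennreal (exp (c\<^sup>2 / 2))"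
proof -
  interpret N: prob_space "density lborel (normal_density c 1)" by (rule prob_space_normal_density) simp
  have "(\<integral>\<^sup>+g. ennreal (exp (c * g)) \<partial>std_normal) = (\<integral>\<^sup>+g. ennreal (std_normal_density g) * ennreal (exp (c * g)) \<partial>lborel)"
    unfolding std_normal_def by (subst nn_integral_density) auto
  also have "\<dots> = (\<integral>\<^sup>+g. ennreal (exp (c\<^sup>2 / 2)) * ennreal (normal_density c 1 g) \<partial>lborel)"
  proof (rule nn_integral_cong)
    fix g :: real
    have "- g\<^sup>2 / 2 + c * g = c\<^sup>2 / 2 + - (g - c)\<^sup>2 / 2" by (simp add: power2_eq_square field_simps)
    then have "exp (- g\<^sup>2 / 2) * exp (c * g) = exp (c\<^sup>2 / 2) * exp (- (g - c)\<^sup>2 / 2)" by (simp only: exp_add[symmetric])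
    then have "std_normal_density g * exp (c * g) = exp (c\<^sup>2 / 2) * normal_density c 1 g"
      unfolding std_normal_density_def normal_density_def by simp
    then show "ennreal (std_normal_density g) * ennreal (exp (c * g)) = ennreal (exp (c\<^sup>2 / 2)) * ennreal (normal_density c 1 g)"
      by (simp add: ennreal_mult[symmetric])
  qed
  also have "\<dots> = ennreal (exp (c\<^sup>2 / 2)) * (\<integral>\<^sup>+g. ennreal (normal_density c 1 g) \<partial>lborel)"
    by (rule nn_integral_cmult) simp
  also have "(\<integral>\<^sup>+g. ennreal (normal_density c 1 g) \<partial>lborel) = 1"
    using N.emeasure_space_1 by (simp add: emeasure_density)
  finally show ?thesis by simp
qed

lemma std_normal_square_mgf:
  assumes "l < 1"
  shows "(\<integral>\<^sup>+g. ennreal (exp (l * g\<^sup>2 / 2)) \<partial>std_normal) = ennreal (1 / sqrt (1 - l))"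
proof -
  define \<sigma> where "\<sigma> = 1 / sqrt (1 - l)"
  have \<sigma>: "\<sigma> > 0" "\<sigma>\<^sup>2 = 1 / (1 - l)" using assms unfolding \<sigma>_def by (auto simp: power_divide)
  interpret N: prob_space "density lborel (normal_density 0 \<sigma>)" by (rule prob_space_normal_density) (rule \<sigma>)
  have "(\<integral>\<^sup>+g. ennreal (exp (l * g\<^sup>2 / 2)) \<partial>std_normal) = (\<integral>\<^sup>+g. ennreal (std_normal_density g) * ennreal (exp (l * g\<^sup>2 / 2)) \<partial>lborel)"
    unfolding std_normal_def by (subst nn_integral_density) auto
  also have "\<dots> = (\<integral>\<^sup>+g. ennreal \<sigma> * ennreal (normal_density 0 \<sigma> g) \<partial>lborel)"
  proof (rule nn_integral_cong)
    fix g :: real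
    have "- g\<^sup>2 / 2 + l * g\<^sup>2 / 2 = - (g - 0)\<^sup>2 / (2 * \<sigma>\<^sup>2)" unfolding \<sigma>(2) by (simp add: field_simps)
    then have "exp (- g\<^sup>2 / 2) * exp (l * g\<^sup>2 / 2) = exp (- (g - 0)\<^sup>2 / (2 * \<sigma>\<^sup>2))" by (simp only: exp_add[symmetric])
    moreover have "sqrt (2 * pi * \<sigma>\<^sup>2) = sqrt (2 * pi) * \<sigma>" using \<sigma>(1) by (simp add: real_sqrt_mult)
    ultimately have "std_normal_density g * exp (l * g\<^sup>2 / 2) = \<sigma> * normal_density 0 \<sigma> g"
      unfolding std_normal_density_def normal_density_def using \<sigma>(1) by simp
    then show "ennreal (std_normal_density g) * ennreal (exp (l * g\<^sup>2 / 2)) = ennreal \<sigma> * ennreal (normal_density 0 \<sigma> g)"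
      using \<sigma>(1) by (simp add: ennreal_mult[symmetric])
  qed
  also have "\<dots> = ennreal \<sigma> * (\<integral>\<^sup>+g. ennreal (normal_density 0 \<sigma> g) \<partial>lborel)"
    by (rule nn_integral_cmult) simp
  also have "(\<integral>\<^sup>+g. ennreal (normal_density 0 \<sigma> g) \<partial>lborel) = 1"
    using N.emeasure_space_1 by (simp add: emeasure_density)
  finally show ?thesis unfolding \<sigma>_def by simp
qed

section \<open>Norms of random combinations\<close>

abbreviation complex_normal :: "(real \<times> real) measure" where
  "complex_normal \<equiv> std_normal \<Otimes>\<^sub>M std_normal"

lemma std_normal_pair_mgf:
  "(\<integral>\<^sup>+g. ennreal (exp (c * (fst g * u + snd g * v))) \<partial>complex_normal) = ennreal (exp (c\<^sup>2 * (u\<^sup>2 + v\<^sup>2) / 2))"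
proof -
  interpret N: prob_space std_normal by (rule prob_space_std_normal)
  have "(\<integral>\<^sup>+g. ennreal (exp (c * (fst g * u + snd g * v))) \<partial>complex_normal)
    = (\<integral>\<^sup>+x. \<integral>\<^sup>+y. ennreal (exp (c * (x * u + y * v))) \<partial>std_normal \<partial>std_normal)"
    by (subst N.nn_integral_fst[symmetric]) auto
  also have "\<dots> = (\<integral>\<^sup>+x. \<integral>\<^sup>+y. ennreal (exp (c * u * x)) * ennreal (exp (c * v * y)) \<partial>std_normal \<partial>std_normal)"
    by (intro nn_integral_cong) (simp add: ennreal_mult[symmetric] exp_add[symmetric] algebra_simps)
  also have "\<dots> = ennreal (exp ((c * u)\<^sup>2 / 2)) * ennreal (exp ((c * v)\<^sup>2 / 2))"
    by (simp add: nn_integral_cmult nn_integral_multc std_normal_mgf)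
  also have "\<dots> = ennreal (exp (c\<^sup>2 * (u\<^sup>2 + v\<^sup>2) / 2))"
    by (simp add: ennreal_mult[symmetric] exp_add[symmetric] power_mult_distrib add_divide_distrib ring_distribs)
  finally show ?thesis .
qed

lemma std_normal_pair_square_mgf:
  assumes "l < 1"
  shows "(\<integral>\<^sup>+g. ennreal (exp (l / 2 * ((fst g)\<^sup>2 + (snd g)\<^sup>2))) \<partial>complex_normal) = ennreal (1 / (1 - l))"
proof -
  interpret N: prob_space std_normal by (rule prob_space_std_normal)
  have "(\<integral>\<^sup>+g. ennreal (exp (l / 2 * ((fst g)\<^sup>2 + (snd g)\<^sup>2))) \<partial>complex_normal)
    = (\<integral>\<^sup>+x. \<integral>\<^sup>+y. ennreal (exp (l / 2 * (x\<^sup>2 + y\<^sup>2))) \<partial>std_normal \<partial>std_normal)"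
    by (subst N.nn_integral_fst[symmetric]) auto
  also have "\<dots> = (\<integral>\<^sup>+x. \<integral>\<^sup>+y. ennreal (exp (l * x\<^sup>2 / 2)) * ennreal (exp (l * y\<^sup>2 / 2)) \<partial>std_normal \<partial>std_normal)"
    by (intro nn_integral_cong) (simp add: ennreal_mult[symmetric] exp_add[symmetric] algebra_simps add_divide_distrib)
  also have "\<dots> = ennreal (1 / sqrt (1 - l)) * ennreal (1 / sqrt (1 - l))"
    by (simp add: nn_integral_cmult nn_integral_multc std_normal_square_mgf[OF assms])
  also have "\<dots> = ennreal (1 / (1 - l))"
    using assms by (simp add: ennreal_mult[symmetric])
  finally show ?thesis .
qed

definition circle_product :: "nat \<Rightarrow> (nat \<Rightarrow> complex) measure" where
  "circle_product n = (\<Pi>\<^sub>M i\<in>{..<n}. uniform_circle)"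

lemma sum_norm_square_orthonormal_rows:
  fixes q :: "nat \<Rightarrow> nat \<Rightarrow> complex"
  assumes rows: "\<And>a b. a < r \<Longrightarrow> b < r \<Longrightarrow> (\<Sum>k<n. q k a * cnj (q k b)) = (if a = b then 1 else 0)"
  shows "(\<Sum>k<n. (cmod (\<Sum>a<r. g a * q k a))\<^sup>2) = norm_square r g"
proof -
  have "complex_of_real (\<Sum>k<n. (cmod (\<Sum>a<r. g a * q k a))\<^sup>2)
    = (\<Sum>k<n. \<Sum>a<r. \<Sum>b<r. (g a * cnj (g b)) * (q k a * cnj (q k b)))"
    by (simp add: complex_norm_square sum_product mult_ac del: of_real_power)
  also have "\<dots> = (\<Sum>a<r. \<Sum>b<r. \<Sum>k<n. (g a * cnj (g b)) * (q k a * cnj (q k b)))"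
    by (subst sum.swap, rule sum.cong[OF refl], rule sum.swap)
  also have "\<dots> = (\<Sum>a<r. \<Sum>b<r. (g a * cnj (g b)) * (if a = b then 1 else 0))"
    unfolding sum_distrib_left[symmetric] by (intro sum.cong refl) (simp add: rows)
  also have "\<dots> = (\<Sum>a<r. g a * cnj (g a))"
    by (simp add: if_distrib[of "(*) _"] cong: if_cong)
  also have "\<dots> = complex_of_real (norm_square r g)"
    by (simp add: complex_norm_square del: of_real_power)
  finally show ?thesis by (simp only: of_real_eq_iff)
qed

lemma circle_component_measurable:
  "k < n \<Longrightarrow> (\<lambda>d. d k) \<in> borel_measurable (circle_product n)"
  unfolding circle_product_def
  using measurable_component_singleton[of k "{..<n}" "\<lambda>_. uniform_circle"]
  by (simp add: measurable_cong_sets[OF refl sets_uniform_circle])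

lemma prob_space_circle_product: "prob_space (circle_product n)"
  unfolding circle_product_def by (intro prob_space_PiM prob_space_uniform_circle)

lemma ennreal_exp_sum: "finite A \<Longrightarrow> ennreal (exp (\<Sum>i\<in>A. f i)) = (\<Prod>i\<in>A. ennreal (exp (f i)))"
  by (simp add: exp_sum prod_ennreal)

text \<open>
  The square of the norm is linearised by an independent complex Gaussian vector \<open>\<gamma>\<close>: the factor
  \<open>exp (l \<parallel>Y\<parallel>\<^sup>2)\<close> is the expectation of \<open>exp (c Re (\<Sum> \<gamma>\<^sub>a Y\<^sub>a))\<close> with \<open>c\<^sup>2 = 2 l\<close>. For fixed \<open>\<gamma>\<close> the exponent
  is a sum of independent terms in the \<open>d k\<close>, to which \<open>uniform_circle_mgf\<close> applies. As the rows of
  \<open>q\<close> are orthonormal, what remains is the exponential moment of \<open>\<parallel>\<gamma>\<parallel>\<^sup>2\<close>, which is explicit.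
\<close>

lemma circle_sum_norm_mgf:
  fixes q :: "nat \<Rightarrow> nat \<Rightarrow> complex"
  assumes rows: "\<And>a b. a < r \<Longrightarrow> b < r \<Longrightarrow> (\<Sum>k<n. q k a * cnj (q k b)) = (if a = b then 1 else 0)"
    and l: "0 \<le> l" "l < 1"
  shows "(\<integral>\<^sup>+d. ennreal (exp (l * (\<Sum>a<r. (cmod (\<Sum>k<n. d k * q k a))\<^sup>2))) \<partial>circle_product n) \<le> ennreal ((1 / (1 - l)) ^ r)"
proof -
  let ?N = "circle_product n"
  define G where "G = (\<Pi>\<^sub>M a\<in>{..<r}. complex_normal)"
  define Y where "Y d a = (\<Sum>k<n. d k * q k a)" for d a
  \<comment> \<open>this sign makes \<open>Re (\<gamma>\<^sub>a Y\<^sub>a)\<close> the real inner product of \<open>g a\<close> with the components of \<open>Y\<^sub>a\<close>\<close>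
  define \<gamma> where "\<gamma> g a = Complex (fst (g a)) (- snd (g a))" for g :: "nat \<Rightarrow> real \<times> real" and a
  define c where "c = sqrt (2 * l)"
  define E where "E d g = ennreal (exp (c * (\<Sum>a<r. fst (g a) * Re (Y d a) + snd (g a) * Im (Y d a))))" for d and g :: "nat \<Rightarrow> real \<times> real"
  have c2: "c\<^sup>2 = 2 * l" using l unfolding c_def by simp
  interpret N: prob_space std_normal by (rule prob_space_std_normal)
  interpret NN: pair_prob_space std_normal std_normal ..
  interpret C: prob_space uniform_circle by (rule prob_space_uniform_circle)
  interpret PC: product_sigma_finite "\<lambda>_::nat. uniform_circle" by standard
  interpret PG: product_sigma_finite "\<lambda>_::nat. complex_normal" by standard
  interpret CP: prob_space "circle_product n" by (rule prob_space_circle_product)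
  interpret G: prob_space G unfolding G_def by (intro prob_space_PiM NN.prob_space_axioms)
  interpret P: pair_sigma_finite "circle_product n" G by standard
  have gm: "(\<lambda>g. fst (g a)) \<in> borel_measurable G" "(\<lambda>g. snd (g a)) \<in> borel_measurable G" if "a < r" for a
  proof -
    have "(\<lambda>g. g a) \<in> measurable G complex_normal"
      unfolding G_def using that by (intro measurable_component_singleton) simp
    from measurable_compose[OF this measurable_fst] measurable_compose[OF this measurable_snd]
    show "(\<lambda>g. fst (g a)) \<in> borel_measurable G" "(\<lambda>g. snd (g a)) \<in> borel_measurable G"
      by (simp_all add: measurable_cong_sets[OF refl sets_std_normal])
  qed
  have Ym: "(\<lambda>d. Y d a) \<in> borel_measurable ?N" for a
    unfolding Y_def by (intro borel_measurable_sum borel_measurable_times borel_measurable_const circle_component_measurable) simp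
  have meas: "case_prod E \<in> borel_measurable (?N \<Otimes>\<^sub>M G)"
  proof -
    have [measurable]: "(\<lambda>x. Y (fst x) a) \<in> borel_measurable (?N \<Otimes>\<^sub>M G)" for a
      using measurable_compose[OF measurable_fst Ym] .
    have 1: "(\<lambda>x. fst (snd x a)) \<in> borel_measurable (?N \<Otimes>\<^sub>M G)"
      "(\<lambda>x. snd (snd x a)) \<in> borel_measurable (?N \<Otimes>\<^sub>M G)" if "a < r" for a
      using measurable_compose[OF measurable_snd gm(1)[OF that]] measurable_compose[OF measurable_snd gm(2)[OF that]] by auto
    have "(\<lambda>x. \<Sum>a<r. fst (snd x a) * Re (Y (fst x) a) + snd (snd x a) * Im (Y (fst x) a)) \<in> borel_measurable (?N \<Otimes>\<^sub>M G)"
      by (intro borel_measurable_sum borel_measurable_add borel_measurable_times 1) auto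
    then show ?thesis unfolding E_def case_prod_beta by measurable
  qed
  have decouple: "ennreal (exp (l * norm_square r (Y d))) = (\<integral>\<^sup>+g. E d g \<partial>G)" for d
  proof -
    have "(\<integral>\<^sup>+g. E d g \<partial>G) = (\<integral>\<^sup>+g. (\<Prod>a<r. ennreal (exp (c * (fst (g a) * Re (Y d a) + snd (g a) * Im (Y d a))))) \<partial>G)"
      unfolding E_def sum_distrib_left ennreal_exp_sum[OF finite_lessThan] ..
    also have "\<dots> = (\<Prod>a<r. \<integral>\<^sup>+h. ennreal (exp (c * (fst h * Re (Y d a) + snd h * Im (Y d a)))) \<partial>complex_normal)"
      unfolding G_def by (rule PG.product_nn_integral_prod) auto
    also have "\<dots> = (\<Prod>a<r. ennreal (exp (l * (cmod (Y d a))\<^sup>2)))"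
      unfolding std_normal_pair_mgf c2 cmod_power2 by simp
    finally show ?thesis unfolding sum_distrib_left ennreal_exp_sum[OF finite_lessThan] by simp
  qed
  have inner: "(\<integral>\<^sup>+d. E d g \<partial>?N) \<le> (\<Prod>a<r. ennreal (exp (l / 2 * ((fst (g a))\<^sup>2 + (snd (g a))\<^sup>2))))" for g
  proof -
    define w where "w k = complex_of_real c * (\<Sum>a<r. \<gamma> g a * q k a)" for k
    have "E d g = (\<Prod>k<n. ennreal (exp (Re (d k * w k))))" for d
    proof -
      have "(\<Sum>a<r. fst (g a) * Re (Y d a) + snd (g a) * Im (Y d a)) = Re (\<Sum>a<r. \<gamma> g a * Y d a)"
        unfolding \<gamma>_def by simp
      also have "(\<Sum>a<r. \<gamma> g a * Y d a) = (\<Sum>k<n. d k * (\<Sum>a<r. \<gamma> g a * q k a))"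
        unfolding Y_def sum_distrib_left by (subst sum.swap) (simp add: mult_ac)
      finally have "c * (\<Sum>a<r. fst (g a) * Re (Y d a) + snd (g a) * Im (Y d a)) = Re (complex_of_real c * (\<Sum>k<n. d k * (\<Sum>a<r. \<gamma> g a * q k a)))"
        by simp
      also have "\<dots> = (\<Sum>k<n. Re (d k * w k))"
        unfolding w_def sum_distrib_left Re_sum[symmetric] by (simp only: mult.left_commute)
      finally show ?thesis unfolding E_def by (simp only: ennreal_exp_sum[OF finite_lessThan])
    qed
    then have "(\<integral>\<^sup>+d. E d g \<partial>?N) = (\<Prod>k<n. \<integral>\<^sup>+z. ennreal (exp (Re (z * w k))) \<partial>uniform_circle)"
      unfolding circle_product_def by (simp, intro PC.product_nn_integral_prod) auto
    also have "\<dots> \<le> (\<Prod>k<n. ennreal (exp ((cmod (w k))\<^sup>2 / 4)))"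
      by (intro prod_mono_ennreal uniform_circle_mgf)
    also have "\<dots> = ennreal (exp (\<Sum>k<n. (cmod (w k))\<^sup>2 / 4))" by (simp only: ennreal_exp_sum[OF finite_lessThan])
    also have "(\<Sum>k<n. (cmod (w k))\<^sup>2 / 4) = l / 2 * (\<Sum>k<n. (cmod (\<Sum>a<r. \<gamma> g a * q k a))\<^sup>2)"
      unfolding w_def sum_distrib_left[of "l / 2"] norm_mult power_mult_distrib by (simp add: c2)
    also have "(\<Sum>k<n. (cmod (\<Sum>a<r. \<gamma> g a * q k a))\<^sup>2) = (\<Sum>a<r. (cmod (\<gamma> g a))\<^sup>2)"
      by (rule sum_norm_square_orthonormal_rows, rule rows)
    also have "l / 2 * (\<Sum>a<r. (cmod (\<gamma> g a))\<^sup>2) = (\<Sum>a<r. l / 2 * ((fst (g a))\<^sup>2 + (snd (g a))\<^sup>2))"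
      unfolding sum_distrib_left by (intro sum.cong refl) (simp add: \<gamma>_def cmod_power2)
    finally show ?thesis unfolding ennreal_exp_sum[OF finite_lessThan] .
  qed
  have "(\<integral>\<^sup>+d. ennreal (exp (l * norm_square r (Y d))) \<partial>?N) = (\<integral>\<^sup>+d. \<integral>\<^sup>+g. E d g \<partial>G \<partial>?N)"
    unfolding decouple ..
  also have "\<dots> = (\<integral>\<^sup>+g. \<integral>\<^sup>+d. E d g \<partial>?N \<partial>G)" by (rule P.Fubini'[OF meas, symmetric])
  also have "\<dots> \<le> (\<integral>\<^sup>+g. (\<Prod>a<r. ennreal (exp (l / 2 * ((fst (g a))\<^sup>2 + (snd (g a))\<^sup>2)))) \<partial>G)"
    by (intro nn_integral_mono inner)
  also have "\<dots> = (\<Prod>a<r. \<integral>\<^sup>+h. ennreal (exp (l / 2 * ((fst h)\<^sup>2 + (snd h)\<^sup>2))) \<partial>complex_normal)"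
    unfolding G_def by (rule PG.product_nn_integral_prod) auto
  also have "\<dots> = ennreal ((1 / (1 - l)) ^ r)"
    unfolding std_normal_pair_square_mgf[OF l(2)] using l by (simp add: ennreal_power)
  finally show ?thesis unfolding Y_def .
qed

text \<open>
  Markov's inequality with the exponent \<open>l = s / (sqrt r + s)\<close>, for which
  \<open>(1 / (1 - l)) ^ r \<le> exp (s sqrt r)\<close> cancels the first term of \<open>l (sqrt r + s)\<^sup>2 = s sqrt r + s\<^sup>2\<close>.
\<close>

lemma circle_sum_norm_tail:
  fixes q :: "nat \<Rightarrow> nat \<Rightarrow> complex"
  assumes rows: "\<And>a b. a < r \<Longrightarrow> b < r \<Longrightarrow> (\<Sum>k<n. q k a * cnj (q k b)) = (if a = b then 1 else 0)"
    and r: "0 < r" and s: "0 \<le> s"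
  shows "emeasure (circle_product n) {d \<in> space (circle_product n). (sqrt r + s)\<^sup>2 \<le> (\<Sum>a<r. (cmod (\<Sum>k<n. d k * q k a))\<^sup>2)} \<le> ennreal (exp (- s\<^sup>2))"
proof -
  let ?N = "circle_product n"
  define l where "l = s / (sqrt r + s)"
  define M where "M = (sqrt r + s)\<^sup>2"
  define Y where "Y d = (\<Sum>a<r. (cmod (\<Sum>k<n. d k * q k a))\<^sup>2)" for d
  have rs: "0 < sqrt r" "0 < sqrt r + s" using r s by (auto intro: add_pos_nonneg)
  have l: "0 \<le> l" "l < 1" using rs s unfolding l_def by auto
  have Ym [measurable]: "Y \<in> borel_measurable ?N"
  proof -
    have [measurable]: "(\<lambda>d. \<Sum>k<n. d k * q k a) \<in> borel_measurable ?N" for a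
      by (intro borel_measurable_sum borel_measurable_times borel_measurable_const circle_component_measurable) simp
    show ?thesis unfolding Y_def by measurable
  qed
  have "{d \<in> space ?N. M \<le> Y d} \<subseteq> {d \<in> space ?N. 1 \<le> ennreal (exp (- (l * M))) * ennreal (exp (l * Y d))}"
    using l by (auto simp: ennreal_mult[symmetric] exp_add[symmetric] mult_left_mono simp del: ennreal_le_1 intro!: ennreal_leI simp flip: ennreal_1)
  then have "emeasure ?N {d \<in> space ?N. M \<le> Y d}
     \<le> emeasure ?N {d \<in> space ?N. 1 \<le> ennreal (exp (- (l * M))) * ennreal (exp (l * Y d))}"
    by (intro emeasure_mono) auto
  also have "\<dots> \<le> ennreal (exp (- (l * M))) * (\<integral>\<^sup>+d. ennreal (exp (l * Y d)) * indicator (space ?N) d \<partial>?N)"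
    by (rule nn_integral_Markov_inequality) auto
  also have "(\<integral>\<^sup>+d. ennreal (exp (l * Y d)) * indicator (space ?N) d \<partial>?N) = (\<integral>\<^sup>+d. ennreal (exp (l * Y d)) \<partial>?N)"
    by (intro nn_integral_cong) simp
  also have "ennreal (exp (- (l * M))) * \<dots> \<le> ennreal (exp (- (l * M))) * ennreal ((1 / (1 - l)) ^ r)"
    unfolding Y_def by (intro mult_left_mono circle_sum_norm_mgf rows l) auto
  also have "\<dots> = ennreal (exp (- (l * M)) * (1 / (1 - l)) ^ r)" using l by (simp add: ennreal_mult[symmetric])
  also have "\<dots> \<le> ennreal (exp (- s\<^sup>2))"
  proof (rule ennreal_leI)
    have lM: "l * M = s * (sqrt r + s)" using rs unfolding l_def M_def by (simp add: power2_eq_square)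
    have "1 / (1 - l) = 1 + s / sqrt r" using rs unfolding l_def by (simp add: field_simps)
    also have "\<dots> \<le> exp (s / sqrt r)" by (rule exp_ge_add_one_self)
    finally have "(1 / (1 - l)) ^ r \<le> exp (s / sqrt r) ^ r" using l by (intro power_mono) auto
    also have "\<dots> = exp (s * sqrt r)" using rs(1) by (simp add: exp_of_nat_mult[symmetric] field_simps)
    finally have "exp (- (l * M)) * (1 / (1 - l)) ^ r \<le> exp (- (l * M)) * exp (s * sqrt r)" by (intro mult_left_mono) auto
    also have "exp (- (l * M)) * exp (s * sqrt r) = exp (- s\<^sup>2)"
      unfolding lM by (simp add: exp_add[symmetric] power2_eq_square algebra_simps)
    finally show "exp (- (l * M)) * (1 / (1 - l)) ^ r \<le> exp (- s\<^sup>2)" .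
  qed
  finally show ?thesis unfolding M_def Y_def .
qed

section \<open>Singular values and Gram matrices\<close>

text \<open>
  The block matrix with rows \<open>(X I, A)\<close> and \<open>(B, I)\<close> has determinant \<open>char_poly (A * B)\<close>, by eliminating
  \<open>B\<close> with column operations. Eliminating \<open>B\<close> with row operations instead, after multiplying the
  lower rows by \<open>X\<close>, relates it to \<open>char_poly (B * A)\<close>.
\<close>

lemma char_poly_mult_swap:
  fixes A B :: "complex mat"
  assumes A: "A \<in> carrier_mat r c" and B: "B \<in> carrier_mat c r"
  shows "[:0, 1:] ^ c * char_poly (A * B) = [:0, 1:] ^ r * char_poly (B * A)"
proof -
  let ?X = "[:0, 1:] :: complex poly"
  define P where "P = map_mat (\<lambda>a. [:a:]) A"
  define Q where "Q = map_mat (\<lambda>a. [:a:]) B"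
  have P [simp]: "P \<in> carrier_mat r c" and Q [simp]: "Q \<in> carrier_mat c r"
    unfolding P_def Q_def using A B by auto
  have mQ [simp]: "- Q \<in> carrier_mat c r" by (simp add: uminus_carrier_iff_mat)
  interpret h: semiring_hom "\<lambda>a::complex. [:a:]" by unfold_locales (auto simp: one_pCons)
  have PQ: "P * Q = map_mat (\<lambda>a. [:a:]) (A * B)" and QP: "Q * P = map_mat (\<lambda>a. [:a:]) (B * A)"
    unfolding P_def Q_def by (simp_all add: h.mat_hom_mult[OF A B] h.mat_hom_mult[OF B A])
  have PQc: "P * Q \<in> carrier_mat r r" and QPc: "Q * P \<in> carrier_mat c c"
    using mult_carrier_mat[OF P Q] mult_carrier_mat[OF Q P] .
  have ABc: "A * B \<in> carrier_mat r r" and BAc: "B * A \<in> carrier_mat c c"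
    using mult_carrier_mat[OF A B] mult_carrier_mat[OF B A] .
  have PmQ: "P * (- Q) = - (P * Q)" "(- Q) * P = - (Q * P)"
    by (rule eq_matI; simp add: carrier_matD[OF P] carrier_matD[OF Q] scalar_prod_def sum_negf)+
  let ?N = "four_block_mat (?X \<cdot>\<^sub>m 1\<^sub>m r) P Q (1\<^sub>m c)"
  let ?L = "four_block_mat (1\<^sub>m r) (0\<^sub>m r c) (- Q) (1\<^sub>m c)"
  let ?K = "four_block_mat (1\<^sub>m r) (0\<^sub>m r c) (- Q) (?X \<cdot>\<^sub>m 1\<^sub>m c)"
  have Xc: "?X \<cdot>\<^sub>m 1\<^sub>m k \<in> carrier_mat k k" for k by simp
  have N: "?N \<in> carrier_mat (r + c) (r + c)" and L: "?L \<in> carrier_mat (r + c) (r + c)" and K: "?K \<in> carrier_mat (r + c) (r + c)"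
    by (auto intro!: four_block_carrier_mat)
  have NL: "?N * ?L = four_block_mat (char_poly_matrix (A * B)) P (0\<^sub>m c r) (1\<^sub>m c)"
  proof -
    have "?X \<cdot>\<^sub>m 1\<^sub>m r * 1\<^sub>m r + P * (- Q) = char_poly_matrix (A * B)"
      unfolding PmQ PQ char_poly_matrix_def right_mult_one_mat[OF Xc]
      by (rule eq_matI) (use carrier_matD[OF ABc] in auto)
    moreover have "?X \<cdot>\<^sub>m 1\<^sub>m r * 0\<^sub>m r c + P * 1\<^sub>m c = P"
      by (simp add: right_mult_zero_mat[OF Xc] right_mult_one_mat[OF P] left_add_zero_mat[OF P])
    moreover have "Q * 1\<^sub>m r + 1\<^sub>m c * (- Q) = 0\<^sub>m c r"
      unfolding right_mult_one_mat[OF Q] left_mult_one_mat[OF mQ]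
      by (rule eq_matI) (use carrier_matD[OF Q] in auto)
    moreover have "Q * 0\<^sub>m r c + 1\<^sub>m c * 1\<^sub>m c = 1\<^sub>m c"
      unfolding right_mult_zero_mat[OF Q] by (rule eq_matI) auto
    ultimately show ?thesis
      by (subst mult_four_block_mat[OF Xc P Q one_carrier_mat one_carrier_mat zero_carrier_mat mQ one_carrier_mat]) simp
  qed
  have KN: "?K * ?N = four_block_mat (?X \<cdot>\<^sub>m 1\<^sub>m r) P (0\<^sub>m c r) (char_poly_matrix (B * A))"
  proof -
    have "1\<^sub>m r * (?X \<cdot>\<^sub>m 1\<^sub>m r) + 0\<^sub>m r c * Q = ?X \<cdot>\<^sub>m 1\<^sub>m r"
      unfolding left_mult_one_mat[OF Xc] left_mult_zero_mat[OF Q] by (rule eq_matI) auto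
    moreover have "1\<^sub>m r * P + 0\<^sub>m r c * 1\<^sub>m c = P"
      unfolding left_mult_one_mat[OF P] by (rule eq_matI) (use carrier_matD[OF P] in auto)
    moreover have "- Q * (?X \<cdot>\<^sub>m 1\<^sub>m r) + ?X \<cdot>\<^sub>m 1\<^sub>m c * Q = 0\<^sub>m c r"
    proof -
      have "- Q * (?X \<cdot>\<^sub>m 1\<^sub>m r) = ?X \<cdot>\<^sub>m (- Q)"
        by (simp add: mult_smult_distrib[OF mQ one_carrier_mat] right_mult_one_mat[OF mQ])
      moreover have "?X \<cdot>\<^sub>m 1\<^sub>m c * Q = ?X \<cdot>\<^sub>m Q"
        by (simp add: mult_smult_assoc_mat[OF one_carrier_mat Q] left_mult_one_mat[OF Q])
      ultimately show ?thesis by (simp, intro eq_matI) (use carrier_matD[OF Q] in auto)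
    qed
    moreover have "- Q * P + ?X \<cdot>\<^sub>m 1\<^sub>m c * 1\<^sub>m c = char_poly_matrix (B * A)"
      unfolding PmQ QP char_poly_matrix_def right_mult_one_mat[OF Xc]
      by (rule eq_matI) (use carrier_matD[OF BAc] in auto)
    ultimately show ?thesis
      by (subst mult_four_block_mat[OF one_carrier_mat zero_carrier_mat mQ Xc Xc P Q one_carrier_mat]) simp
  qed
  have dL: "det ?L = 1"
    using det_four_block_mat_upper_right_zero[OF one_carrier_mat refl mQ one_carrier_mat] by simp
  have dK: "det ?K = ?X ^ c"
    using det_four_block_mat_upper_right_zero[OF one_carrier_mat refl mQ Xc] by simp
  have "char_poly (A * B) = det (?N * ?L)"
    unfolding NL char_poly_def
    using det_four_block_mat_lower_left_zero[OF char_poly_matrix_closed[OF ABc] P refl one_carrier_mat] by simp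
  then have 1: "det ?N = char_poly (A * B)" using det_mult[OF N L] dL by simp
  have "?X ^ r * char_poly (B * A) = det (?K * ?N)"
    unfolding KN char_poly_def
    using det_four_block_mat_lower_left_zero[OF Xc P refl char_poly_matrix_closed[OF BAc]] by simp
  also have "\<dots> = ?X ^ c * char_poly (A * B)" unfolding det_mult[OF K N] dK 1 ..
  finally show ?thesis ..
qed

lemma proots_char_poly_diagonalized:
  assumes A: "A \<in> carrier_mat c c" and U: "unitary_matrix c U"
    and D: "mat_adjoint U * A * U = real_diag c a"
  shows "proots (char_poly A) = image_mset (\<lambda>i. complex_of_real (a i)) (mset_set {..<c})"
proof -
  let ?D = "real_diag c a"
  have Uc: "U \<in> carrier_mat c c" and UU: "mat_adjoint U * U = 1\<^sub>m c" "U * mat_adjoint U = 1\<^sub>m c"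
    using U unfolding unitary_matrix_def by auto
  have "similar_mat ?D A"
    by (rule similar_matI[of _ _ "mat_adjoint U" U c]) (use Uc UU A D in auto)
  then have "char_poly A = char_poly ?D" using char_poly_similar by metis
  also have "\<dots> = (\<Prod>a \<leftarrow> diag_mat ?D. [:- a, 1:])"
    by (rule char_poly_upper_triangular[of _ c]) (auto simp: mat_diag_def)
  also have "diag_mat ?D = map (\<lambda>i. complex_of_real (a i)) [0..<c]"
    unfolding diag_mat_def by (auto simp: mat_diag_def)
  finally have "char_poly A = (\<Prod>i\<leftarrow>[0..<c]. [:- complex_of_real (a i), 1:])" by (simp add: o_def)
  also have "\<dots> = (\<Prod>i<c. [:- complex_of_real (a i), 1:])"
    by (simp add: prod.list_conv_set_nth lessThan_atLeast0)
  finally have "proots (char_poly A) = (\<Sum>i<c. proots [:- complex_of_real (a i), 1:])"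
    by (simp add: proots_prod)
  also have "\<dots> = (\<Sum>i<c. {#complex_of_real (a i)#})" by simp
  also have "\<dots> = image_mset (\<lambda>i. complex_of_real (a i)) (mset_set {..<c})"
    by (induction c) (auto simp: lessThan_Suc)
  finally show ?thesis .
qed

lemma eigenval_eq_rayleigh:
  assumes hA: "hermitian_matrix c A" and i: "i < c"
  shows "eigenvals c A i = Re (rayleigh_form c A (\<lambda>k. eigenbasis c A $$ (k, i)))"
    and "(\<Sum>k<c. (cmod (eigenbasis c A $$ (k, i)))\<^sup>2) = 1"
proof -
  let ?U = "eigenbasis c A"
  have Ac: "A \<in> carrier_mat c c" using hA unfolding hermitian_matrix_def by simp
  have Uc: "?U \<in> carrier_mat c c" and UU: "mat_adjoint ?U * ?U = 1\<^sub>m c"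
    using eigenbasis(1)[OF hA] unfolding unitary_matrix_def by auto
  have "complex_of_real (\<Sum>k<c. (cmod (?U $$ (k, i)))\<^sup>2) = (mat_adjoint ?U * ?U) $$ (i, i)"
    by (rule adjoint_mult_diagonal[OF Uc i, symmetric])
  also have "\<dots> = 1" unfolding UU using i by simp
  finally show "(\<Sum>k<c. (cmod (?U $$ (k, i)))\<^sup>2) = 1" by (simp only: of_real_eq_1_iff)
  have e: "adjoint_apply c ?U (\<lambda>k. ?U $$ (k, i)) j = (if j = i then 1 else 0)" if "j < c" for j
  proof -
    have "adjoint_apply c ?U (\<lambda>k. ?U $$ (k, i)) j = (mat_adjoint ?U * ?U) $$ (j, i)"
      using that i carrier_matD[OF Uc] by (simp add: adjoint_apply_def scalar_prod_def lessThan_atLeast0)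
    then show ?thesis using UU that i by simp
  qed
  have "Re (rayleigh_form c A (\<lambda>k. ?U $$ (k, i))) = (\<Sum>j<c. eigenvals c A j * (cmod (adjoint_apply c ?U (\<lambda>k. ?U $$ (k, i)) j))\<^sup>2)"
    using rayleigh_form_diagonalized[OF Ac eigenbasis[OF hA]] by simp
  also have "\<dots> = (\<Sum>j<c. if j = i then eigenvals c A j else 0)" by (intro sum.cong) (auto simp: e)
  also have "\<dots> = eigenvals c A i" using i by simp
  finally show "eigenvals c A i = Re (rayleigh_form c A (\<lambda>k. ?U $$ (k, i)))" by simp
qed

text \<open>
  The extreme eigenvalues are the extreme values of the Rayleigh quotient. In this form, bounds on
  singular values are conjunctions of inequalities that are explicit in the entries of the matrix; both
  the probabilistic estimates and measurability rely on that.
\<close>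

lemma eigenvals_bound_iff:
  assumes hA: "hermitian_matrix c A"
  shows "(\<forall>i<c. eigenvals c A i \<le> t) \<longleftrightarrow> (\<forall>z. Re (rayleigh_form c A z) \<le> t * norm_square c z)" (is "?le \<longleftrightarrow> ?form_le")
    and "(\<forall>i<c. t \<le> eigenvals c A i) \<longleftrightarrow> (\<forall>z. t * norm_square c z \<le> Re (rayleigh_form c A z))" (is "?ge \<longleftrightarrow> ?form_ge")
proof -
  have Ac: "A \<in> carrier_mat c c" using hA unfolding hermitian_matrix_def by simp
  have R: "Re (rayleigh_form c A z) = (\<Sum>i<c. eigenvals c A i * (cmod (adjoint_apply c (eigenbasis c A) z i))\<^sup>2)" for z
    using rayleigh_form_diagonalized[OF Ac eigenbasis[OF hA]] by simp
  have S: "t * norm_square c z = (\<Sum>i<c. t * (cmod (adjoint_apply c (eigenbasis c A) z i))\<^sup>2)" for z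
    unfolding sum_distrib_left[symmetric] norm_adjoint_apply[OF eigenbasis(1)[OF hA]] ..
  show "?le \<longleftrightarrow> ?form_le"
  proof
    assume ?le
    then show ?form_le
      unfolding R S by (auto intro!: sum_mono mult_right_mono)
  next
    assume ?form_le
    then show ?le using eigenval_eq_rayleigh[OF hA] by (metis mult.right_neutral)
  qed
  show "?ge \<longleftrightarrow> ?form_ge"
  proof
    assume ?ge
    then show ?form_ge
      unfolding R S by (auto intro!: sum_mono mult_right_mono)
  next
    assume ?form_ge
    then show ?ge using eigenval_eq_rayleigh[OF hA] by (metis mult.right_neutral)
  qed
qed

definition row_gram :: "nat \<Rightarrow> nat \<Rightarrow> complex mat \<Rightarrow> complex mat" where
  "row_gram r c M = gram_sum r 1 {..<c} (\<lambda>j a. M $$ (a, j))"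

definition col_gram :: "nat \<Rightarrow> nat \<Rightarrow> complex mat \<Rightarrow> complex mat" where
  "col_gram r c M = gram_sum c 1 {..<r} (\<lambda>i a. cnj (M $$ (i, a)))"

lemma row_gram_eq: "M \<in> carrier_mat r c \<Longrightarrow> M * mat_adjoint M = row_gram r c M"
  by (rule eq_matI) (auto simp: row_gram_def gram_sum_def scalar_prod_def lessThan_atLeast0)

lemma col_gram_eq: "M \<in> carrier_mat r c \<Longrightarrow> mat_adjoint M * M = col_gram r c M"
  by (rule eq_matI) (auto simp: col_gram_def gram_sum_def scalar_prod_def lessThan_atLeast0)

lemma eigenvals_gram_nonneg:
  assumes "i < r"
  shows "0 \<le> eigenvals r (gram_sum r 1 T x) i"
  using eigenvals_bound_iff(2)[of r "gram_sum r 1 T x" 0] assms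
  by (simp add: rayleigh_form_gram_sum sum_nonneg)

lemma proots_gram:
  "proots (char_poly (gram_sum r 1 T x)) = image_mset (\<lambda>i. complex_of_real (eigenvals r (gram_sum r 1 T x) i)) (mset_set {..<r})"
  by (rule proots_char_poly_diagonalized[OF _ eigenbasis]) auto

lemma singular_values_tall:
  assumes M: "M \<in> carrier_mat r c" and le: "c \<le> r"
  shows "singular_values M = rev (sorted_list_of_multiset (image_mset (\<lambda>i. sqrt (eigenvals c (col_gram r c M) i)) (mset_set {..<c})))"
    (is "_ = rev (sorted_list_of_multiset ?S)")
proof -
  have "length (sorted_list_of_multiset ?S) = c"
    by (metis mset_sorted_list_of_multiset size_mset size_image_mset size_mset_set card_lessThan)
  moreover have "image_mset (\<lambda>z. sqrt (Re z)) (proots (char_poly (mat_adjoint M * M))) = ?S"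
    unfolding col_gram_eq[OF M] unfolding col_gram_def proots_gram by (simp add: image_mset.compositionality o_def)
  ultimately show ?thesis unfolding singular_values_def using carrier_matD[OF M] le by simp
qed

text \<open>
  The eigenvalues of \<open>M\<^sup>* M\<close> are those of \<open>M M\<^sup>*\<close> and \<open>c - r\<close> additional zeros. In decreasing order the
  zeros come last, and the definition of the singular values cuts them off.
\<close>

lemma singular_values_wide:
  assumes M: "M \<in> carrier_mat r c" and le: "r \<le> c"
  shows "singular_values M = rev (sorted_list_of_multiset (image_mset (\<lambda>i. sqrt (eigenvals r (row_gram r c M) i)) (mset_set {..<r})))"
    (is "_ = rev (sorted_list_of_multiset ?S)")
proof -
  have Mc: "mat_adjoint M \<in> carrier_mat c r" using M by simp
  have ne: "char_poly (mat_adjoint M * M) \<noteq> 0" "char_poly (M * mat_adjoint M) \<noteq> 0"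
    using degree_monic_char_poly[OF mult_carrier_mat[OF Mc M]] degree_monic_char_poly[OF mult_carrier_mat[OF M Mc]]
    by (metis monic_degree_0 leading_coeff_0_iff zero_neq_one)+
  have pX: "proots ([:0, 1:] ^ k :: complex poly) = replicate_mset k 0" for k
    using proots_power[of "[:0, 1:] :: complex poly" k] proots_linear_factor[of "0 :: complex"]
    by (simp del: proots_linear_factor)
  have "proots ([:0, 1:] ^ r * char_poly (mat_adjoint M * M)) = proots ([:0, 1:] ^ c * char_poly (M * mat_adjoint M))"
    using char_poly_mult_swap[OF M Mc] by simp
  then have "replicate_mset r 0 + proots (char_poly (mat_adjoint M * M)) = replicate_mset c 0 + proots (char_poly (M * mat_adjoint M))"
    using ne by (subst (asm) (1 2) proots_mult) (auto simp: pX)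
  also have "replicate_mset c (0::complex) = replicate_mset r 0 + replicate_mset (c - r) 0"
    using le by (intro multiset_eqI) auto
  finally have "proots (char_poly (mat_adjoint M * M)) = replicate_mset (c - r) 0 + proots (char_poly (M * mat_adjoint M))"
    by (simp add: add.assoc)
  then have ms: "image_mset (\<lambda>z. sqrt (Re z)) (proots (char_poly (mat_adjoint M * M))) = replicate_mset (c - r) 0 + ?S"
    unfolding row_gram_eq[OF M] unfolding row_gram_def proots_gram by (simp add: image_mset.compositionality o_def)
  have nonneg: "0 \<le> x" if "x \<in># ?S" for x
    using that eigenvals_gram_nonneg[of _ r] unfolding row_gram_def by auto
  have "sorted_list_of_multiset (replicate_mset (c - r) 0 + ?S) = replicate (c - r) 0 @ sorted_list_of_multiset ?S"
  proof -
    have "replicate_mset (c - r) 0 + ?S = mset (replicate (c - r) 0 @ sorted_list_of_multiset ?S)" by simp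
    moreover have "sorted (replicate (c - r) 0 @ sorted_list_of_multiset ?S)"
      using nonneg by (auto simp: sorted_append)
    ultimately show ?thesis by (metis sorted_list_of_multiset_mset sorted_sort_id)
  qed
  moreover have "length (sorted_list_of_multiset ?S) = r"
    by (metis mset_sorted_list_of_multiset size_mset size_image_mset size_mset_set card_lessThan)
  ultimately show ?thesis unfolding singular_values_def ms using carrier_matD[OF M] le by simp
qed

lemma sorted_values_bounds:
  fixes a :: "nat \<Rightarrow> real"
  assumes sv: "singular_values M = rev (sorted_list_of_multiset (image_mset a (mset_set {..<m})))" and m: "1 \<le> m"
  shows "sigma_val 1 M \<le> t \<longleftrightarrow> (\<forall>i<m. a i \<le> t)" and "t \<le> sigma_val m M \<longleftrightarrow> (\<forall>i<m. t \<le> a i)"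
proof -
  let ?L = "sorted_list_of_multiset (image_mset a (mset_set {..<m}))"
  have len: "length ?L = m"
    by (metis mset_sorted_list_of_multiset size_mset size_image_mset size_mset_set card_lessThan)
  have set: "set ?L = a ` {..<m}" by simp
  have sorted: "sorted ?L" by simp
  have 1: "sigma_val 1 M = ?L ! (m - 1)" and 2: "sigma_val m M = ?L ! 0"
    unfolding sigma_val_def sv using len m by (simp_all add: rev_nth)
  have "?L ! (m - 1) \<in> set ?L" "?L ! 0 \<in> set ?L" using len m by (auto intro!: nth_mem simp del: set_sorted_list_of_multiset)
  then obtain i j where i: "i < m" "?L ! (m - 1) = a i" and j: "j < m" "?L ! 0 = a j" unfolding set by auto
  have "a k \<le> ?L ! (m - 1) \<and> ?L ! 0 \<le> a k" if "k < m" for k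
  proof -
    have "a k \<in> set ?L" unfolding set using that by simp
    then obtain p where p: "p < m" "?L ! p = a k" unfolding in_set_conv_nth len by auto
    then show ?thesis using sorted_nth_mono[OF sorted, of p "m - 1"] sorted_nth_mono[OF sorted, of 0 p] len by auto
  qed
  then show "sigma_val 1 M \<le> t \<longleftrightarrow> (\<forall>i<m. a i \<le> t)" and "t \<le> sigma_val m M \<longleftrightarrow> (\<forall>i<m. t \<le> a i)"
    unfolding 1 2 using i j by (metis order_trans)+
qed

lemma sigma_1_le_iff_columns:
  assumes M: "M \<in> carrier_mat r c" and c: "1 \<le> c" "c \<le> r" and t: "0 \<le> t"
  shows "sigma_val 1 M \<le> t \<longleftrightarrow>
    (\<forall>w. (\<Sum>i<r. (cmod (\<Sum>j<c. cnj (w j) * cnj (M $$ (i, j))))\<^sup>2) \<le> t\<^sup>2 * norm_square c w)"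
proof -
  have "sigma_val 1 M \<le> t \<longleftrightarrow> (\<forall>j<c. sqrt (eigenvals c (col_gram r c M) j) \<le> t)"
    using sorted_values_bounds(1)[OF singular_values_tall[OF M c(2)] c(1)] .
  also have "\<dots> \<longleftrightarrow> (\<forall>j<c. eigenvals c (col_gram r c M) j \<le> t\<^sup>2)"
    using t real_sqrt_le_iff[of _ "t\<^sup>2"] by simp
  finally show ?thesis
    unfolding col_gram_def eigenvals_bound_iff(1)[OF hermitian_gram_sum] rayleigh_form_gram_sum by simp
qed

lemma sigma_wide_bounds_iff:
  assumes M: "M \<in> carrier_mat r c" and r: "1 \<le> r" "r \<le> c" and t: "0 \<le> t"
  shows "sigma_val 1 M \<le> t \<longleftrightarrow>
      (\<forall>z. (\<Sum>j<c. (cmod (\<Sum>a<r. cnj (z a) * M $$ (a, j)))\<^sup>2) \<le> t\<^sup>2 * norm_square r z)"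
      (is ?first)
    and "t \<le> sigma_val r M \<longleftrightarrow>
      (\<forall>z. t\<^sup>2 * norm_square r z \<le> (\<Sum>j<c. (cmod (\<Sum>a<r. cnj (z a) * M $$ (a, j)))\<^sup>2))"
      (is ?last)
proof -
  have "sigma_val 1 M \<le> t \<longleftrightarrow> (\<forall>i<r. sqrt (eigenvals r (row_gram r c M) i) \<le> t)"
    using sorted_values_bounds(1)[OF singular_values_wide[OF M r(2)] r(1)] .
  also have "\<dots> \<longleftrightarrow> (\<forall>i<r. eigenvals r (row_gram r c M) i \<le> t\<^sup>2)"
    using t real_sqrt_le_iff[of _ "t\<^sup>2"] by simp
  finally show ?first
    unfolding row_gram_def eigenvals_bound_iff(1)[OF hermitian_gram_sum] rayleigh_form_gram_sum by simp
  have "t \<le> sigma_val r M \<longleftrightarrow> (\<forall>i<r. t \<le> sqrt (eigenvals r (row_gram r c M) i))"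
    using sorted_values_bounds(2)[OF singular_values_wide[OF M r(2)] r(1)] .
  also have "\<dots> \<longleftrightarrow> (\<forall>i<r. t\<^sup>2 \<le> eigenvals r (row_gram r c M) i)"
    using t real_sqrt_le_iff[of "t\<^sup>2"] by simp
  finally show ?last
    unfolding row_gram_def eigenvals_bound_iff(2)[OF hermitian_gram_sum] rayleigh_form_gram_sum by simp
qed

section \<open>Flatness of the two transforms\<close>

text \<open>
  The two properties that the Walsh--Hadamard and the Fourier matrix share and on which the result rests.
\<close>

definition flat_unitary :: "nat \<Rightarrow> complex mat \<Rightarrow> bool" where
  "flat_unitary n F \<longleftrightarrow> F \<in> carrier_mat n n \<and>
     (\<forall>a<n. \<forall>b<n. (\<Sum>j<n. F $$ (a, j) * cnj (F $$ (b, j))) = (if a = b then 1 else 0)) \<and>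
     (\<forall>a<n. \<forall>j<n. (cmod (F $$ (a, j)))\<^sup>2 = 1 / real n)"

text \<open>
  Up to a factor, the inner product of two rows \<open>a \<noteq> b\<close> is the sum of the powers of
  \<open>\<omega> powi (a - b)\<close>, an \<open>n\<close>-th root of unity other than \<open>1\<close>; such a sum vanishes.
\<close>

lemma flat_unitary_dft: "flat_unitary n (unitary_dft n)"
proof (cases "n = 0")
  case True
  then show ?thesis unfolding flat_unitary_def unitary_dft_def by simp
next
  case False
  define \<omega> where "\<omega> = exp (2 * of_real pi * \<i> / of_nat n :: complex)"
  have entry: "unitary_dft n $$ (a, j) = complex_of_real (1 / sqrt n) * \<omega> ^ (a * j)" if "a < n" "j < n" for a j
    using that unfolding unitary_dft_def \<omega>_def by simp
  have \<omega>: "\<omega> = cis (2 * pi / n)" unfolding \<omega>_def cis_conv_exp by (simp add: mult_ac)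
  then have norm: "cmod \<omega> = 1" by simp
  have "real n * (2 * pi / n) = 2 * pi" using False by simp
  then have root: "\<omega> ^ n = 1" unfolding \<omega> Complex.DeMoivre by (simp only: cis_2pi)
  have cn: "cnj \<omega> = inverse \<omega>" unfolding \<omega> by (simp add: cis_cnj)
  have \<omega>0: "\<omega> \<noteq> 0" using norm by auto
  have pow1: "\<omega> powi (int a - int b) = 1 \<longleftrightarrow> a = b" if "a < n" "b < n" for a b
  proof
    assume 1: "\<omega> powi (int a - int b) = 1"
    then have "\<omega> ^ a = \<omega> ^ b" using \<omega>0 by (simp add: power_int_diff)
    then have "cis (2 * pi * a / n) = cis (2 * pi * b / n)" unfolding \<omega> Complex.DeMoivre by (simp add: mult_ac)
    then have "exp (2 * of_real pi * \<i> * of_nat a / of_nat n) = exp (2 * of_real pi * \<i> * of_nat b / of_nat n :: complex)"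
      unfolding cis_conv_exp by (simp add: mult_ac)
    then have "a mod n = b mod n" using False complex_root_unity_eq[of n a b] by simp
    then show "a = b" using that by simp
  qed simp
  have orth: "(\<Sum>j<n. unitary_dft n $$ (a, j) * cnj (unitary_dft n $$ (b, j))) = (if a = b then 1 else 0)"
    if "a < n" "b < n" for a b
  proof -
    define z where "z = \<omega> powi (int a - int b)"
    have zj: "\<omega> ^ (a * j) * cnj (\<omega> ^ (b * j)) = z ^ j" for j
      unfolding z_def using \<omega>0 by (simp add: power_int_diff cn power_mult power_divide field_simps)
    have "(\<Sum>j<n. unitary_dft n $$ (a, j) * cnj (unitary_dft n $$ (b, j))) = (\<Sum>j<n. 1 / of_nat n * z ^ j)"
    proof (rule sum.cong[OF refl])
      fix j assume "j \<in> {..<n}"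
      then have j: "j < n" by simp
      have "unitary_dft n $$ (a, j) * cnj (unitary_dft n $$ (b, j))
          = complex_of_real (1 / sqrt n * (1 / sqrt n)) * (\<omega> ^ (a * j) * cnj (\<omega> ^ (b * j)))"
        unfolding entry[OF that(1) j] entry[OF that(2) j] complex_cnj_mult complex_cnj_complex_of_real of_real_mult
        by (simp only: mult_ac)
      also have "1 / sqrt n * (1 / sqrt n) = 1 / real n" by simp
      finally show "unitary_dft n $$ (a, j) * cnj (unitary_dft n $$ (b, j)) = 1 / of_nat n * z ^ j"
        unfolding zj by simp
    qed
    also have "\<dots> = 1 / of_nat n * (\<Sum>j<n. z ^ j)" by (simp add: sum_distrib_left)
    also have "\<dots> = (if a = b then 1 else 0)"
    proof (cases "a = b")
      case True
      then show ?thesis using False unfolding z_def by simp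
    next
      case ab: False
      have "z ^ n = (\<omega> ^ n) powi (int a - int b)"
        unfolding z_def power_int_mult[symmetric] power_int_of_nat[symmetric] by (simp add: mult.commute)
      then have "z ^ n = 1" by (simp add: root)
      moreover have "z \<noteq> 1" using pow1[OF that] ab unfolding z_def by simp
      ultimately show ?thesis using ab by (simp add: geometric_sum)
    qed
    finally show ?thesis .
  qed
  have "(cmod (unitary_dft n $$ (a, j)))\<^sup>2 = 1 / real n" if "a < n" "j < n" for a j
    using that by (simp add: entry norm_mult norm_power norm norm_divide power_divide)
  moreover have "unitary_dft n \<in> carrier_mat n n" unfolding unitary_dft_def by simp
  ultimately show ?thesis unfolding flat_unitary_def using orth by blast
qed

lemma walsh_hadamard_entries:
  "i < 2 ^ k \<Longrightarrow> j < 2 ^ k \<Longrightarrow> walsh_hadamard k $$ (i, j) \<in> {1, -1}"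
proof (induction k arbitrary: i j)
  case (Suc k)
  have d: "dim_row (walsh_hadamard k) = 2 ^ k" "dim_col (walsh_hadamard k) = 2 ^ k"
    using carrier_matD[OF walsh_hadamard_carrier[of k]] by auto
  show ?case
    using Suc.prems Suc.IH[of i j] Suc.IH[of "i - 2 ^ k" j] Suc.IH[of i "j - 2 ^ k"] Suc.IH[of "i - 2 ^ k" "j - 2 ^ k"] d
    by (cases "i < 2 ^ k"; cases "j < 2 ^ k") auto
qed auto

lemma walsh_hadamard_orthogonal:
  "i < 2 ^ k \<Longrightarrow> i' < 2 ^ k \<Longrightarrow>
    (\<Sum>j<2 ^ k. walsh_hadamard k $$ (i, j) * walsh_hadamard k $$ (i', j)) = (if i = i' then 2 ^ k else 0)"
proof (induction k arbitrary: i i')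
  case (Suc k)
  let ?N = "2 ^ k :: nat" and ?H = "walsh_hadamard k"
  have d: "dim_row ?H = ?N" "dim_col ?H = ?N" using carrier_matD[OF walsh_hadamard_carrier[of k]] by auto
  define \<epsilon> :: "nat \<Rightarrow> complex" where "\<epsilon> i = (if i < ?N then 1 else -1)" for i
  define m where "m i = (if i < ?N then i else i - ?N)" for i
  have e: "walsh_hadamard (Suc k) $$ (i, j) = ?H $$ (m i, j)" "walsh_hadamard (Suc k) $$ (i, j + ?N) = \<epsilon> i * ?H $$ (m i, j)"
    if "i < 2 ^ Suc k" "j < ?N" for i j
    using that d by (auto simp: m_def \<epsilon>_def)
  have split: "(\<Sum>j<2 ^ Suc k. f j) = (\<Sum>j<?N. f j) + (\<Sum>j<?N. f (j + ?N))" for f :: "nat \<Rightarrow> complex"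
  proof -
    have "(\<Sum>j<2 ^ Suc k. f j) = (\<Sum>j<?N + ?N. f j)" by (simp add: mult_2)
    also have "\<dots> = (\<Sum>j<?N. f j) + (\<Sum>j=?N..<?N + ?N. f j)"
      by (simp add: lessThan_atLeast0 sum.atLeastLessThan_concat)
    also have "(\<Sum>j=?N..<?N + ?N. f j) = (\<Sum>j<?N. f (j + ?N))"
      using sum.shift_bounds_nat_ivl[of f 0 ?N ?N] by (simp add: lessThan_atLeast0)
    finally show ?thesis .
  qed
  have "(\<Sum>j<2 ^ Suc k. walsh_hadamard (Suc k) $$ (i, j) * walsh_hadamard (Suc k) $$ (i', j))
    = (1 + \<epsilon> i * \<epsilon> i') * (\<Sum>j<?N. ?H $$ (m i, j) * ?H $$ (m i', j))"
    unfolding split using Suc.prems by (simp add: e sum_distrib_left ring_distribs mult_ac del: walsh_hadamard.simps)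
  also have "(\<Sum>j<?N. ?H $$ (m i, j) * ?H $$ (m i', j)) = (if m i = m i' then 2 ^ k else 0)"
    using Suc.prems by (intro Suc.IH) (auto simp: m_def)
  also have "(1 + \<epsilon> i * \<epsilon> i') * (if m i = m i' then 2 ^ k else 0) = (if i = i' then 2 ^ Suc k else 0)"
    using Suc.prems by (auto simp: m_def \<epsilon>_def)
  finally show ?case .
qed auto

lemma flat_unitary_hadamard: "flat_unitary (2 ^ k) (unitary_hadamard k)"
proof -
  let ?n = "2 ^ k :: nat" and ?H = "walsh_hadamard k"
  have d: "dim_row ?H = ?n" "dim_col ?H = ?n" using carrier_matD[OF walsh_hadamard_carrier[of k]] by auto
  have entry: "unitary_hadamard k $$ (a, j) = complex_of_real (1 / sqrt (2 ^ k)) * ?H $$ (a, j)" if "a < ?n" "j < ?n" for a j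
    using that d unfolding unitary_hadamard_def by simp
  have cn: "cnj (?H $$ (a, j)) = ?H $$ (a, j)" and nrm: "cmod (?H $$ (a, j)) = 1" if "a < ?n" "j < ?n" for a j
    using walsh_hadamard_entries[OF that] by auto
  have sq: "complex_of_real (1 / sqrt (2 ^ k)) * complex_of_real (1 / sqrt (2 ^ k)) = 1 / 2 ^ k"
    unfolding of_real_mult[symmetric] by simp
  have orth: "(\<Sum>j<?n. unitary_hadamard k $$ (a, j) * cnj (unitary_hadamard k $$ (b, j))) = (if a = b then 1 else 0)"
    if "a < ?n" "b < ?n" for a b
  proof -
    have "(\<Sum>j<?n. unitary_hadamard k $$ (a, j) * cnj (unitary_hadamard k $$ (b, j)))
      = (\<Sum>j<?n. (complex_of_real (1 / sqrt (2 ^ k)) * complex_of_real (1 / sqrt (2 ^ k))) * (?H $$ (a, j) * ?H $$ (b, j)))"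
      by (rule sum.cong[OF refl]) (use that in \<open>simp add: entry cn mult_ac\<close>)
    also have "\<dots> = 1 / 2 ^ k * (\<Sum>j<?n. ?H $$ (a, j) * ?H $$ (b, j))"
      unfolding sq sum_distrib_left ..
    finally show ?thesis unfolding walsh_hadamard_orthogonal[OF that] by simp
  qed
  have "(cmod (unitary_hadamard k $$ (a, j)))\<^sup>2 = 1 / real ?n" if "a < ?n" "j < ?n" for a j
    using that by (simp add: entry norm_mult nrm norm_divide power_divide)
  moreover have "unitary_hadamard k \<in> carrier_mat ?n ?n" unfolding unitary_hadamard_def by simp
  ultimately show ?thesis unfolding flat_unitary_def using orth by blast
qed

section \<open>Reduction to orthonormal rows\<close>

text \<open>
  The factorisation \<open>W = T Q\<close>, where \<open>q k\<close> is column \<open>k\<close> of \<open>Q\<close> and \<open>y = T\<^sup>* z\<close>. If \<open>W W\<^sup>* = U G U\<^sup>*\<close> with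
  \<open>G\<close> diagonal, then \<open>G\<close> is invertible by the assumption on \<open>sigma_val r W\<close>, and \<open>Q = G\<^sup>-\<^sup>1\<^sup>/\<^sup>2 U\<^sup>* W\<close> has
  orthonormal rows.
\<close>

lemma orthonormal_row_factor:
  assumes W: "W \<in> carrier_mat r n" and r: "1 \<le> r" "r \<le> n" and pos: "0 < sigma_val r W"
  obtains q where "\<And>a b. a < r \<Longrightarrow> b < r \<Longrightarrow> (\<Sum>k<n. q k a * cnj (q k b)) = (if a = b then 1 else 0 :: complex)"
    and "\<And>z. \<exists>y. \<forall>k<n. (\<Sum>a<r. cnj (z a) * W $$ (a, k)) = (\<Sum>a<r. cnj (y a) * q k a)"
proof -
  let ?G = "row_gram r n W"
  let ?U = "eigenbasis r ?G"
  define g where "g = eigenvals r ?G"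
  have hG: "hermitian_matrix r ?G" unfolding row_gram_def by simp
  have Uc [simp]: "?U \<in> carrier_mat r r" and UU: "?U * mat_adjoint ?U = 1\<^sub>m r"
    using eigenbasis(1)[OF hG] unfolding unitary_matrix_def by auto
  have g: "0 < g i" if "i < r" for i
  proof -
    have "\<forall>z. (sigma_val r W)\<^sup>2 * norm_square r z \<le> Re (rayleigh_form r ?G z)"
      using sigma_wide_bounds_iff(2)[OF W r, of "sigma_val r W"] pos
      unfolding row_gram_def rayleigh_form_gram_sum by simp
    then have "(sigma_val r W)\<^sup>2 \<le> g i" using eigenvals_bound_iff(2)[OF hG] that unfolding g_def by blast
    then show ?thesis using pos by (meson less_le_trans zero_less_power)
  qed
  let ?V = "mat_adjoint ?U * W"
  have Vc: "?V \<in> carrier_mat r n" using W by simp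
  define q where "q k a = ?V $$ (a, k) / complex_of_real (sqrt (g a))" for k a
  have VV: "?V * mat_adjoint ?V = real_diag r g"
  proof -
    have aW: "mat_adjoint W \<in> carrier_mat n r" using W by simp
    have "?V * mat_adjoint ?V = mat_adjoint ?U * W * (mat_adjoint W * ?U)"
      using W by (simp add: mat_adjoint_mult[of _ r r _ n])
    also have "\<dots> = mat_adjoint ?U * (W * mat_adjoint W) * ?U"
      using W aW mult_carrier_mat[OF W aW]
      by (simp add: assoc_mult_mat[of _ r r _ n _ r] assoc_mult_mat[of _ r n _ r _ r] assoc_mult_mat[of _ r r _ r _ r])
    finally show ?thesis unfolding row_gram_eq[OF W] using eigenbasis(2)[OF hG] unfolding g_def by simp
  qed
  have rows: "(\<Sum>k<n. q k a * cnj (q k b)) = (if a = b then 1 else 0)" if "a < r" "b < r" for a b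
  proof -
    have "(\<Sum>k<n. q k a * cnj (q k b)) = (\<Sum>k<n. ?V $$ (a, k) * cnj (?V $$ (b, k))) / (complex_of_real (sqrt (g a)) * complex_of_real (sqrt (g b)))"
      unfolding q_def sum_divide_distrib by (simp add: mult_ac)
    also have "(\<Sum>k<n. ?V $$ (a, k) * cnj (?V $$ (b, k))) = (?V * mat_adjoint ?V) $$ (a, b)"
      using that carrier_matD[OF Vc] by (subst (3) index_mult_mat(1)) (auto simp: scalar_prod_def lessThan_atLeast0)
    also have "\<dots> / (complex_of_real (sqrt (g a)) * complex_of_real (sqrt (g b))) = (if a = b then 1 else 0)"
      unfolding VV using that g[of a] by (auto simp flip: of_real_mult)
    finally show ?thesis .
  qed
  have factor: "\<exists>y. \<forall>k<n. (\<Sum>a<r. cnj (z a) * W $$ (a, k)) = (\<Sum>a<r. cnj (y a) * q k a)" for z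
  proof (intro exI allI impI)
    fix k assume k: "k < n"
    let ?z = "column_matrix r z"
    have zc: "mat_adjoint ?z \<in> carrier_mat (Suc 0) r" by simp
    have Yc: "mat_adjoint ?U * ?z \<in> carrier_mat r (Suc 0)" by simp
    have eq: "mat_adjoint (mat_adjoint ?U * ?z) * ?V = mat_adjoint ?z * W"
    proof -
      have "mat_adjoint (mat_adjoint ?U * ?z) * ?V = mat_adjoint ?z * ((?U * mat_adjoint ?U) * W)"
        using W by (simp add: mat_adjoint_mult[of _ r r _ "Suc 0"] assoc_mult_mat[of _ "Suc 0" r _ r _ n] assoc_mult_mat[of _ r r _ r _ n])
      then show ?thesis unfolding UU using left_mult_one_mat[OF W] by simp
    qed
    have "(\<Sum>a<r. cnj (z a) * W $$ (a, k)) = (mat_adjoint ?z * W) $$ (0, k)"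
      using k carrier_matD[OF W] by (simp add: scalar_prod_def lessThan_atLeast0 column_matrix_def)
    also have "\<dots> = (\<Sum>a<r. cnj (adjoint_apply r ?U z a) * ?V $$ (a, k))"
      unfolding eq[symmetric] using k carrier_matD[OF Vc] carrier_matD[OF Yc]
      by (subst index_mult_mat(1)) (auto simp: scalar_prod_def lessThan_atLeast0 adjoint_times_column[OF Uc] simp del: index_mult_mat(1))
    also have "\<dots> = (\<Sum>a<r. cnj (complex_of_real (sqrt (g a)) * adjoint_apply r ?U z a) * q k a)"
    proof (rule sum.cong[OF refl])
      fix a assume "a \<in> {..<r}"
      then show "cnj (adjoint_apply r ?U z a) * ?V $$ (a, k) = cnj (complex_of_real (sqrt (g a)) * adjoint_apply r ?U z a) * q k a"
        using g[of a] unfolding q_def by simp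
    qed
    finally show "(\<Sum>a<r. cnj (z a) * W $$ (a, k)) = (\<Sum>a<r. cnj ((\<lambda>a. complex_of_real (sqrt (g a)) * adjoint_apply r ?U z a) a) * q k a)" .
  qed
  show thesis using that[of q] rows factor by blast
qed

lemma subsampled_transform_carrier [simp]:
  "subsampled_transform F n l (d, p, s) \<in> carrier_mat n (length s)"
  unfolding subsampled_transform_def by (auto intro!: carrier_matI)

lemma subsampled_transform_index_col:
  assumes "k < n" "j < length s"
  shows "subsampled_transform F n l (d, p, s) $$ (k, j) =
    complex_of_real (sqrt (real n / real l)) * (mat_diag n d * F * perm_mat n p) $$ (k, s ! j)"
proof -
  define X where "X = mat_diag n d * F * perm_mat n p"
  have "dim_row X = n" unfolding X_def by (simp add: mat_diag_def)
  moreover have "subsampled_transform F n l (d, p, s) = complex_of_real (sqrt (real n / real l)) \<cdot>\<^sub>m mat_of_cols n (map (col X) s)"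
    unfolding subsampled_transform_def X_def by simp
  ultimately show ?thesis using assms unfolding X_def[symmetric] by (simp add: mat_of_cols_index col_def)
qed

lemma transform_product_index:
  assumes F: "F \<in> carrier_mat n n" and k: "k < n" and m: "m < n"
  shows "(mat_diag n d * F * perm_mat n p) $$ (k, m) = (\<Sum>i<n. d k * F $$ (k, i) * (if i = p m then 1 else 0))"
proof -
  have DF: "mat_diag n d * F \<in> carrier_mat n n" using F by simp
  show ?thesis
    using k m carrier_matD[OF F] carrier_matD[OF DF]
    by (simp add: perm_mat_def scalar_prod_def lessThan_atLeast0 mat_diag_mult_left[OF F])
qed

lemma subsampled_transform_index:
  assumes F: "F \<in> carrier_mat n n" and p: "p permutes {..<n}" and k: "k < n" and j: "j < length s" "s ! j < n"
  shows "subsampled_transform F n l (d, p, s) $$ (k, j) =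
    complex_of_real (sqrt (real n / real l)) * (d k * F $$ (k, p (s ! j)))"
proof -
  have "p (s ! j) < n" using permutes_in_image[OF p] j(2) by auto
  then show ?thesis
    unfolding subsampled_transform_index_col[OF k j(1)] transform_product_index[OF F k j(2)]
    by (simp add: if_distrib[of "(*) _"] cong: if_cong)
qed

lemma product_transform_index:
  assumes W: "W \<in> carrier_mat r n" and F: "F \<in> carrier_mat n n" and p: "p permutes {..<n}"
    and a: "a < r" and j: "j < length s" "s ! j < n"
  shows "(W * subsampled_transform F n l (d, p, s)) $$ (a, j) =
    (\<Sum>k<n. complex_of_real (sqrt (real n / real l)) * (W $$ (a, k) * (d k * F $$ (k, p (s ! j)))))"
proof -
  have "(W * subsampled_transform F n l (d, p, s)) $$ (a, j) = (\<Sum>k<n. W $$ (a, k) * subsampled_transform F n l (d, p, s) $$ (k, j))"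
    using a j carrier_matD[OF W] carrier_matD[OF subsampled_transform_carrier[of F n l d p s]]
    by (subst index_mult_mat(1)) (auto simp: scalar_prod_def lessThan_atLeast0)
  then show ?thesis using subsampled_transform_index[OF F p _ j] by (simp add: mult_ac)
qed

definition success :: "nat \<Rightarrow> complex mat \<Rightarrow> complex mat \<Rightarrow> bool" where
  "success r W M \<longleftrightarrow> 0.40 * sigma_val r W \<le> sigma_val r M \<and> sigma_val 1 M \<le> 1.48 * sigma_val 1 W"

text \<open>
  Column \<open>J\<close> of \<open>sqrt (n / l) Q D F\<close>, where \<open>q k\<close> is column \<open>k\<close> of \<open>Q\<close> and \<open>D\<close> has the diagonal \<open>d\<close>.
\<close>

definition frame_vector ::
  "nat \<Rightarrow> nat \<Rightarrow> complex mat \<Rightarrow> (nat \<Rightarrow> nat \<Rightarrow> complex) \<Rightarrow> (nat \<Rightarrow> complex) \<Rightarrow> nat \<Rightarrow> nat \<Rightarrow> complex" where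
  "frame_vector n l F q d J a = complex_of_real (sqrt (real n / real l)) * (\<Sum>k<n. q k a * (d k * F $$ (k, J)))"

lemma frame_vector_tight:
  assumes F: "flat_unitary n F"
    and rows: "\<And>a b. a < r \<Longrightarrow> b < r \<Longrightarrow> (\<Sum>k<n. q k a * cnj (q k b)) = (if a = b then 1 else 0)"
    and d: "\<And>k. k < n \<Longrightarrow> cmod (d k) = 1"
    and ab: "a < r" "b < r"
  shows "(\<Sum>J<n. frame_vector n l F q d J a * cnj (frame_vector n l F q d J b)) = (if a = b then complex_of_real (real n / real l) else 0)"
proof -
  define c where "c = complex_of_real (sqrt (real n / real l))"
  have c2: "c * cnj c = complex_of_real (real n / real l)"
    unfolding c_def complex_cnj_complex_of_real of_real_mult[symmetric] by simp
  have orth: "(\<Sum>J<n. F $$ (k, J) * cnj (F $$ (m, J))) = (if k = m then 1 else 0)" if "k < n" "m < n" for k m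
    using F that unfolding flat_unitary_def by auto
  have "(\<Sum>J<n. frame_vector n l F q d J a * cnj (frame_vector n l F q d J b))
    = (\<Sum>J<n. \<Sum>k<n. \<Sum>m<n. (c * cnj c) * (q k a * d k * cnj (q m b) * cnj (d m)) * (F $$ (k, J) * cnj (F $$ (m, J))))"
  proof (rule sum.cong[OF refl])
    fix J
    have "frame_vector n l F q d J a * cnj (frame_vector n l F q d J b)
      = (c * cnj c) * ((\<Sum>k<n. q k a * (d k * F $$ (k, J))) * (\<Sum>m<n. cnj (q m b * (d m * F $$ (m, J)))))"
      unfolding frame_vector_def c_def[symmetric] by (simp add: mult_ac)
    also have "\<dots> = (\<Sum>k<n. \<Sum>m<n. (c * cnj c) * (q k a * d k * cnj (q m b) * cnj (d m)) * (F $$ (k, J) * cnj (F $$ (m, J))))"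
      unfolding sum_product unfolding sum_distrib_left by (intro sum.cong refl) (simp add: mult_ac)
    finally show "frame_vector n l F q d J a * cnj (frame_vector n l F q d J b)
      = (\<Sum>k<n. \<Sum>m<n. (c * cnj c) * (q k a * d k * cnj (q m b) * cnj (d m)) * (F $$ (k, J) * cnj (F $$ (m, J))))" .
  qed
  also have "\<dots> = (\<Sum>k<n. \<Sum>m<n. \<Sum>J<n. (c * cnj c) * (q k a * d k * cnj (q m b) * cnj (d m)) * (F $$ (k, J) * cnj (F $$ (m, J))))"
    by (subst sum.swap, rule sum.cong[OF refl], rule sum.swap)
  also have "\<dots> = (\<Sum>k<n. \<Sum>m<n. (c * cnj c) * (q k a * d k * cnj (q m b) * cnj (d m)) * (if k = m then 1 else 0))"
    unfolding sum_distrib_left[symmetric] by (intro sum.cong refl) (simp add: orth)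
  also have "\<dots> = (\<Sum>k<n. (c * cnj c) * (q k a * d k * cnj (q k b) * cnj (d k)))"
    by (simp add: if_distrib[of "(*) _"] cong: if_cong)
  also have "\<dots> = (\<Sum>k<n. (c * cnj c) * (q k a * cnj (q k b)))"
  proof (rule sum.cong[OF refl])
    fix k assume "k \<in> {..<n}"
    then have "d k * cnj (d k) = 1" using d[of k] by (simp add: complex_norm_square[symmetric])
    then show "(c * cnj c) * (q k a * d k * cnj (q k b) * cnj (d k)) = (c * cnj c) * (q k a * cnj (q k b))"
      by (simp add: mult.assoc mult.left_commute[of "d k"])
  qed
  also have "\<dots> = complex_of_real (real n / real l) * (\<Sum>k<n. q k a * cnj (q k b))"
    unfolding c2 sum_distrib_left ..
  finally show ?thesis using rows[OF ab] by simp
qed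

lemma sigma_last_le_first:
  assumes W: "W \<in> carrier_mat r n" and r: "1 \<le> r" "r \<le> n"
  shows "sigma_val r W \<le> sigma_val 1 W"
proof -
  note b = sorted_values_bounds[OF singular_values_wide[OF W r(2)] r(1)]
  have "sigma_val r W \<le> sqrt (eigenvals r (row_gram r n W) 0)"
    using b(2)[of "sigma_val r W"] r by simp
  also have "\<dots> \<le> sigma_val 1 W" using b(1)[of "sigma_val 1 W"] r by simp
  finally show ?thesis .
qed

text \<open>
  For every \<open>z\<close> there is \<open>y\<close> with \<open>\<parallel>y\<parallel> = \<parallel>z\<^sup>* W\<parallel>\<close> such that \<open>\<parallel>z\<^sup>* W H\<parallel>\<^sup>2\<close> is the quadratic form of the sampled frame vectors
  at \<open>y\<close>. Frame bounds for the sample are therefore bounds for \<open>W H\<close> relative to \<open>W\<close>.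
\<close>

lemma success_of_frame_bounds:
  assumes W: "W \<in> carrier_mat r n" and F: "F \<in> carrier_mat n n" and p: "p permutes {..<n}"
    and s: "length s = l" "distinct s" "set s \<subseteq> {..<n}" and rl: "1 \<le> r" "r \<le> l" "r \<le> n"
    and pos: "0 < sigma_val r W"
    and rows: "\<And>a b. a < r \<Longrightarrow> b < r \<Longrightarrow> (\<Sum>k<n. q k a * cnj (q k b)) = (if a = b then 1 else 0)"
    and factor: "\<And>z. \<exists>y. \<forall>k<n. (\<Sum>a<r. cnj (z a) * W $$ (a, k)) = (\<Sum>a<r. cnj (y a) * q k a)"
    and lower: "\<And>y. (0.40)\<^sup>2 * norm_square r y \<le> (\<Sum>i\<in>set s. (cmod (\<Sum>a<r. cnj (y a) * frame_vector n l F q d (p i) a))\<^sup>2)"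
    and upper: "\<And>y. (\<Sum>i\<in>set s. (cmod (\<Sum>a<r. cnj (y a) * frame_vector n l F q d (p i) a))\<^sup>2) \<le> (1.48)\<^sup>2 * norm_square r y"
  shows "success r W (W * subsampled_transform F n l (d, p, s))"
proof -
  let ?M = "W * subsampled_transform F n l (d, p, s)"
  let ?V = "\<lambda>z. \<Sum>k<n. (cmod (\<Sum>a<r. cnj (z a) * W $$ (a, k)))\<^sup>2"
  let ?G = "\<lambda>z. \<Sum>j<l. (cmod (\<Sum>a<r. cnj (z a) * ?M $$ (a, j)))\<^sup>2"
  let ?E = "\<lambda>y. \<Sum>i\<in>set s. (cmod (\<Sum>a<r. cnj (y a) * frame_vector n l F q d (p i) a))\<^sup>2"
  define c where "c = complex_of_real (sqrt (real n / real l))"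
  have M: "?M \<in> carrier_mat r l"
    using mult_carrier_mat[OF W subsampled_transform_carrier[of F n l d p s]] s(1) by simp
  have sr: "sigma_val r W \<le> sigma_val 1 W"
    by (rule sigma_last_le_first[OF W rl(1,3)])
  have y: "\<exists>y. ?V z = norm_square r y \<and>
      ?G z = ?E y" for z
  proof -
    obtain y where y: "\<And>k. k < n \<Longrightarrow> (\<Sum>a<r. cnj (z a) * W $$ (a, k)) = (\<Sum>a<r. cnj (y a) * q k a)"
      using factor by blast
    have col: "(\<Sum>a<r. cnj (z a) * ?M $$ (a, j)) = (\<Sum>a<r. cnj (y a) * frame_vector n l F q d (p (s ! j)) a)" if j: "j < l" for j
    proof -
      have sj: "j < length s" "s ! j < n" using j s by (auto dest: nth_mem)
      let ?e = "\<lambda>k. c * (d k * F $$ (k, p (s ! j)))"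
      have "(\<Sum>a<r. cnj (z a) * ?M $$ (a, j)) = (\<Sum>a<r. \<Sum>k<n. ?e k * (cnj (z a) * W $$ (a, k)))"
        by (rule sum.cong[OF refl]) (simp add: product_transform_index[OF W F p _ sj] c_def sum_distrib_left mult_ac)
      also have "\<dots> = (\<Sum>k<n. ?e k * (\<Sum>a<r. cnj (z a) * W $$ (a, k)))"
        by (subst sum.swap) (simp add: sum_distrib_left)
      also have "\<dots> = (\<Sum>k<n. ?e k * (\<Sum>a<r. cnj (y a) * q k a))" by (simp add: y)
      also have "\<dots> = (\<Sum>a<r. cnj (y a) * frame_vector n l F q d (p (s ! j)) a)"
        unfolding frame_vector_def c_def[symmetric] sum_distrib_left by (subst sum.swap) (simp add: mult_ac)
      finally show ?thesis .
    qed
    have "?G z = (\<Sum>j<length s. (cmod (\<Sum>a<r. cnj (y a) * frame_vector n l F q d (p (s ! j)) a))\<^sup>2)"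
      using s(1) by (simp add: col)
    also have "\<dots> = ?E y"
      using sum.reindex_bij_betw[OF bij_betw_nth[OF s(2) refl refl], of "\<lambda>i. (cmod (\<Sum>a<r. cnj (y a) * frame_vector n l F q d (p i) a))\<^sup>2"] .
    finally have 1: "?G z = ?E y" .
    have "?V z = (\<Sum>k<n. (cmod (\<Sum>a<r. cnj (y a) * q k a))\<^sup>2)" by (simp add: y)
    also have "\<dots> = (\<Sum>a<r. (cmod (cnj (y a)))\<^sup>2)" by (rule sum_norm_square_orthonormal_rows) (rule rows)
    finally show ?thesis using 1 by auto
  qed
  have "0.40 * sigma_val r W \<le> sigma_val r ?M"
  proof (subst sigma_wide_bounds_iff(2)[OF M rl(1,2)], use pos in simp, intro allI)
    fix z
    obtain y where y: "?V z = norm_square r y"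
      "?G z = ?E y"
      using y by blast
    have "(sigma_val r W)\<^sup>2 * norm_square r z \<le> ?V z"
      using sigma_wide_bounds_iff(2)[OF W rl(1,3), of "sigma_val r W"] pos by simp
    then have "(0.40)\<^sup>2 * ((sigma_val r W)\<^sup>2 * norm_square r z) \<le> (0.40)\<^sup>2 * norm_square r y"
      unfolding y(1) by (intro mult_left_mono) simp_all
    also have "\<dots> \<le> ?G z" unfolding y(2) by (rule lower)
    finally show "(0.40 * sigma_val r W)\<^sup>2 * norm_square r z \<le> ?G z"
      by (simp only: power_mult_distrib mult.assoc)
  qed
  moreover have "sigma_val 1 ?M \<le> 1.48 * sigma_val 1 W"
  proof (subst sigma_wide_bounds_iff(1)[OF M rl(1,2)], use pos sr in simp, intro allI)
    fix z
    obtain y where y: "?V z = norm_square r y"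
      "?G z = ?E y"
      using y by blast
    have "?G z \<le> (1.48)\<^sup>2 * norm_square r y"
      unfolding y(2) by (rule upper)
    also have "\<dots> \<le> (1.48)\<^sup>2 * ((sigma_val 1 W)\<^sup>2 * norm_square r z)"
      using sigma_wide_bounds_iff(1)[OF W rl(1,3), of "sigma_val 1 W"] pos sr
      unfolding y(1)[symmetric] by (intro mult_left_mono) auto
    finally show "?G z \<le> (1.48 * sigma_val 1 W)\<^sup>2 * norm_square r z"
      by (simp only: power_mult_distrib mult.assoc)
  qed
  ultimately show ?thesis unfolding success_def by simp
qed

lemma exp_bound_of_log:
  assumes r: "2 \<le> r" and \<rho>: "0 < \<rho>" "\<rho> * (4 * ln r) \<le> 1" and e: "e \<le> - (1/2) / \<rho>"
  shows "real r * exp e \<le> 1 / real r"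
proof -
  have "4 * ln r \<le> 1 / \<rho>" using \<rho> by (simp add: field_simps)
  then have "e \<le> - (2 * ln r)" using e by (simp add: field_simps)
  then have "exp e \<le> exp (- (2 * ln r))" by simp
  also have "\<dots> = 1 / (real r)\<^sup>2" using r by (simp add: exp_minus exp_double[symmetric] exp_of_nat_mult inverse_eq_divide)
      (simp add: exp_double)
  finally show ?thesis using r by (simp add: field_simps power2_eq_square)
qed

text \<open>
  The squared lengths of the frame vectors are at most \<open>\<rho>\<close>. With \<open>R\<close> taken from the scalar inequality
  for either tail, \<open>R / \<rho>\<close> is then the largest exponent, in absolute value, to which \<open>perm_chernoff\<close> applies.
\<close>

lemma failing_permutations_count:
  assumes W: "W \<in> carrier_mat r n" and F: "flat_unitary n F"
    and s: "length s = l" "distinct s" "set s \<subseteq> {..<n}" and rl: "2 \<le> r" "r \<le> l" "l \<le> n"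
    and pos: "0 < sigma_val r W"
    and rows: "\<And>a b. a < r \<Longrightarrow> b < r \<Longrightarrow> (\<Sum>k<n. q k a * cnj (q k b)) = (if a = b then 1 else 0)"
    and factor: "\<And>z. \<exists>y. \<forall>k<n. (\<Sum>a<r. cnj (z a) * W $$ (a, k)) = (\<Sum>a<r. cnj (y a) * q k a)"
    and d: "\<And>k. k < n \<Longrightarrow> cmod (d k) = 1"
    and \<rho>: "0 < \<rho>" "\<rho> * (4 * ln r) \<le> 1"
    and small: "\<And>J. J < n \<Longrightarrow> (\<Sum>a<r. (cmod (frame_vector n l F q d J a))\<^sup>2) \<le> \<rho>"
  shows "real (card {p \<in> perms n. \<not> success r W (W * subsampled_transform F n l (d, p, s))}) \<le> fact n * (2 / real r)"
proof -
  let ?x = "frame_vector n l F q d"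
  let ?S = "\<lambda>p y. \<Sum>i\<in>set s. (cmod (\<Sum>a<r. cnj (y a) * ?x (p i) a))\<^sup>2"
  let ?N = "\<lambda>y. \<Sum>a<r. (cmod (y a))\<^sup>2"
  have n0: "0 < n" "0 < l" using rl by auto
  have cs: "card (set s) = l" using s distinct_card by metis
  have frame: "(\<Sum>J<n. ?x J a * cnj (?x J b)) = (if a = b then complex_of_real (real n / real l) else 0)" if "a < r" "b < r" for a b
    by (rule frame_vector_tight[OF F]) (use rows d that in auto)
  \<comment> \<open>the upper tail has the scalar constant \<open>R = 3/4\<close>, the lower one \<open>R = - 3/2\<close>\<close>
  define u where "u = (3/4) / \<rho>"
  define v where "v = - (3/2) / \<rho>"
  have u: "0 < u" "u * \<rho> = 3/4" and v: "v < 0" "v * \<rho> = - (3/2)" unfolding u_def v_def using \<rho>(1) by auto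
  let ?Up = "{p \<in> perms n. \<exists>y. u * ?S p y > (u * (1.48)\<^sup>2) * ?N y}"
  let ?Lo = "{p \<in> perms n. \<exists>y. v * ?S p y > (v * (0.40)\<^sup>2) * ?N y}"
  let ?Bad = "{p \<in> perms n. \<not> success r W (W * subsampled_transform F n l (d, p, s))}"
  interpret up: bounded_tight_frame n r ?x "real n / real l" u "3/4" "0.49" "0.2" "1.5175"
  proof
    fix J assume J: "J < n"
    have "u * norm_square r (?x J) \<le> u * \<rho>" using u small[OF J] by (intro mult_left_mono) auto
    then show "u * (u * norm_square r (?x J) - 3/4) \<le> 0" using u by (intro mult_nonneg_nonpos) auto
  qed (use frame chernoff_scalar_upper in auto)
  interpret lo: bounded_tight_frame n r ?x "real n / real l" v "- (3/2)" "0.2077" "0.13" "0.49345"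
  proof
    fix J assume J: "J < n"
    have "v * \<rho> \<le> v * norm_square r (?x J)" using v small[OF J] by (intro mult_left_mono_neg) auto
    then show "v * (v * norm_square r (?x J) - (- (3/2))) \<le> 0" using v by (intro mult_nonpos_nonneg) auto
  qed (use frame chernoff_scalar_lower in auto)
  have "real (card ?Up)
    \<le> fact n * (real r * exp (card (set s) * (1.5175 * u * (real n / real l) / n) - u * (1.48)\<^sup>2))"
    by (rule up.perm_chernoff[OF s(3)])
  also have "card (set s) * (1.5175 * u * (real n / real l) / n) - u * (1.48)\<^sup>2 = (1.5175 - (1.48)\<^sup>2) * u"
    unfolding cs using n0 by (simp add: field_simps)
  finally have 1: "real (card ?Up) \<le> fact n * (real r * exp ((1.5175 - (1.48)\<^sup>2) * u))" .
  have "real r * exp ((1.5175 - (1.48)\<^sup>2) * u) \<le> 1 / real r"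
    by (rule exp_bound_of_log[OF rl(1) \<rho>]) (use \<rho>(1) in \<open>simp add: u_def power2_eq_square field_simps\<close>)
  then have "fact n * (real r * exp ((1.5175 - (1.48)\<^sup>2) * u)) \<le> fact n * (1 / real r)" by (intro mult_left_mono) auto
  with 1 have upper: "real (card ?Up) \<le> fact n * (1 / real r)" by linarith
  have "real (card ?Lo)
    \<le> fact n * (real r * exp (card (set s) * (0.49345 * v * (real n / real l) / n) - v * (0.40)\<^sup>2))"
    by (rule lo.perm_chernoff[OF s(3)])
  also have "card (set s) * (0.49345 * v * (real n / real l) / n) - v * (0.40)\<^sup>2 = (0.49345 - (0.40)\<^sup>2) * v"
    unfolding cs using n0 by (simp add: field_simps)
  finally have 2: "real (card ?Lo) \<le> fact n * (real r * exp ((0.49345 - (0.40)\<^sup>2) * v))" .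
  have "real r * exp ((0.49345 - (0.40)\<^sup>2) * v) \<le> 1 / real r"
    by (rule exp_bound_of_log[OF rl(1) \<rho>]) (use \<rho>(1) in \<open>simp add: v_def power2_eq_square field_simps\<close>)
  then have "fact n * (real r * exp ((0.49345 - (0.40)\<^sup>2) * v)) \<le> fact n * (1 / real r)" by (intro mult_left_mono) auto
  with 2 have lower: "real (card ?Lo) \<le> fact n * (1 / real r)" by linarith
  have sub: "?Bad
     \<subseteq> ?Up \<union> ?Lo"
  proof (rule subsetI, rule ccontr)
    fix p assume p: "p \<in> ?Bad"
      and n: "p \<notin> ?Up \<union> ?Lo"
    have up: "?S p y \<le> (1.48)\<^sup>2 * ?N y" for y
    proof -
      have "u * ?S p y \<le> u * ((1.48)\<^sup>2 * ?N y)" using n p by (auto simp: not_less mult.assoc)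
      then show ?thesis using u(1) by (simp only: mult_le_cancel_left_pos)
    qed
    have lo: "(0.40)\<^sup>2 * ?N y \<le> ?S p y" for y
    proof -
      have "v * ?S p y \<le> v * ((0.40)\<^sup>2 * ?N y)" using n p by (auto simp: not_less mult.assoc)
      then show ?thesis using v(1) by (simp only: mult_le_cancel_left_neg)
    qed
    have "p permutes {..<n}" using p unfolding perms_def by simp
    then have "success r W (W * subsampled_transform F n l (d, p, s))"
      using rl F by (intro success_of_frame_bounds[OF W _ _ s _ _ _ pos rows factor lo up]) (auto simp: flat_unitary_def)
    then show False using p by simp
  qed
  have "card ?Bad
    \<le> card ?Up + card ?Lo"
    by (rule order_trans[OF card_mono[OF _ sub] card_Un_le]) simp
  then have "real (card ?Bad) \<le> fact n * (1 / real r) + fact n * (1 / real r)"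
    using upper lower by linarith
  then show ?thesis by (simp add: mult.commute)
qed

section \<open>Measurability of the failure event\<close>

text \<open>
  A countable dense family of vectors. Quantifying over it instead of over all vectors turns the bounds on singular values
  into countable intersections of measurable conditions on the entries.
\<close>

definition rational_vector :: "(rat \<times> rat) list \<Rightarrow> nat \<Rightarrow> complex" where
  "rational_vector qs i = (if i < length qs then Complex (of_rat (fst (qs ! i))) (of_rat (snd (qs ! i))) else 0)"

lemma rational_vectors_dense:
  "\<exists>Q. \<forall>a<m. (\<lambda>k. rational_vector (Q k) a) \<longlonglongrightarrow> z a"
proof -
  have ex: "\<exists>u :: rat. x < of_rat u \<and> of_rat u < x + 1 / Suc k" for x :: real and k
    by (rule of_rat_dense) simp
  define \<rho> where "\<rho> x k = (SOME u :: rat. x < of_rat u \<and> of_rat u < x + 1 / Suc k)" for x :: real and k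
  have \<rho>: "x < of_rat (\<rho> x k)" "of_rat (\<rho> x k) < x + 1 / Suc k" for x k
    using someI_ex[OF ex[of x k]] unfolding \<rho>_def by auto
  have lim: "(\<lambda>k. of_rat (\<rho> x k)) \<longlonglongrightarrow> x" for x :: real
  proof (rule tendsto_sandwich[where f = "\<lambda>_. x" and h = "\<lambda>k. x + 1 / Suc k"])
    show "(\<lambda>k. x + 1 / Suc k) \<longlonglongrightarrow> x"
      using tendsto_add[OF tendsto_const LIMSEQ_Suc[OF lim_1_over_n], of x] by simp
  qed (use \<rho> in \<open>auto intro!: always_eventually less_imp_le\<close>)
  define Q where "Q k = map (\<lambda>i. (\<rho> (Re (z i)) k, \<rho> (Im (z i)) k)) [0..<m]" for k
  have "(\<lambda>k. rational_vector (Q k) a) \<longlonglongrightarrow> z a" if "a < m" for a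
  proof -
    have "(\<lambda>k. rational_vector (Q k) a) = (\<lambda>k. Complex (of_rat (\<rho> (Re (z a)) k)) (of_rat (\<rho> (Im (z a)) k)))"
      using that unfolding rational_vector_def Q_def by auto
    moreover have "(\<lambda>k. Complex (of_rat (\<rho> (Re (z a)) k)) (of_rat (\<rho> (Im (z a)) k))) \<longlonglongrightarrow> Complex (Re (z a)) (Im (z a))"
      by (intro tendsto_Complex lim)
    ultimately show ?thesis by simp
  qed
  then show ?thesis by blast
qed

lemma rational_vectors_suffice:
  fixes X :: "nat \<Rightarrow> nat \<Rightarrow> complex"
  shows "(\<forall>z. (\<Sum>j<c. (cmod (\<Sum>a<m. cnj (z a) * X a j))\<^sup>2) \<le> t * norm_square m z) \<longleftrightarrow>
      (\<forall>qs. (\<Sum>j<c. (cmod (\<Sum>a<m. cnj (rational_vector qs a) * X a j))\<^sup>2) \<le> t * norm_square m (rational_vector qs))" (is "?A \<longleftrightarrow> ?A'")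
    and "(\<forall>z. t * norm_square m z \<le> (\<Sum>j<c. (cmod (\<Sum>a<m. cnj (z a) * X a j))\<^sup>2)) \<longleftrightarrow>
      (\<forall>qs. t * norm_square m (rational_vector qs) \<le> (\<Sum>j<c. (cmod (\<Sum>a<m. cnj (rational_vector qs a) * X a j))\<^sup>2))" (is "?B \<longleftrightarrow> ?B'")
proof -
  define f where "f z = (\<Sum>j<c. (cmod (\<Sum>a<m. cnj (z a) * X a j))\<^sup>2)" for z
  define g where "g z = t * norm_square m z" for z :: "nat \<Rightarrow> complex"
  have lim: "\<exists>Q. (\<lambda>k. f (rational_vector (Q k))) \<longlonglongrightarrow> f z \<and> (\<lambda>k. g (rational_vector (Q k))) \<longlonglongrightarrow> g z" for z
  proof -
    obtain Q where Q: "\<And>a. a < m \<Longrightarrow> (\<lambda>k. rational_vector (Q k) a) \<longlonglongrightarrow> z a"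
      using rational_vectors_dense[of m z] by auto
    have "(\<lambda>k. f (rational_vector (Q k))) \<longlonglongrightarrow> f z" "(\<lambda>k. g (rational_vector (Q k))) \<longlonglongrightarrow> g z"
      unfolding f_def g_def by (auto intro!: tendsto_intros Q)
    then show ?thesis by blast
  qed
  have "f z \<le> g z" if "\<forall>qs. f (rational_vector qs) \<le> g (rational_vector qs)" for z
    using lim[of z] that by (auto intro: LIMSEQ_le)
  then show "?A \<longleftrightarrow> ?A'" unfolding f_def g_def by blast
  have "g z \<le> f z" if "\<forall>qs. g (rational_vector qs) \<le> f (rational_vector qs)" for z
    using lim[of z] that by (auto intro: LIMSEQ_le)
  then show "?B \<longleftrightarrow> ?B'" unfolding f_def g_def by blast
qed

lemma length_singular_values: "length (singular_values M) \<le> dim_col M"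
  unfolding singular_values_def by simp

text \<open>
  All shapes of \<open>M\<close> have to be covered, because the sample space contains lists of every length. If
  there are fewer columns than rows, the last singular value is the default \<open>0\<close> and the first one
  is governed by \<open>M\<^sup>* M\<close>.
\<close>

lemma sigma_measurable:
  assumes M: "\<And>x. M x \<in> carrier_mat r c" and r: "1 \<le> r"
    and [measurable]: "\<And>a j. a < r \<Longrightarrow> j < c \<Longrightarrow> (\<lambda>x. M x $$ (a, j)) \<in> borel_measurable N"
    and t: "0 \<le> t"
  shows "{x \<in> space N. sigma_val 1 (M x) \<le> t} \<in> sets N" and "{x \<in> space N. t \<le> sigma_val r (M x)} \<in> sets N"
proof -
  have wide: "{x \<in> space N. sigma_val 1 (M x) \<le> t} \<in> sets N" "{x \<in> space N. t \<le> sigma_val r (M x)} \<in> sets N" if "r \<le> c"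
    unfolding sigma_wide_bounds_iff[OF M r that t] rational_vectors_suffice by measurable
  have tall: "{x \<in> space N. sigma_val 1 (M x) \<le> t} \<in> sets N" if "1 \<le> c" "c \<le> r"
  proof -
    have [measurable]: "cnj \<in> borel_measurable borel"
      by (intro borel_measurable_continuous_onI continuous_intros)
    have "(\<lambda>x. \<Sum>i<r. (cmod (\<Sum>j<c. cnj (w j) * cnj (M x $$ (i, j))))\<^sup>2) \<in> borel_measurable N" for w
      by measurable
    then show ?thesis
      unfolding sigma_1_le_iff_columns[OF M that t] rational_vectors_suffice(1) by measurable
  qed
  have zero: "sigma_val k (M x) = 0" if "c < k" for k x
    using length_singular_values[of "M x"] carrier_matD[OF M[of x]] that unfolding sigma_val_def by auto
  show "{x \<in> space N. sigma_val 1 (M x) \<le> t} \<in> sets N"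
  proof (cases "c = 0")
    case True
    then show ?thesis using zero[of 1] t by simp
  qed (use wide tall in \<open>cases "r \<le> c"; auto\<close>)
  show "{x \<in> space N. t \<le> sigma_val r (M x)} \<in> sets N"
    by (cases "r \<le> c") (use wide zero[of r] in auto)
qed

text \<open>
  Entries beyond the last column are unspecified, but they do not depend on the contents of the matrix.
  This is what makes the failure event measurable at sampled lists with elements outside \<open>{..<n}\<close>.
\<close>

lemma index_mat_out_of_range:
  assumes "i < nr" "nc \<le> j"
  shows "Matrix.mat nr nc f $$ (i, j) = ([] :: 'a list) ! (j - nc)"
proof -
  have "Matrix.mat nr nc f $$ (i, j) = mk_mat nr nc f (i, j)" by transfer simp
  also have "\<dots> = map (\<lambda>j. f (i, j)) [0..<nc] ! j"
    using assms unfolding mk_mat_def undef_mat_def by simp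
  also have "\<dots> = (map (\<lambda>j. f (i, j)) [0..<nc] @ []) ! j" by simp
  also have "\<dots> = [] ! (j - nc)" using assms by (subst nth_append) simp
  finally show ?thesis .
qed

lemma transform_entry_measurable:
  assumes F: "F \<in> carrier_mat n n" and k: "k < n"
  shows "(\<lambda>d. (mat_diag n d * F * perm_mat n p) $$ (k, m)) \<in> borel_measurable (circle_product n)"
proof (cases "m < n")
  case True
  show ?thesis unfolding transform_product_index[OF F k True]
    by (intro borel_measurable_sum borel_measurable_times borel_measurable_const circle_component_measurable k)
next
  case False
  have "(mat_diag n d * F * perm_mat n p) $$ (k, m) = [] ! (m - n)" for d
    unfolding times_mat_def[of "mat_diag n d * F"]
    using index_mat_out_of_range[OF k, of n m] False by (simp add: mat_diag_def perm_mat_def)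
  then show ?thesis by simp
qed

lemma product_entry_measurable:
  assumes W: "W \<in> carrier_mat r n" and F: "F \<in> carrier_mat n n" and a: "a < r" and j: "j < length s"
  shows "(\<lambda>d. (W * subsampled_transform F n l (d, p, s)) $$ (a, j)) \<in> borel_measurable (circle_product n)"
proof -
  have "(W * subsampled_transform F n l (d, p, s)) $$ (a, j) =
     (\<Sum>k<n. W $$ (a, k) * (complex_of_real (sqrt (real n / real l)) * (mat_diag n d * F * perm_mat n p) $$ (k, s ! j)))" for d
    using a j carrier_matD[OF W] carrier_matD[OF subsampled_transform_carrier[of F n l d p s]]
    by (subst index_mult_mat(1)) (auto simp: scalar_prod_def lessThan_atLeast0 subsampled_transform_index_col)
  then show ?thesis
    by (auto intro!: borel_measurable_sum borel_measurable_times transform_entry_measurable[OF F])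
qed

text \<open>
  The functions \<open>p\<close> form an uncountable discrete space, but the permutation matrix depends on \<open>p\<close> only
  through \<open>clip n p\<close>, which takes finitely many values. The clipped value \<open>n\<close> stands for all images that hit no row.
\<close>

definition clip :: "nat \<Rightarrow> (nat \<Rightarrow> nat) \<Rightarrow> nat \<Rightarrow> nat" where
  "clip n p j = (if j < n then min (p j) n else 0)"

lemma perm_mat_clip: "perm_mat n (clip n p) = perm_mat n p"
  unfolding perm_mat_def by (rule eq_matI) (auto simp: clip_def)

lemma subsampled_transform_clip: "subsampled_transform F n l (d, clip n p, s) = subsampled_transform F n l (d, p, s)"
  unfolding subsampled_transform_def by (simp add: perm_mat_clip)

lemma finite_range_clip: "finite (range (clip n))"
proof (rule finite_subset)
  show "range (clip n) \<subseteq> (\<lambda>h j. if j < n then h j else 0) ` (PiE {..<n} (\<lambda>_. {..n}))"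
  proof (rule subsetI, elim rangeE)
    fix f p assume "f = clip n p"
    then show "f \<in> (\<lambda>h j. if j < n then h j else 0) ` (PiE {..<n} (\<lambda>_. {..n}))"
      by (intro image_eqI[where x = "restrict (clip n p) {..<n}"]) (auto simp: clip_def fun_eq_iff)
  qed
qed (intro finite_imageI finite_PiE; simp)

definition sample_lists :: "nat \<Rightarrow> nat \<Rightarrow> nat list set" where
  "sample_lists n l = {s. length s = l \<and> distinct s \<and> set s \<subseteq> {..<n}}"

lemma transform_space_eq:
  "transform_space n l = circle_product n \<Otimes>\<^sub>M (measure_pmf (pmf_of_set (perms n)) \<Otimes>\<^sub>M measure_pmf (pmf_of_set (sample_lists n l)))"
  unfolding transform_space_def circle_product_def perms_def sample_lists_def ..

definition failure_event :: "nat \<Rightarrow> nat \<Rightarrow> nat \<Rightarrow> complex mat \<Rightarrow> complex mat \<Rightarrow> ((nat \<Rightarrow> complex) \<times> (nat \<Rightarrow> nat) \<times> nat list) set" where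
  "failure_event n l r F W = {\<omega> \<in> space (transform_space n l). \<not> success r W (W * subsampled_transform F n l \<omega>)}"

lemma failure_event_measurable:
  assumes W: "W \<in> carrier_mat r n" and F: "F \<in> carrier_mat n n" and r: "1 \<le> r" "r \<le> n" and pos: "0 < sigma_val r W"
  shows "failure_event n l r F W \<in> sets (transform_space n l)"
proof -
  let ?N = "circle_product n"
  define A where "A p s = {d \<in> space ?N. \<not> success r W (W * subsampled_transform F n l (d, p, s))}" for p s
  have A: "A p s \<in> sets ?N" for p s
  proof -
    let ?M = "\<lambda>d. W * subsampled_transform F n l (d, p, s)"
    have M: "?M d \<in> carrier_mat r (length s)" for d using mult_carrier_mat[OF W subsampled_transform_carrier] .
    have ent: "(\<lambda>d. ?M d $$ (a, j)) \<in> borel_measurable ?N" if "a < r" "j < length s" for a j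
      by (rule product_entry_measurable[OF W F that])
    have t: "0 \<le> 0.40 * sigma_val r W" "0 \<le> 1.48 * sigma_val 1 W"
      using pos sigma_last_le_first[OF W r] by auto
    have "A p s = space ?N - ({d \<in> space ?N. 0.40 * sigma_val r W \<le> sigma_val r (?M d)} \<inter> {d \<in> space ?N. sigma_val 1 (?M d) \<le> 1.48 * sigma_val 1 W})"
      unfolding A_def success_def by auto
    also have "\<dots> \<in> sets ?N"
      by (intro sets.Diff sets.Int sets.top sigma_measurable[OF M r(1) ent] t)
    finally show ?thesis .
  qed
  have "failure_event n l r F W = (\<Union>p'\<in>range (clip n). \<Union>s. A p' s \<times> ({p. clip n p = p'} \<times> {s}))"
    unfolding failure_event_def A_def transform_space_eq
    by (auto simp: space_pair_measure subsampled_transform_clip) (metis subsampled_transform_clip)+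
  also have "\<dots> \<in> sets (transform_space n l)"
    unfolding transform_space_eq
    by (rule sets.finite_UN[OF finite_range_clip], rule sets.countable_UN''[OF countableI_type], intro pair_measureI A) auto
  finally show ?thesis .
qed

section \<open>The failure probability\<close>

text \<open>
  By flatness, \<open>sqrt l\<close> times a frame vector is a sum as in \<open>circle_sum_norm_tail\<close> whose
  coefficient rows are again orthonormal. The union bound over the \<open>n\<close> frame vectors costs a factor \<open>n\<close>,
  while each tail is at most \<open>exp (- 8 ln (r n))\<close>.
\<close>

lemma bad_diagonal_event:
  assumes F: "flat_unitary n F" and r: "0 < r" and n: "0 < n" and l: "0 < l"
    and rows: "\<And>a b. a < r \<Longrightarrow> b < r \<Longrightarrow> (\<Sum>k<n. q k a * cnj (q k b)) = (if a = b then 1 else 0)"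
  defines "M \<equiv> (sqrt (real r) + sqrt (8 * ln (real r * real n)))\<^sup>2"
  shows "\<exists>B\<in>sets (circle_product n). emeasure (circle_product n) B \<le> ennreal (1 / real r) \<and>
    (\<forall>d\<in>space (circle_product n) - B. (\<forall>k<n. cmod (d k) = 1) \<and>
      (\<forall>J<n. (\<Sum>a<r. (cmod (frame_vector n l F q d J a))\<^sup>2) \<le> M / real l))"
proof -
  let ?N = "circle_product n"
  interpret N: prob_space ?N by (rule prob_space_circle_product)
  define q' where "q' J k a = complex_of_real (sqrt (real n)) * F $$ (k, J) * q k a" for J k a
  define Y where "Y J d = (\<Sum>a<r. (cmod (\<Sum>k<n. d k * q' J k a))\<^sup>2)" for J d
  define E where "E = {d \<in> space ?N. \<exists>k<n. cmod (d k) \<noteq> 1}"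
  define T where "T J = {d \<in> space ?N. M \<le> Y J d}" for J
  have rn: "1 \<le> real r * real n" using mult_mono[of 1 "real r" 1 "real n"] r n by simp
  have [measurable]: "Y J \<in> borel_measurable ?N" for J
  proof -
    have [measurable]: "(\<lambda>d. \<Sum>k<n. d k * q' J k a) \<in> borel_measurable ?N" for a
      by (intro borel_measurable_sum borel_measurable_times borel_measurable_const circle_component_measurable) simp
    show ?thesis unfolding Y_def by measurable
  qed
  have T: "T J \<in> sets ?N" for J unfolding T_def by measurable
  have E: "E \<in> sets ?N"
  proof -
    have [measurable]: "(\<lambda>d. cmod (d k)) \<in> borel_measurable ?N" if "k < n" for k
      using circle_component_measurable[OF that] by measurable
    have "E = (\<Union>k\<in>{..<n}. {d \<in> space ?N. cmod (d k) \<noteq> 1})" unfolding E_def by auto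
    also have "\<dots> \<in> sets ?N" by (intro sets.finite_UN) auto
    finally show ?thesis .
  qed
  have E0: "emeasure ?N E = 0"
  proof -
    have "AE d in ?N. \<forall>k\<in>{..<n}. cmod (d k) = 1"
      unfolding circle_product_def
      by (intro AE_finite_allI AE_PiM_component prob_space_uniform_circle AE_uniform_circle) auto
    then have "AE d in ?N. d \<notin> E" unfolding E_def by (rule AE_mp) auto
    then show ?thesis using AE_iff_null_sets[OF E] null_setsD1 by blast
  qed
  have TJ: "emeasure ?N (T J) \<le> ennreal (1 / (real r * real n))" if J: "J < n" for J
  proof -
    have nF: "complex_of_real (real n) * (F $$ (k, J) * cnj (F $$ (k, J))) = 1" if "k < n" for k
    proof -
      have "(cmod (F $$ (k, J)))\<^sup>2 = 1 / real n" using F J that unfolding flat_unitary_def by auto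
      then show ?thesis using n by (simp add: complex_norm_square[symmetric] del: of_real_power)
    qed
    have rows': "(\<Sum>k<n. q' J k a * cnj (q' J k b)) = (if a = b then 1 else 0)" if "a < r" "b < r" for a b
    proof -
      have "(\<Sum>k<n. q' J k a * cnj (q' J k b)) = (\<Sum>k<n. q k a * cnj (q k b))"
      proof (rule sum.cong[OF refl])
        fix k assume "k \<in> {..<n}"
        have "q' J k a * cnj (q' J k b)
          = (complex_of_real (sqrt (real n) * sqrt (real n)) * (F $$ (k, J) * cnj (F $$ (k, J)))) * (q k a * cnj (q k b))"
          unfolding q'_def by (simp only: complex_cnj_mult complex_cnj_complex_of_real of_real_mult mult_ac)
        also have "sqrt (real n) * sqrt (real n) = real n" by simp
        finally show "q' J k a * cnj (q' J k b) = q k a * cnj (q k b)" using nF[of k] \<open>k \<in> {..<n}\<close> by simp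
      qed
      then show ?thesis using rows[OF that] by simp
    qed
    have "emeasure ?N (T J) \<le> ennreal (exp (- (sqrt (8 * ln (real r * real n)))\<^sup>2))"
      unfolding T_def M_def Y_def by (rule circle_sum_norm_tail[OF rows' r]) (use rn in auto)
    also have "\<dots> \<le> ennreal (exp (- ln (real r * real n)))" using rn by (intro ennreal_leI) simp
    also have "exp (- ln (real r * real n)) = 1 / (real r * real n)" using rn by (simp add: exp_minus inverse_eq_divide)
    finally show ?thesis .
  qed
  define B where "B = E \<union> (\<Union>J\<in>{..<n}. T J)"
  have UT: "(\<Union>J\<in>{..<n}. T J) \<in> sets ?N" by (intro sets.finite_UN T) simp
  have "emeasure ?N B \<le> emeasure ?N E + emeasure ?N (\<Union>J\<in>{..<n}. T J)"
    unfolding B_def by (rule emeasure_subadditive[OF E UT])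
  also have "\<dots> \<le> 0 + (\<Sum>J<n. emeasure ?N (T J))"
    unfolding E0 by (intro add_mono order_refl emeasure_subadditive_finite) (auto simp: T)
  also have "\<dots> \<le> (\<Sum>J<n. ennreal (1 / (real r * real n)))"
    unfolding add_0 by (intro sum_mono TJ) simp
  also have "\<dots> = ennreal (\<Sum>J<n. 1 / (real r * real n))" by (rule sum_ennreal) simp
  also have "(\<Sum>J<n. 1 / (real r * real n)) = 1 / real r" using n by simp
  finally have mB: "emeasure ?N B \<le> ennreal (1 / real r)" .
  have small: "(\<Sum>a<r. (cmod (frame_vector n l F q d J a))\<^sup>2) \<le> M / real l"
    if d: "d \<in> space ?N" "d \<notin> B" and J: "J < n" for d J
  proof -
    have "frame_vector n l F q d J a = complex_of_real (1 / sqrt (real l)) * (\<Sum>k<n. d k * q' J k a)" for a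
      unfolding frame_vector_def q'_def sum_distrib_left
      by (intro sum.cong refl) (simp add: real_sqrt_divide mult_ac)
    then have "(\<Sum>a<r. (cmod (frame_vector n l F q d J a))\<^sup>2) = (\<Sum>a<r. 1 / real l * (cmod (\<Sum>k<n. d k * q' J k a))\<^sup>2)"
      by (simp add: norm_mult power_mult_distrib norm_divide power_divide)
    also have "\<dots> = 1 / real l * Y J d" unfolding Y_def by (rule sum_distrib_left[symmetric])
    also have "\<dots> \<le> 1 / real l * M" using d J unfolding B_def T_def
      by (intro mult_left_mono) (auto simp: not_le intro: less_imp_le)
    finally show ?thesis by simp
  qed
  show ?thesis
  proof (intro bexI[of _ B] conjI ballI allI impI mB)
    show "B \<in> sets ?N" unfolding B_def by (rule sets.Un[OF E UT])
    show "cmod (d k) = 1" if "d \<in> space ?N - B" "k < n" for d k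
      using that unfolding B_def E_def by blast
    show "(\<Sum>a<r. (cmod (frame_vector n l F q d J a))\<^sup>2) \<le> M / real l"
      if "d \<in> space ?N - B" "J < n" for d J
      using small[of d J] that by blast
  qed
qed

text \<open>
  Off the exceptional diagonals, every sampled list leaves at most the fraction \<open>2 / r\<close> of failing
  permutations; integrating over lists and diagonals adds the \<open>1 / r\<close> of the exceptional diagonals.
\<close>

lemma failure_probability:
  assumes F: "flat_unitary n F" and W: "W \<in> carrier_mat r n" and r: "2 \<le> r" "r \<le> n" and ln: "l \<le> n"
    and pos: "0 < sigma_val r W"
    and l: "4 * (sqrt (real r) + sqrt (8 * ln (real r * real n)))\<^sup>2 * ln (real r) \<le> real l"
  shows "emeasure (transform_space n l) (failure_event n l r F W) \<le> ennreal (3 / real r)"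
proof -
  let ?N = "circle_product n" and ?P = "measure_pmf (pmf_of_set (perms n))" and ?S = "measure_pmf (pmf_of_set (sample_lists n l))"
  let ?fail = "failure_event n l r F W"
  let ?A = "\<lambda>d s. (\<lambda>p. (p, s)) -` (Pair d -` ?fail)"
  define M where "M = (sqrt (real r) + sqrt (8 * ln (real r * real n)))\<^sup>2"
  have Fc: "F \<in> carrier_mat n n" using F unfolding flat_unitary_def by simp
  have rM: "real r \<le> M"
  proof -
    have "1 \<le> real r * real n" using mult_mono[of 1 "real r" 1 "real n"] r by simp
    then have "(sqrt (real r))\<^sup>2 \<le> M" unfolding M_def by (intro power_mono) auto
    then show ?thesis by simp
  qed
  have rl: "r \<le> l"
  proof -
    \<comment> \<open>the sample size is at least \<open>4 M ln r \<ge> 2 r\<close>, so that \<open>W H\<close> has at least as many columns as rows\<close>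
    have "1 / 2 \<le> ln (2 :: real)" using ln_le_minus_one[of "1/2 :: real"] by (simp add: ln_div)
    also have "\<dots> \<le> ln (real r)" using r by simp
    finally have "real r * 1 \<le> M * (4 * ln (real r))" using rM r by (intro mult_mono) auto
    then have "real r \<le> real l" using l unfolding M_def[symmetric] by (simp add: mult_ac)
    then show ?thesis by simp
  qed
  obtain q where rows: "\<And>a b. a < r \<Longrightarrow> b < r \<Longrightarrow> (\<Sum>k<n. q k a * cnj (q k b)) = (if a = b then 1 else 0 :: complex)"
    and factor: "\<And>z. \<exists>y. \<forall>k<n. (\<Sum>a<r. cnj (z a) * W $$ (a, k)) = (\<Sum>a<r. cnj (y a) * q k a)"
    using orthonormal_row_factor[OF W _ r(2) pos] r by auto
  have pos0: "0 < r" "0 < n" "0 < l" using r rl by auto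
  obtain B where B: "B \<in> sets ?N" "emeasure ?N B \<le> ennreal (1 / real r)"
    and unit: "\<And>d k. d \<in> space ?N \<Longrightarrow> d \<notin> B \<Longrightarrow> k < n \<Longrightarrow> cmod (d k) = 1"
    and small: "\<And>d J. d \<in> space ?N \<Longrightarrow> d \<notin> B \<Longrightarrow> J < n \<Longrightarrow> (\<Sum>a<r. (cmod (frame_vector n l F q d J a))\<^sup>2) \<le> M / real l"
    using bad_diagonal_event[OF F pos0 rows, folded M_def] by (metis DiffI)
  have fail: "?fail \<in> sets (?N \<Otimes>\<^sub>M (?P \<Otimes>\<^sub>M ?S))"
    using failure_event_measurable[OF W Fc _ r(2) pos, of l] r unfolding transform_space_eq by simp
  interpret N: prob_space ?N by (rule prob_space_circle_product)
  interpret PS: pair_prob_space ?P ?S by unfold_locales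
  have S: "finite (sample_lists n l)" "sample_lists n l \<noteq> {}"
  proof -
    show "finite (sample_lists n l)" unfolding sample_lists_def
      by (rule finite_subset[OF _ finite_lists_length_eq[of "{..<n}" l]]) auto
    have "[0..<l] \<in> sample_lists n l" unfolding sample_lists_def using ln by auto
    then show "sample_lists n l \<noteq> {}" by auto
  qed
  have "id \<in> perms n" unfolding perms_def by (simp add: permutes_id)
  then have pne: "perms n \<noteq> {}" by auto
  have slice: "emeasure (?P \<Otimes>\<^sub>M ?S) (Pair d -` ?fail) \<le> ennreal (2 / real r)" if d: "d \<in> space ?N" "d \<notin> B" for d
  proof -
    have "emeasure (?P \<Otimes>\<^sub>M ?S) (Pair d -` ?fail) = (\<integral>\<^sup>+s. emeasure ?P (?A d s) \<partial>?S)"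
      by (rule PS.emeasure_pair_measure_alt2) (rule sets_Pair1[OF fail])
    also have "\<dots> \<le> (\<integral>\<^sup>+s. ennreal (2 / real r) \<partial>?S)"
    proof (rule nn_integral_mono_AE, rule AE_pmfI)
      fix s assume "s \<in> set_pmf (pmf_of_set (sample_lists n l))"
      then have s: "length s = l" "distinct s" "set s \<subseteq> {..<n}" using S by (auto simp: sample_lists_def)
      have "perms n \<inter> ?A d s \<subseteq> {p \<in> perms n. \<not> success r W (W * subsampled_transform F n l (d, p, s))}"
        unfolding failure_event_def by auto
      then have "real (card (perms n \<inter> ?A d s)) \<le> real (card {p \<in> perms n. \<not> success r W (W * subsampled_transform F n l (d, p, s))})"
        by (intro of_nat_mono card_mono) auto
      also have "\<dots> \<le> fact n * (2 / real r)"
      proof (rule failing_permutations_count[OF W F s r(1) rl ln pos rows factor])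
        show "cmod (d k) = 1" if "k < n" for k by (rule unit[OF d that])
        show "0 < M / real l" using rM r rl by simp
        show "M / real l * (4 * ln (real r)) \<le> 1" using l r rl unfolding M_def[symmetric] by (simp add: field_simps)
        show "(\<Sum>a<r. (cmod (frame_vector n l F q d J a))\<^sup>2) \<le> M / real l" if "J < n" for J by (rule small[OF d that])
      qed
      finally have "real (card (perms n \<inter> ?A d s)) / fact n \<le> 2 / real r"
        by (simp add: field_simps)
      then show "emeasure ?P (?A d s) \<le> ennreal (2 / real r)"
        by (simp add: emeasure_pmf_of_set[OF pne finite_perms] card_perms ennreal_leI)
    qed
    also have "\<dots> = ennreal (2 / real r)" by (simp add: measure_pmf.emeasure_space_1[simplified])
    finally show ?thesis .
  qed
  have "emeasure (transform_space n l) ?fail = (\<integral>\<^sup>+d. emeasure (?P \<Otimes>\<^sub>M ?S) (Pair d -` ?fail) \<partial>?N)"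
    unfolding transform_space_eq by (rule PS.P.emeasure_pair_measure_alt[OF fail])
  also have "\<dots> \<le> (\<integral>\<^sup>+d. indicator B d + ennreal (2 / real r) \<partial>?N)"
  proof (rule nn_integral_mono)
    fix d assume d: "d \<in> space ?N"
    show "emeasure (?P \<Otimes>\<^sub>M ?S) (Pair d -` ?fail) \<le> indicator B d + ennreal (2 / real r)"
    proof (cases "d \<in> B")
      case True
      have "emeasure (?P \<Otimes>\<^sub>M ?S) (Pair d -` ?fail) \<le> 1" by (rule PS.P.emeasure_le_1)
      also have "\<dots> \<le> indicator B d + ennreal (2 / real r)" using True by simp
      finally show ?thesis .
    qed (use slice[OF d] in simp)
  qed
  also have "\<dots> = emeasure ?N B + ennreal (2 / real r)"
    using B(1) N.emeasure_space_1 by (subst nn_integral_add) auto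
  also have "\<dots> \<le> ennreal (1 / real r) + ennreal (2 / real r)" using B(2) by (intro add_mono) auto
  also have "\<dots> = ennreal (3 / real r)" by (simp add: ennreal_plus[symmetric] add_divide_distrib[symmetric] del: ennreal_plus)
  finally show ?thesis .
qed

theorem corollary85:
  shows "\<exists>C::real. \<forall>(n::nat) (l::nat) (r::nat) (F::complex mat) (W::complex mat).
    F = unitary_dft n \<or> (\<exists>k. n = 2 ^ k \<and> F = unitary_hadamard k) \<longrightarrow>
    1 \<le> r \<longrightarrow>
    4 * (sqrt (real r) + sqrt (8 * ln (real r * real n)))\<^sup>2 * ln (real r) \<le> real l \<longrightarrow>
    l \<le> n \<longrightarrow>
    W \<in> carrier_mat r n \<longrightarrow>
    sigma_val r W > 0 \<longrightarrow>
    (let failure = {\<omega> \<in> space (transform_space n l).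
           \<not> (0.40 * sigma_val r W \<le> sigma_val r (W * subsampled_transform F n l \<omega>) \<and>
              sigma_val 1 (W * subsampled_transform F n l \<omega>) \<le> 1.48 * sigma_val 1 W)}
     in failure \<in> sets (transform_space n l) \<and>
        measure (transform_space n l) failure \<le> C / real r)"
proof (intro exI[of _ "3 :: real"] allI impI)
  fix n l r :: nat and F W :: "complex mat"
  assume F: "F = unitary_dft n \<or> (\<exists>k. n = 2 ^ k \<and> F = unitary_hadamard k)"
    and r: "1 \<le> r"
    and l: "4 * (sqrt (real r) + sqrt (8 * ln (real r * real n)))\<^sup>2 * ln (real r) \<le> real l"
    and ln: "l \<le> n" and W: "W \<in> carrier_mat r n" and pos: "sigma_val r W > 0"
  have F: "flat_unitary n F" using F flat_unitary_dft flat_unitary_hadamard by auto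
  then have Fc: "F \<in> carrier_mat n n" unfolding flat_unitary_def by simp
  have rn: "r \<le> n"
    using pos length_singular_values[of W] carrier_matD[OF W] unfolding sigma_val_def by (auto split: if_splits)
  have meas: "failure_event n l r F W \<in> sets (transform_space n l)"
    by (rule failure_event_measurable[OF W Fc r rn pos])
  interpret N: prob_space "circle_product n" by (rule prob_space_circle_product)
  interpret PS: pair_prob_space "measure_pmf (pmf_of_set (perms n))" "measure_pmf (pmf_of_set (sample_lists n l))" by unfold_locales
  interpret T: pair_prob_space "circle_product n" "measure_pmf (pmf_of_set (perms n)) \<Otimes>\<^sub>M measure_pmf (pmf_of_set (sample_lists n l))" by unfold_locales
  let ?p = "measure (transform_space n l) (failure_event n l r F W)"
  have "?p \<le> 3 / real r"
  proof (cases "r = 1")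
    case True
    have "?p \<le> 1"
      unfolding transform_space_eq by (rule T.P.prob_le_1)
    then show ?thesis using True by simp
  next
    case False
    then have "2 \<le> r" using r by simp
    from failure_probability[OF F W this rn ln pos l]
    have "emeasure (transform_space n l) (failure_event n l r F W) \<le> ennreal (3 / real r)" .
    then show ?thesis unfolding transform_space_eq by (simp add: T.P.emeasure_eq_measure)
  qed
  then show "let failure = {\<omega> \<in> space (transform_space n l).
           \<not> (0.40 * sigma_val r W \<le> sigma_val r (W * subsampled_transform F n l \<omega>) \<and>
              sigma_val 1 (W * subsampled_transform F n l \<omega>) \<le> 1.48 * sigma_val 1 W)}
     in failure \<in> sets (transform_space n l) \<and>
        measure (transform_space n l) failure \<le> 3 / real r"
    using meas unfolding failure_event_def success_def Let_def by blast
qed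

end
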